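(* Let $\Bbbk$ be an algebraically closed field and let $N\geqslant 3$. Fix an integer $m\geqslant 1$. Let $s\geqslant 1$ be an integer, write $\sqrt[N]{s}=k+\epsilon$ with $k$ an integer and $0\leqslant\epsilon<1$, and suppose that $$s\;\geqslant\;\left(\frac{(1+\epsilon)\,2m}{N-1}+1+\epsilon\right)^{N}.$$ If $I$ is the defining ideal of a set of $s$ general points in $\mathbb{P}^N_{\Bbbk}$, then $$\widehat{\alpha}(I)\;\geqslant\;\frac{\alpha(I^{(m)})+N-1}{m+N-1}.$$
   Context: Let $R=\Bbbk[x_0,\dots,x_N]$ be the homogeneous coordinate ring of $\mathbb{P}^N_{\Bbbk}$. For a homogeneous ideal $J$, $\alpha(J)$ denotes its initial degree, i.e. the least degree of a nonzero homogeneous element of $J$. The $m$-th symbolic power of a homogeneous ideal $I$ is $I^{(m)}=\bigcap_{\mathfrak p\in \mathrm{Ass}(I)} (I^mR_{\mathfrak p}\cap R)$; when $I$ is the defining ideal of finitely many reduced points with point ideals $\mathfrak p_1,\dots,\mathfrak p_s$, $I^{(m)}=\mathfrak p_1^m\cap\dots\cap\mathfrak p_s^m$. The Waldschmidt constant of $I$ is $\widehat{\alpha}(I)=\lim_{t\to\infty}\alpha(I^{(t)})/t=\inf_{t\geqslant 1}\alpha(I^{(t)})/t$. General points: for $\underline a=(a_{i,j})_{1\le i\le s,\,0\le j\le N}\in\mathbb{A}^{s(N+1)}_{\Bbbk}$ let $\mathbb{X}(\underline a)=\{P_1(\underline a),\dots,P_s(\underline a)\}$ with $P_i(\underline a)=[a_{i,0}:\dots:a_{i,N}]$.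 A property holds for $s$ general points in $\mathbb{P}^N_{\Bbbk}$ if there is a nonempty Zariski open subset $U\subset\mathbb{A}^{s(N+1)}_{\Bbbk}$ such that the property holds for $\mathbb{X}(\underline a)$ for every $\underline a\in U$. Here the open set may depend on $s,m,N$. *)

theory Defs
  imports
    Complex_Main
    "HOL-Library.Poly_Mapping"
    "HOL-Library.FuncSet"
    "HOL-Algebra.Ideal_Product"
    "HOL-Computational_Algebra.Polynomial"
    "HOL-Computational_Algebra.Fraction_Field"
begin


section \<open>Polynomial rings and affine space\<close>

text \<open>A monomial is a finitely supported exponent function on the variables, and a polynomial
  is a finitely supported function from monomials to coefficients.  The type has one variable
  for each element of \<open>'v\<close>; the ring only uses the variables in \<open>V\<close>.\<close>

type_synonym ('v, 'k) mpoly = "('v \<Rightarrow>\<^sub>0 nat) \<Rightarrow>\<^sub>0 'k"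

definition poly_ring :: "'v set \<Rightarrow> ('v, 'k::comm_ring_1) mpoly ring" where
  "poly_ring V = \<lparr> carrier = {f. \<forall>\<mu>\<in>Poly_Mapping.keys f. Poly_Mapping.keys \<mu> \<subseteq> V},
     monoid.mult = (*), one = 1, zero = 0, add = (+) \<rparr>"

definition poly_eval :: "('v \<Rightarrow> 'k::comm_ring_1) \<Rightarrow> ('v, 'k) mpoly \<Rightarrow> 'k" where
  "poly_eval a f = (\<Sum>\<mu>\<in>Poly_Mapping.keys f. Poly_Mapping.lookup f \<mu> *
     (\<Prod>i\<in>Poly_Mapping.keys \<mu>. a i ^ Poly_Mapping.lookup \<mu> i))"

definition homogeneous :: "nat \<Rightarrow> ('v, 'k::zero) mpoly \<Rightarrow> bool" where
  "homogeneous d f \<longleftrightarrow>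
     (\<forall>\<mu>\<in>Poly_Mapping.keys f. (\<Sum>i\<in>Poly_Mapping.keys \<mu>. Poly_Mapping.lookup \<mu> i) = d)"

definition affine_space :: "'v set \<Rightarrow> ('v \<Rightarrow> 'k) set" where
  "affine_space V = V \<rightarrow>\<^sub>E UNIV"

definition zero_locus :: "'v set \<Rightarrow> ('v, 'k::comm_ring_1) mpoly set \<Rightarrow> ('v \<Rightarrow> 'k) set" where
  "zero_locus V S = {a \<in> affine_space V. \<forall>f\<in>S. poly_eval a f = 0}"

definition zariski_open :: "'v set \<Rightarrow> ('v \<Rightarrow> 'k::comm_ring_1) set \<Rightarrow> bool" where
  "zariski_open V U \<longleftrightarrow>
     (\<exists>S \<subseteq> carrier (poly_ring V). U = affine_space V - zero_locus V S)"


section \<open>Symbolic powers\<close>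

text \<open>In this section \<open>R\<close> is a subring of the ambient integral domain \<open>'a\<close>, so that its
  localizations are subrings of the fraction field of \<open>'a\<close>.\<close>

definition localization :: "'a::idom ring \<Rightarrow> 'a set \<Rightarrow> 'a fract ring" where
  "localization R p = \<lparr> carrier = {Fract a b | a b. a \<in> carrier R \<and> b \<in> carrier R - p},
     monoid.mult = (*), one = 1, zero = 0, add = (+) \<rparr>"

text \<open>The contraction \<open>J R\<^sub>p \<inter> R\<close>.\<close>

definition local_contraction :: "'a::idom ring \<Rightarrow> 'a set \<Rightarrow> 'a set \<Rightarrow> 'a set" where
  "local_contraction R p J =
     {f \<in> carrier R. Fract f 1 \<in> Idl\<^bsub>localization R p\<^esub> ((\<lambda>g. Fract g 1) ` J)}"

text \<open>\<open>Ass(I)\<close> is the set of associated primes of the module \<open>R/I\<close>, i.e. the primes of the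
  form \<open>(I : f)\<close>.\<close>

definition associated_primes :: "'a ring \<Rightarrow> 'a set \<Rightarrow> 'a set set" where
  "associated_primes R I =
     {p. primeideal p R \<and> (\<exists>f\<in>carrier R. p = {g \<in> carrier R. g \<otimes>\<^bsub>R\<^esub> f \<in> I})}"

definition symbolic_power :: "'a::idom ring \<Rightarrow> 'a set \<Rightarrow> nat \<Rightarrow> 'a set" where
  "symbolic_power R I m =
     {f \<in> carrier R. \<forall>p\<in>associated_primes R I.
        f \<in> local_contraction R p (I [^]\<^bsub>ideals_set R\<^esub> m)}"


section \<open>Initial degree and Waldschmidt constant\<close>

definition initial_degree :: "('v, 'k::zero) mpoly set \<Rightarrow> nat" where
  "initial_degree J = (LEAST d. \<exists>f\<in>J. f \<noteq> 0 \<and> homogeneous d f)"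

definition waldschmidt ::
  "('v::linorder, 'k::idom) mpoly ring \<Rightarrow> ('v, 'k) mpoly set \<Rightarrow> real" where
  "waldschmidt R I = lim (\<lambda>t. real (initial_degree (symbolic_power R I t)) / real t)"


section \<open>General points in projective space\<close>

text \<open>The point \<open>[v\<^sub>0 : \<dots> : v\<^sub>N]\<close> is the set of all its homogeneous coordinate vectors; it is a
  point of projective space when \<open>v\<close> is not zero.\<close>

definition proj_point :: "nat \<Rightarrow> (nat \<Rightarrow> 'k::field) \<Rightarrow> (nat \<Rightarrow> 'k) set" where
  "proj_point N v = {(\<lambda>j\<in>{0..N}. c * v j) | c. c \<noteq> 0}"

definition defining_ideal ::
  "nat \<Rightarrow> (nat \<Rightarrow> 'k::field) set set \<Rightarrow> (nat, 'k) mpoly set" where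
  "defining_ideal N X = Idl\<^bsub>poly_ring {0..N}\<^esub>
     {f \<in> carrier (poly_ring {0..N}). (\<exists>d. homogeneous d f) \<and>
        (\<forall>P\<in>X. \<forall>v\<in>P. poly_eval v f = 0)}"

text \<open>The requirement that every row of \<open>a\<close> be nonzero says that the points \<open>P\<^sub>i(a)\<close> are
  defined on all of \<open>U\<close>.\<close>

definition holds_for_general_points ::
  "nat \<Rightarrow> nat \<Rightarrow> ((nat \<Rightarrow> 'k::field) set set \<Rightarrow> bool) \<Rightarrow> bool" where
  "holds_for_general_points N s Q \<longleftrightarrow>
     (\<exists>U. zariski_open ({1..s} \<times> {0..N}) U \<and> U \<noteq> {} \<and>
        (\<forall>a\<in>U. (\<forall>i\<in>{1..s}. \<exists>j\<in>{0..N}. a (i, j) \<noteq> 0) \<and>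
           Q ((\<lambda>i. proj_point N (\<lambda>j. a (i, j))) ` {1..s})))"

end

theory Submission
  imports Defs
begin

text \<open>The quotient on the right is bounded from above by linear algebra, the Waldschmidt constant
  from below by a degeneration, and the hypothesis on \<open>s\<close> is what makes the two bounds meet.

  An \<open>m\<close>-fold point imposes at most \<open>m + N - 1 choose N\<close> linear conditions on forms of degree \<open>d\<close>, so
  \<open>\<alpha>(I\<^sup>(\<^sup>m\<^sup>)) \<le> d\<close> as soon as \<open>s * (m + N - 1 choose N) < (d + N choose N)\<close>
  (\<open>symbolic_power_degree_bound\<close>). It remains to show that the Waldschmidt constant is at least
  \<open>\<theta> = (d + N - 1) / (m + N - 1)\<close>.

  Let \<open>k\<close> be the integer part of the \<open>N\<close>-th root of \<open>s\<close>. The grid of \<open>k\<^sup>N\<close> points has Waldschmidt constant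
  \<open>k\<close>: a form of degree less than \<open>k t\<close> vanishing to order \<open>t\<close> on the grid is divisible by the \<open>k\<close>
  parallel hyperplanes covering it. The constant \<open>k\<close> exceeds \<open>\<theta>\<close> for a suitable \<open>d\<close>, unless \<open>k = 2\<close> and the
  fractional part \<open>\<epsilon>\<close> is large, more than the inverse of the golden ratio. Then \<open>s\<close> is so much larger
  than \<open>2\<^sup>N\<close> that there is room for more points: those of the grid on one more letter in which the
  additional letter occurs at most \<open>r\<close> times, with \<open>r\<close> a fixed fraction of \<open>N\<close>. Their constant is at least
  \<open>alpha_bound k N r\<close>, which is larger than \<open>k\<close> (\<open>special_configuration_bound\<close>), and the numerical lemma
  \<open>configuration_exists\<close> finds \<open>r\<close> and \<open>d\<close> with \<open>\<theta> < alpha_bound k N r\<close>.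

  Since this inequality is strict, there are \<open>t\<close> and \<open>e\<close> with \<open>e \<ge> \<theta> (t + N + 1)\<close> such that no nonzero
  form of degree \<open>e\<close> vanishes to order \<open>t\<close> on the special configuration. This is a rank condition, hence it
  holds on a nonempty open set of configurations. Therefore the theorem follows from the inequality
  \<open>\<theta> \<le> e / (t + N + 1) \<le> D / T\<close> for every nonzero form of degree \<open>D\<close> vanishing to order \<open>T\<close> at such
  points (\<open>degree_lower_bound\<close>): one order of vanishing controls all others. Usually this is derived from
  the containments between symbolic and ordinary powers. In characteristic \<open>p\<close> it has a direct proof.
  Write \<open>F = \<Sum>\<^sub>b x\<^sup>b G\<^sub>b\<^sup>p\<close>, the exponents \<open>b\<close> having entries below \<open>p\<close>. If \<open>F\<close> vanishes to an order
  close to \<open>p t\<close> at a point, then all \<open>G\<^sub>b\<close> vanish to order \<open>t\<close> there, while their degrees are at most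
  \<open>deg F / p\<close> (\<open>frobenius_descent\<close>). Applying this repeatedly to a power of \<open>F\<close> gives a form of degree at
  most \<open>e\<close> and order \<open>t\<close>, unless \<open>D / T\<close> is as large as claimed.

  Characteristic zero is reduced to this case inside the field itself. The field has a valuation
  ring with residue characteristic \<open>p > 0\<close> in which finitely many prescribed nonzero elements are
  units (\<open>units_of_valuation_ring\<close>), and the descent works modulo its maximal ideal. The rank
  condition is witnessed by a polynomial \<open>\<Delta>\<close> in the coordinates of the points with integer coefficients
  (\<open>independence_certificate\<close>). So the condition \<open>\<Delta> \<noteq> 0\<close> does not depend on any valuation, and for
  each configuration satisfying it the valuation ring can be chosen such that \<open>\<Delta>\<close> stays nonzero in the residue field.\<close>

section \<open>Valuation rings of positive residue characteristic\<close>

definition subring_of :: "'k::field set \<Rightarrow> bool" where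
  "subring_of B \<longleftrightarrow> 1 \<in> B \<and> (\<forall>x\<in>B. \<forall>y\<in>B. x - y \<in> B \<and> x * y \<in> B)"

definition valuation_ring :: "'k::field set \<Rightarrow> bool" where
  "valuation_ring A \<longleftrightarrow> subring_of A \<and> (\<forall>x. x \<in> A \<or> inverse x \<in> A)"

definition max_ideal :: "'k::field set \<Rightarrow> 'k set" where
  "max_ideal A = {x \<in> A. x = 0 \<or> inverse x \<notin> A}"

lemma subring_of_one: "subring_of B \<Longrightarrow> 1 \<in> B"
  and subring_of_diff: "subring_of B \<Longrightarrow> x \<in> B \<Longrightarrow> y \<in> B \<Longrightarrow> x - y \<in> B"
  and subring_of_mult: "subring_of B \<Longrightarrow> x \<in> B \<Longrightarrow> y \<in> B \<Longrightarrow> x * y \<in> B"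
  by (auto simp: subring_of_def)

lemma subring_of_zero: "subring_of B \<Longrightarrow> 0 \<in> B"
  using subring_of_diff[of B 1 1] subring_of_one by force

lemma subring_of_uminus: "subring_of B \<Longrightarrow> x \<in> B \<Longrightarrow> - x \<in> B"
  using subring_of_diff[of B 0 x] subring_of_zero by force

lemma subring_of_add: "subring_of B \<Longrightarrow> x \<in> B \<Longrightarrow> y \<in> B \<Longrightarrow> x + y \<in> B"
  using subring_of_diff[of B x "- y"] subring_of_uminus by force

lemma subring_of_sum: "subring_of B \<Longrightarrow> (\<And>i. i \<in> I \<Longrightarrow> f i \<in> B) \<Longrightarrow> sum f I \<in> B"
  by (induction I rule: infinite_finite_induct) (auto intro: subring_of_add subring_of_zero)

lemma subring_of_prod: "subring_of B \<Longrightarrow> (\<And>i. i \<in> I \<Longrightarrow> f i \<in> B) \<Longrightarrow> prod f I \<in> B"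
  by (induction I rule: infinite_finite_induct) (auto intro: subring_of_mult subring_of_one)

lemma subring_of_power: "subring_of B \<Longrightarrow> x \<in> B \<Longrightarrow> x ^ n \<in> B"
  by (induction n) (auto intro: subring_of_mult subring_of_one)

lemma subring_of_nat: "subring_of B \<Longrightarrow> of_nat n \<in> B"
  by (induction n) (auto intro: subring_of_add subring_of_one subring_of_zero)

lemma subring_of_poly:
  "subring_of B \<Longrightarrow> x \<in> B \<Longrightarrow> (\<And>i. coeff q i \<in> B) \<Longrightarrow> poly q x \<in> B"
  unfolding poly_altdef by (intro subring_of_sum subring_of_mult subring_of_power) auto

lemma valuation_ring_subring: "valuation_ring A \<Longrightarrow> subring_of A"
  by (simp add: valuation_ring_def)

lemma max_ideal_subset: "x \<in> max_ideal A \<Longrightarrow> x \<in> A"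
  by (simp add: max_ideal_def)

lemma max_ideal_zero: "valuation_ring A \<Longrightarrow> 0 \<in> max_ideal A"
  by (simp add: max_ideal_def subring_of_zero valuation_ring_subring)

lemma max_ideal_one: "valuation_ring A \<Longrightarrow> 1 \<notin> max_ideal A"
  by (simp add: max_ideal_def subring_of_one valuation_ring_subring)

lemma max_ideal_mult:
  assumes "valuation_ring A" "x \<in> max_ideal A" "y \<in> A"
  shows "x * y \<in> max_ideal A" "y * x \<in> max_ideal A"
proof -
  have A: "subring_of A" using assms by (simp add: valuation_ring_def)
  show "x * y \<in> max_ideal A"
  proof (cases "x * y = 0")
    case False
    have "inverse (x * y) \<notin> A"
    proof
      assume "inverse (x * y) \<in> A"
      hence "y * inverse (x * y) \<in> A" using A assms(3) subring_of_mult by blast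
      moreover have "y * inverse (x * y) = inverse x" using False by simp
      ultimately have "inverse x \<in> A" by argo
      thus False using assms(2) False by (auto simp: max_ideal_def)
    qed
    thus ?thesis using A assms by (auto simp: max_ideal_def subring_of_mult)
  next
    case True thus ?thesis using max_ideal_zero[OF assms(1)] by argo
  qed
  thus "y * x \<in> max_ideal A" by (simp add: mult.commute)
qed

lemma max_ideal_add:
  assumes "valuation_ring A" "x \<in> max_ideal A" "y \<in> max_ideal A"
  shows "x + y \<in> max_ideal A"
proof -
  have A: "subring_of A" using assms by (simp add: valuation_ring_def)
  have *: "u + v \<in> max_ideal A" if "u \<in> max_ideal A" "v \<in> max_ideal A" "u \<noteq> 0" "v / u \<in> A" for u v
  proof -
    have "u + v = u * (1 + v / u)" using that by (simp add: field_simps)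
    thus ?thesis using max_ideal_mult(1)[OF assms(1) that(1), of "1 + v / u"] that A
      by (simp add: subring_of_add subring_of_one)
  qed
  show ?thesis
  proof (cases "x = 0 \<or> y = 0")
    case False
    have "y / x \<in> A \<or> x / y \<in> A" using assms(1) by (metis inverse_divide valuation_ring_def)
    thus ?thesis using *[of x y] *[of y x] False assms(2,3) by (auto simp: add.commute)
  qed (use assms in auto)
qed

lemma max_ideal_uminus: "valuation_ring A \<Longrightarrow> x \<in> max_ideal A \<Longrightarrow> - x \<in> max_ideal A"
  by (auto simp: max_ideal_def subring_of_uminus valuation_ring_subring)
    (metis minus_minus subring_of_uminus valuation_ring_subring)

lemma max_ideal_diff:
  "valuation_ring A \<Longrightarrow> x \<in> max_ideal A \<Longrightarrow> y \<in> max_ideal A \<Longrightarrow> x - y \<in> max_ideal A"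
  using max_ideal_add[of A x "- y"] max_ideal_uminus[of A y] by simp

lemma max_ideal_sum:
  "valuation_ring A \<Longrightarrow> (\<And>i. i \<in> I \<Longrightarrow> f i \<in> max_ideal A) \<Longrightarrow> sum f I \<in> max_ideal A"
  by (induction I rule: infinite_finite_induct) (auto intro: max_ideal_add max_ideal_zero)

lemma max_ideal_prime:
  assumes "valuation_ring A" "x \<in> A" "y \<in> A" "x * y \<in> max_ideal A"
  shows "x \<in> max_ideal A \<or> y \<in> max_ideal A"
proof (rule ccontr)
  assume "\<not> ?thesis"
  hence "inverse x \<in> A" "x \<noteq> 0" "y \<notin> max_ideal A" using assms by (auto simp: max_ideal_def)
  moreover have "y = (x * y) * inverse x" using \<open>x \<noteq> 0\<close> by simp
  ultimately show False using max_ideal_mult(1)[OF assms(1,4), of "inverse x"] by argo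
qed

lemma max_ideal_power:
  assumes "valuation_ring A" "x \<in> A" "x ^ n \<in> max_ideal A"
  shows "x \<in> max_ideal A"
  using assms(3)
proof (induction n)
  case 0 thus ?case using max_ideal_one[OF assms(1)] by simp
next
  case (Suc n) thus ?case
    using max_ideal_prime[OF assms(1,2), of "x ^ n"] assms
    by (auto simp: subring_of_power valuation_ring_subring)
qed

lemma inverse_in_max_ideal:
  "valuation_ring A \<Longrightarrow> x \<notin> A \<Longrightarrow> inverse x \<in> max_ideal A"
  by (auto simp: max_ideal_def valuation_ring_def)

lemma valuation_ring_power_closed:
  assumes "valuation_ring A" "x ^ n \<in> A" "n > 0"
  shows "x \<in> A"
proof (rule ccontr)
  assume "x \<notin> A"
  hence i: "inverse x \<in> max_ideal A" by (rule inverse_in_max_ideal[OF assms(1)])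
  have x0: "x \<noteq> 0" using \<open>x \<notin> A\<close> subring_of_zero[OF valuation_ring_subring[OF assms(1)]] by auto
  have "inverse x ^ (n - 1) \<in> A"
    using i assms by (intro subring_of_power) (auto simp: valuation_ring_subring max_ideal_subset)
  hence "inverse x * inverse x ^ (n - 1) \<in> max_ideal A" by (rule max_ideal_mult(1)[OF assms(1) i])
  hence "inverse x ^ n \<in> max_ideal A" using \<open>n > 0\<close> by (metis power_eq_if neq0_conv)
  hence "inverse x ^ n * x ^ n \<in> max_ideal A" using assms(1,2) by (auto intro: max_ideal_mult)
  moreover have "inverse x ^ n * x ^ n = 1" using x0 by (simp flip: power_mult_distrib)
  ultimately show False using max_ideal_one[OF assms(1)] by simp
qed

text \<open>Divide by an entry of largest valuation.\<close>
lemma valuation_ring_normalize: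
  assumes "valuation_ring A" "finite S" "x0 \<in> S" "x0 \<noteq> 0"
  shows "\<exists>c. c \<noteq> 0 \<and> (\<forall>x\<in>S. c * x \<in> A) \<and> (\<exists>x\<in>S. c * x = 1)"
  using assms(2,3,4)
proof (induction S arbitrary: x0 rule: finite_induct)
  case (insert y F)
  have A: "subring_of A" by (rule valuation_ring_subring[OF assms(1)])
  show ?case
  proof (cases "\<exists>x\<in>F. x \<noteq> 0")
    case True
    then obtain c z where c: "c \<noteq> 0" "\<forall>x\<in>F. c * x \<in> A" "z \<in> F" "c * z = 1"
      using insert.IH by blast
    show ?thesis
    proof (cases "c * y \<in> A")
      case True thus ?thesis using c by (intro exI[of _ c]) auto
    next
      case False
      hence i: "inverse (c * y) \<in> A" using assms(1) by (auto simp: valuation_ring_def)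
      have y0: "y \<noteq> 0" using False subring_of_zero[OF A] by auto
      have "inverse y * x \<in> A" if "x \<in> F" for x
      proof -
        have "inverse y * x = inverse (c * y) * (c * x)" using c(1) y0 by (simp add: field_simps)
        moreover have "c * x \<in> A" using c that by blast
        ultimately show ?thesis using subring_of_mult[OF A i, of "c * x"] by argo
      qed
      thus ?thesis using y0 subring_of_one[OF A] by (intro exI[of _ "inverse y"]) auto
    qed
  next
    case False
    hence "y \<noteq> 0" using insert.prems by auto
    thus ?thesis using False subring_of_one[OF A] subring_of_zero[OF A]
      by (intro exI[of _ "inverse y"]) auto
  qed
qed simp

text \<open>Otherwise adjoining the inverse of \<open>u = 1 - x v\<close> would enlarge \<open>V\<close>. The larger ring
  still misses \<open>1/x\<close>, because every power of \<open>u\<close> is congruent to \<open>1\<close> modulo \<open>x V\<close>.\<close>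
lemma maximal_subring_unit:
  assumes V: "subring_of V" "inverse x \<notin> V" "x \<in> V" "x \<noteq> 0"
    and max: "\<And>W. subring_of W \<Longrightarrow> V \<subseteq> W \<Longrightarrow> inverse x \<notin> W \<Longrightarrow> W = V"
    and v: "v \<in> V"
  shows "inverse (1 - x * v) \<in> V"
proof -
  define u where "u = 1 - x * v"
  have uV: "u \<in> V" unfolding u_def using V v by (intro subring_of_diff subring_of_mult subring_of_one)
  have u0: "u \<noteq> 0"
  proof
    assume "u = 0"
    hence "inverse x = v" using V(4) by (auto simp: u_def field_simps)
    thus False using v V by simp
  qed
  have pw: "\<exists>w\<in>V. u ^ n = 1 - x * w" for n
  proof (induction n)
    case 0 show ?case using subring_of_zero[OF V(1)] by (intro bexI[of _ 0]) auto
  next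
    case (Suc n)
    then obtain w where w: "w \<in> V" "u ^ n = 1 - x * w" by auto
    have "u ^ Suc n = 1 - x * (v + w - x * v * w)" unfolding power_Suc w(2) by (simp add: u_def algebra_simps)
    moreover have "v + w - x * v * w \<in> V"
      using V v w by (intro subring_of_diff subring_of_mult subring_of_add)
    ultimately show ?case by blast
  qed
  define W where "W = {w / u ^ n | w n. w \<in> V}"
  have VW: "V \<subseteq> W"
  proof
    fix y assume "y \<in> V"
    thus "y \<in> W" unfolding W_def by (intro CollectI exI[of _ y] exI[of _ "0::nat"]) auto
  qed
  have "subring_of W"
    unfolding subring_of_def
  proof (intro conjI ballI)
    show "1 \<in> W" using VW V subring_of_one by auto
    fix a b assume "a \<in> W" "b \<in> W"
    then obtain p q m n where *: "a = p / u ^ m" "b = q / u ^ n" "p \<in> V" "q \<in> V"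
      unfolding W_def by blast
    have "a - b = (p * u ^ n - q * u ^ m) / u ^ (m + n)" "a * b = (p * q) / u ^ (m + n)"
      using u0 * by (auto simp: field_simps power_add)
    moreover have "p * u ^ n - q * u ^ m \<in> V" "p * q \<in> V"
      using * V uV by (auto intro!: subring_of_diff subring_of_mult subring_of_power)
    ultimately show "a - b \<in> W" "a * b \<in> W" unfolding W_def by blast+
  qed
  moreover have "inverse x \<notin> W"
  proof
    assume "inverse x \<in> W"
    then obtain w n where w: "w \<in> V" "inverse x = w / u ^ n" unfolding W_def by auto
    obtain w' where w': "w' \<in> V" "u ^ n = 1 - x * w'" using pw by auto
    have "u ^ n = x * w" using w(2) u0 V(4) by (simp add: field_simps)
    hence "x * (w + w') = 1" using w'(2) by (simp add: algebra_simps)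
    hence "inverse x = w + w'" by (simp add: inverse_unique)
    thus False using V w w' subring_of_add by metis
  qed
  ultimately have "W = V" using max VW by blast
  moreover have "inverse u \<in> W" unfolding W_def using subring_of_one[OF V(1)]
    by (auto intro!: exI[of _ "1"] exI[of _ "1::nat"] simp: field_simps)
  ultimately show ?thesis by (simp add: u_def)
qed

definition adjoin :: "'k::field set \<Rightarrow> 'k \<Rightarrow> 'k set" where
  "adjoin B x = {poly q x | q. \<forall>i. coeff q i \<in> B}"

lemma subring_of_coeff_mult:
  "subring_of B \<Longrightarrow> \<forall>i. coeff p i \<in> B \<Longrightarrow> \<forall>i. coeff q i \<in> B \<Longrightarrow> coeff (p * q) i \<in> B"
  by (auto simp: coeff_mult intro!: subring_of_sum subring_of_mult)

lemma adjoin_subring: "subring_of B \<Longrightarrow> subring_of (adjoin B x)"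
  unfolding subring_of_def[of "adjoin B x"]
proof (intro conjI ballI)
  assume B: "subring_of B"
  show "1 \<in> adjoin B x" unfolding adjoin_def
    using subring_of_one[OF B] subring_of_zero[OF B] by (auto intro!: exI[of _ 1] simp: coeff_1)
  fix a b assume "a \<in> adjoin B x" "b \<in> adjoin B x"
  then obtain p q where *: "a = poly p x" "\<forall>i. coeff p i \<in> B" "b = poly q x" "\<forall>i. coeff q i \<in> B"
    unfolding adjoin_def by auto
  have "a - b = poly (p - q) x" "\<forall>i. coeff (p - q) i \<in> B"
    using * subring_of_diff[OF B] by auto
  thus "a - b \<in> adjoin B x" unfolding adjoin_def by blast
  have "a * b = poly (p * q) x" "\<forall>i. coeff (p * q) i \<in> B"
    using * subring_of_coeff_mult[OF B] by auto
  thus "a * b \<in> adjoin B x" unfolding adjoin_def by blast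
qed

lemma adjoin_superset: "subring_of B \<Longrightarrow> B \<subseteq> adjoin B x"
proof
  fix b assume "subring_of B" "b \<in> B"
  hence "\<forall>i. coeff [:b:] i \<in> B" "poly [:b:] x = b"
    using subring_of_zero by (auto simp: coeff_pCons split: nat.split)
  thus "b \<in> adjoin B x" unfolding adjoin_def by (intro CollectI exI[of _ "[:b:]"]) simp
qed

lemma adjoin_self: "subring_of B \<Longrightarrow> x \<in> adjoin B x"
proof -
  assume B: "subring_of B"
  have "\<forall>i. coeff [:0, 1:] i \<in> B" "poly [:0, 1:] x = x"
    using subring_of_zero[OF B] subring_of_one[OF B] by (auto simp: coeff_pCons split: nat.split)
  thus "x \<in> adjoin B x" unfolding adjoin_def by (intro CollectI exI[of _ "[:0, 1:]"]) simp
qed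

lemma adjoin_least: "subring_of A \<Longrightarrow> B \<subseteq> A \<Longrightarrow> x \<in> A \<Longrightarrow> adjoin B x \<subseteq> A"
  unfolding adjoin_def by (auto intro: subring_of_poly)


text \<open>As \<open>1 - x r\<^sub>0\<close> is a unit of \<open>V\<close>, the second relation expresses \<open>1\<close> by negative powers of
  \<open>y\<close>. Multiplied by the leading term of \<open>q\<close>, it replaces that term by terms of lower degree.\<close>
lemma reduce_degree_of_inverse_pair:
  assumes V: "subring_of V" and u: "\<And>v. v \<in> V \<Longrightarrow> inverse (1 - x * v) \<in> V" "x \<in> V"
    and qr: "\<And>i. coeff q i \<in> V" "\<And>i. coeff r i \<in> V" "x * poly q y = 1" "x * poly r (inverse y) = 1"
    and y: "y \<noteq> 0" and d: "degree r \<le> degree q" "degree q > 0" and nv: "inverse x \<notin> V"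
  shows "\<exists>q'. (\<forall>i. coeff q' i \<in> V) \<and> x * poly q' y = 1 \<and> degree q' < degree q"
proof -
  define n where "n = degree q"
  define w where "w = inverse (1 - x * coeff r 0)"
  have wV: "w \<in> V" unfolding w_def using u qr by blast
  have ne: "1 - x * coeff r 0 \<noteq> 0"
  proof
    assume "1 - x * coeff r 0 = 0"
    hence "inverse x = coeff r 0" by (intro inverse_unique) simp
    thus False using nv qr(2) by simp
  qed
  have "1 = x * (\<Sum>j\<le>degree r. coeff r j * inverse y ^ j)"
    using qr(4) by (simp add: poly_altdef)
  also have "(\<Sum>j\<le>degree r. coeff r j * inverse y ^ j) = (\<Sum>j\<le>n. coeff r j * inverse y ^ j)"
    using d by (intro sum.mono_neutral_left) (auto simp: n_def coeff_eq_0)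
  also have "\<dots> = coeff r 0 + (\<Sum>j=1..n. coeff r j * inverse y ^ j)"
    by (simp add: atMost_atLeast0 sum.atLeast_Suc_atMost)
  finally have "1 - x * coeff r 0 = x * (\<Sum>j=1..n. coeff r j * inverse y ^ j)"
    by (simp add: algebra_simps)
  hence "w * (1 - x * coeff r 0) = w * (x * (\<Sum>j=1..n. coeff r j * inverse y ^ j))" by simp
  moreover have "w * (1 - x * coeff r 0) = 1" using ne by (simp add: w_def)
  ultimately have one: "1 = w * x * (\<Sum>j=1..n. coeff r j * inverse y ^ j)"
    by (simp add: mult.assoc)
  define q' where "q' = (\<Sum>i<n. monom (coeff q i) i) + (\<Sum>j=1..n. monom (w * x * coeff q n * coeff r j) (n - j))"
  have "poly (\<Sum>j=1..n. monom (w * x * coeff q n * coeff r j) (n - j)) y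
      = (\<Sum>j=1..n. (w * x * coeff q n * coeff r j) * (y ^ n * inverse y ^ j))"
    unfolding poly_sum poly_monom using y
    by (intro sum.cong) (auto simp: power_diff field_simps power_inverse)
  also have "\<dots> = coeff q n * y ^ n * (w * x * (\<Sum>j=1..n. coeff r j * inverse y ^ j))"
    by (simp add: sum_distrib_left mult_ac)
  also have "\<dots> = coeff q n * y ^ n" using one by simp
  finally have "poly q' y = (\<Sum>i<n. coeff q i * y ^ i) + coeff q n * y ^ n"
    unfolding q'_def by (simp add: poly_sum poly_monom)
  also have "\<dots> = poly q y"
    by (simp add: poly_altdef n_def flip: lessThan_Suc_atMost)
  finally have 1: "x * poly q' y = 1" using qr by simp
  have 2: "coeff q' i \<in> V" for i unfolding q'_def
    using V wV qr u subring_of_zero[OF V]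
    by (auto simp: coeff_sum intro!: subring_of_add subring_of_sum subring_of_mult)
  have "coeff q' i = 0" if "i \<ge> n" for i unfolding q'_def using that d
    by (auto simp: coeff_sum n_def intro!: sum.neutral)
  hence "degree q' < n" using d by (intro degree_lessI) (auto simp: n_def)
  thus ?thesis using 1 2 by (auto simp: n_def)
qed

lemma no_inverse_pair:
  assumes V: "subring_of V" and u: "\<And>v. v \<in> V \<Longrightarrow> inverse (1 - x * v) \<in> V" "x \<in> V" and nv: "inverse x \<notin> V"
    and qr: "\<And>i. coeff q i \<in> V" "\<And>i. coeff r i \<in> V" "x * poly q y = 1" "x * poly r (inverse y) = 1"
    and y: "y \<noteq> 0"
  shows False
  using qr y
proof (induction "degree q + degree r" arbitrary: q r y rule: less_induct)
  case less
  have nz: "degree p > 0" if "\<And>i. coeff p i \<in> V" "x * poly p z = 1" for p z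
  proof (rule ccontr)
    assume "\<not> degree p > 0"
    then obtain c where "p = [:c:]" by (auto elim: degree_eq_zeroE)
    hence "inverse x = c" "c \<in> V" using that(2) that(1)[of 0] by (auto intro: inverse_unique)
    thus False using nv by simp
  qed
  show False
  proof (cases "degree r \<le> degree q")
    case True
    from reduce_degree_of_inverse_pair[OF V u less.prems True nz[OF less.prems(1,3)] nv]
    obtain q' where "\<forall>i. coeff q' i \<in> V" "x * poly q' y = 1" "degree q' < degree q" by blast
    thus False using less.hyps[of q' r y] less.prems by auto
  next
    case False
    have "\<exists>r'. (\<forall>i. coeff r' i \<in> V) \<and> x * poly r' (inverse y) = 1 \<and> degree r' < degree r"
      using False less.prems nz[OF less.prems(2,4)]
      by (intro reduce_degree_of_inverse_pair[where r = q, OF V u _ _ _ _ _ _ _ nv]) auto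
    then obtain r' where "\<forall>i. coeff r' i \<in> V" "x * poly r' (inverse y) = 1" "degree r' < degree r" by blast
    thus False using less.hyps[of q r' y] less.prems by auto
  qed
qed

text \<open>A subring that is maximal among those containing \<open>C\<close> but not \<open>1/x\<close> is a valuation ring:
  if it contained neither \<open>y\<close> nor \<open>1/y\<close>, adjoining either of them would produce \<open>1/x\<close>, and the
  two resulting relations could be played off against each other.\<close>
lemma valuation_ring_extension:
  assumes C: "subring_of C" "x \<in> C" "x \<noteq> 0" "inverse x \<notin> C"
  shows "\<exists>A. valuation_ring A \<and> C \<subseteq> A \<and> x \<in> max_ideal A"
proof -
  define F where "F = {R. subring_of R \<and> C \<subseteq> R \<and> inverse x \<notin> R}"
  have "\<exists>V\<in>F. \<forall>W\<in>F. V \<subseteq> W \<longrightarrow> W = V"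
  proof (rule subset_Zorn_nonempty)
    show "F \<noteq> {}" using C unfolding F_def by auto
    fix K assume K: "K \<noteq> {}" "subset.chain F K"
    have KF: "\<And>R. R \<in> K \<Longrightarrow> R \<in> F" and tot: "\<And>R S. R \<in> K \<Longrightarrow> S \<in> K \<Longrightarrow> R \<subseteq> S \<or> S \<subseteq> R"
      using K(2) by (auto simp: subset.chain_def)
    have "subring_of (\<Union>K)"
      unfolding subring_of_def
    proof (intro conjI ballI)
      show "1 \<in> \<Union>K" using K(1) KF by (auto simp: F_def subring_of_def)
      fix a b assume "a \<in> \<Union>K" "b \<in> \<Union>K"
      then obtain R where "R \<in> K" "a \<in> R" "b \<in> R" using tot by blast
      moreover from this have "subring_of R" using KF by (auto simp: F_def)
      ultimately show "a - b \<in> \<Union>K" "a * b \<in> \<Union>K" using subring_of_diff subring_of_mult by blast+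
    qed
    thus "\<Union>K \<in> F" using K(1) KF unfolding F_def by blast
  qed
  then obtain V where V: "V \<in> F" and max: "\<And>W. W \<in> F \<Longrightarrow> V \<subseteq> W \<Longrightarrow> W = V" by blast
  have Vs: "subring_of V" "C \<subseteq> V" "inverse x \<notin> V" using V by (auto simp: F_def)
  have xV: "x \<in> V" using Vs C by auto
  have u: "inverse (1 - x * v) \<in> V" if "v \<in> V" for v
    using maximal_subring_unit[OF Vs(1,3) xV C(3) _ that] max Vs unfolding F_def by blast
  have ad: "\<exists>q. (\<forall>i. coeff q i \<in> V) \<and> x * poly q y = 1" if "y \<notin> V" for y
  proof -
    have "adjoin V y \<notin> F"
      using max[of "adjoin V y"] adjoin_superset[OF Vs(1), of y] adjoin_self[OF Vs(1), of y] that by blast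
    hence "inverse x \<in> adjoin V y"
      using adjoin_subring[OF Vs(1), of y] adjoin_superset[OF Vs(1), of y] Vs by (auto simp: F_def)
    then obtain q where "\<forall>i. coeff q i \<in> V" "inverse x = poly q y" unfolding adjoin_def by auto
    moreover from this have "x * poly q y = 1" using C(3) by (metis right_inverse)
    ultimately show ?thesis by blast
  qed
  have "y \<in> V \<or> inverse y \<in> V" for y
  proof (rule ccontr)
    assume a: "\<not> ?thesis"
    hence "y \<noteq> 0" using subring_of_zero[OF Vs(1)] by auto
    from a obtain q r where "\<forall>i. coeff q i \<in> V" "x * poly q y = 1" "\<forall>i. coeff r i \<in> V" "x * poly r (inverse y) = 1"
      using ad[of y] ad[of "inverse y"] by blast
    thus False using no_inverse_pair[OF Vs(1) u xV Vs(3), of q r y] \<open>y \<noteq> 0\<close> by blast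
  qed
  hence "valuation_ring V" using Vs by (simp add: valuation_ring_def)
  thus ?thesis using Vs xV by (auto simp: max_ideal_def)
qed

lemma subring_of_coeff_monom: "subring_of B \<Longrightarrow> c \<in> B \<Longrightarrow> coeff (monom c n) i \<in> B"
  by (auto simp: subring_of_zero)

lemma pseudo_division_in_subring:
  fixes q h :: "'k::field poly"
  assumes B: "subring_of B" and q: "\<forall>i. coeff q i \<in> B" and h: "\<forall>i. coeff h i \<in> B" "h \<noteq> 0"
  shows "\<exists>j w r. (\<forall>i. coeff w i \<in> B) \<and> (\<forall>i. coeff r i \<in> B) \<and>
     smult (lead_coeff h ^ j) q = h * w + r \<and> (r = 0 \<or> degree r < degree h)"
  using q
proof (induction "degree q" arbitrary: q rule: less_induct)
  case less
  show ?case
  proof (cases "q = 0 \<or> degree q < degree h")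
    case True
    thus ?thesis using less.prems subring_of_zero[OF B]
      by (intro exI[of _ 0] exI[of _ "0::'k poly"] exI[of _ q]) auto
  next
    case False
    define mm where "mm = monom (lead_coeff q) (degree q - degree h)"
    define q1 where "q1 = smult (lead_coeff h) q - mm * h"
    have mB: "\<forall>i. coeff mm i \<in> B" unfolding mm_def using less.prems subring_of_coeff_monom[OF B] by blast
    have q1B: "\<forall>i. coeff q1 i \<in> B" unfolding q1_def using less.prems h mB subring_of_coeff_mult[OF B mB h(1)]
      by (auto intro!: subring_of_diff subring_of_mult B)
    have dmm: "degree mm = degree q - degree h" "mm \<noteq> 0" using False
      by (auto simp: mm_def degree_monom_eq)
    have dm: "degree (mm * h) = degree q" using False h(2) dmm by (simp add: degree_mult_eq)
    have "lead_coeff (mm * h) = lead_coeff h * lead_coeff q"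
      unfolding lead_coeff_mult using dmm by (simp add: mm_def mult.commute)
    hence c0: "coeff q1 (degree q) = 0" unfolding q1_def using dm by simp
    have dq: "degree q1 \<le> degree q" unfolding q1_def
      by (intro degree_diff_le) (auto simp: dm intro: order.trans[OF degree_smult_le])
    have cases: "q1 = 0 \<or> degree q1 < degree q"
      using c0 dq by (metis le_neq_implies_less leading_coeff_0_iff)
    have "\<exists>j w r. (\<forall>i. coeff w i \<in> B) \<and> (\<forall>i. coeff r i \<in> B) \<and>
      smult (lead_coeff h ^ j) q1 = h * w + r \<and> (r = 0 \<or> degree r < degree h)"
    proof (cases "q1 = 0")
      case True thus ?thesis using subring_of_zero[OF B]
        by (intro exI[of _ 0] exI[of _ "0::'k poly"]) auto
    next
      case False thus ?thesis using less.hyps[of q1] q1B cases by blast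
    qed
    then obtain j w r where jwr: "\<forall>i. coeff w i \<in> B" "\<forall>i. coeff r i \<in> B"
      "smult (lead_coeff h ^ j) q1 = h * w + r" "r = 0 \<or> degree r < degree h" by blast
    have "smult (lead_coeff h ^ Suc j) q = smult (lead_coeff h ^ j) q1 + h * smult (lead_coeff h ^ j) mm"
      by (simp add: q1_def smult_diff_right algebra_simps)
    also have "\<dots> = h * (w + smult (lead_coeff h ^ j) mm) + r" by (simp add: jwr(3) algebra_simps)
    finally show ?thesis using jwr mB h B
      by (intro exI[of _ "Suc j"] exI[of _ "w + smult (lead_coeff h ^ j) mm"] exI[of _ r])
        (auto intro!: subring_of_add subring_of_mult subring_of_power)
  qed
qed

text \<open>Among the multiples of \<open>poly g x\<close> by elements of \<open>B[x]\<close> take one that is represented in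
  least degree. It is a constant: otherwise pseudo-division between it and a minimal equation of
  \<open>x\<close> would give a smaller representative or a smaller equation.\<close>
lemma algebraic_divides_base:
  fixes x :: "'k::field"
  assumes B: "subring_of B" and q: "\<forall>i. coeff q i \<in> B" "q \<noteq> 0" "poly q x = 0"
    and g: "\<forall>i. coeff g i \<in> B" "poly g x \<noteq> 0"
  shows "\<exists>v c. (\<forall>i. coeff v i \<in> B) \<and> c \<in> B \<and> c \<noteq> 0 \<and> c = poly v x * poly g x"
proof -
  define ann where "ann q \<longleftrightarrow> (\<forall>i. coeff q i \<in> B) \<and> q \<noteq> 0 \<and> poly q x = 0" for q
  define mul where "mul h \<longleftrightarrow> (\<forall>i. coeff h i \<in> B) \<and> poly h x \<noteq> 0 \<and>
     (\<exists>v. (\<forall>i. coeff v i \<in> B) \<and> poly h x = poly v x * poly g x)" for h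
  obtain q where q: "ann q" and qmin: "\<And>q'. ann q' \<Longrightarrow> degree q \<le> degree q'"
    using q ex_has_least_nat[of ann q degree] by (auto simp: ann_def)
  have "mul g" unfolding mul_def using g subring_of_one[OF B] subring_of_zero[OF B]
    by (auto intro!: exI[of _ 1] simp: coeff_1)
  then obtain h where h: "mul h" and hmin: "\<And>h'. mul h' \<Longrightarrow> degree h \<le> degree h'"
    using ex_has_least_nat[of mul g degree] by blast
  from h obtain v where hv: "\<forall>i. coeff h i \<in> B" "poly h x \<noteq> 0" "\<forall>i. coeff v i \<in> B" "poly h x = poly v x * poly g x"
    unfolding mul_def by auto
  have qq: "\<forall>i. coeff q i \<in> B" "q \<noteq> 0" "poly q x = 0" using q by (auto simp: ann_def)
  have h0: "h \<noteq> 0" using hv by auto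
  have mulI: "mul r" if "\<forall>i. coeff r i \<in> B" "poly r x \<noteq> 0" "\<forall>i. coeff w i \<in> B" "poly r x = poly w x * poly h x" for r w
    unfolding mul_def using that subring_of_coeff_mult[OF B that(3) hv(3)] hv
    by (auto intro!: exI[of _ "w * v"])
  show ?thesis
  proof (cases "degree h = 0")
    case True
    then obtain c where "h = [:c:]" by (rule degree_eq_zeroE)
    thus ?thesis using hv by (intro exI[of _ v] exI[of _ c]) (auto dest: spec[of _ 0])
  next
    case False
    obtain j w r where jwr: "\<forall>i. coeff w i \<in> B" "\<forall>i. coeff r i \<in> B"
      "smult (lead_coeff h ^ j) q = h * w + r" "r = 0 \<or> degree r < degree h"
      using pseudo_division_in_subring[OF B qq(1) hv(1) h0] by blast
    have ev: "poly r x = poly (- w) x * poly h x"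
      using arg_cong[OF jwr(3), of "\<lambda>p. poly p x"] qq by (simp add: algebra_simps add_eq_0_iff)
    have mwB: "\<forall>i. coeff (- w) i \<in> B" using jwr by (auto intro: subring_of_uminus[OF B])
    have rx: "poly r x = 0"
    proof (rule ccontr)
      assume "poly r x \<noteq> 0"
      hence "mul r" using mulI[OF jwr(2) _ mwB ev] by simp
      thus False using hmin[of r] jwr(4) \<open>poly r x \<noteq> 0\<close> by auto
    qed
    hence wx: "poly w x = 0" using ev hv by simp
    show ?thesis
    proof (cases "w = 0")
      case False
      have "degree (h * w) = degree h + degree w" using h0 False by (simp add: degree_mult_eq)
      moreover have "degree (h * w + r) = degree (h * w)"
        using jwr(4) calculation by (cases "r = 0") (simp_all add: degree_add_eq_left)
      moreover have "degree (smult (lead_coeff h ^ j) q) = degree q" using h0 by simp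
      ultimately have "degree q = degree h + degree w" using jwr(3) by simp
      moreover have "degree q \<le> degree w" using qmin[of w] wx jwr False by (auto simp: ann_def)
      ultimately show ?thesis using \<open>degree h \<noteq> 0\<close> by simp
    next
      case True
      have "degree (smult (lead_coeff h ^ j) q) = degree q" using h0 by simp
      moreover have "r \<noteq> 0" using True jwr(3) qq(2) h0 by auto
      ultimately have dq: "degree q < degree h" using True jwr(3,4) by auto
      obtain i w2 r2 where r2: "\<forall>i. coeff w2 i \<in> B" "\<forall>i. coeff r2 i \<in> B"
        "smult (lead_coeff q ^ i) h = q * w2 + r2" "r2 = 0 \<or> degree r2 < degree q"
        using pseudo_division_in_subring[OF B hv(1) qq(1,2)] by blast
      have e: "poly r2 x = poly [:lead_coeff q ^ i:] x * poly h x"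
        using arg_cong[OF r2(3), of "\<lambda>p. poly p x"] qq by (simp add: algebra_simps)
      have "poly r2 x \<noteq> 0" using e hv qq by simp
      moreover have "\<forall>n. coeff [:lead_coeff q ^ i:] n \<in> B"
        using qq subring_of_zero[OF B] by (auto simp: coeff_pCons split: nat.split intro!: subring_of_power[OF B])
      ultimately have "mul r2" using mulI[OF r2(2) _ _ e] by blast
      thus ?thesis using hmin[of r2] r2(4) dq \<open>poly r2 x \<noteq> 0\<close> by auto
    qed
  qed
qed

text \<open>The induction over a finite set of field elements adjoins them to the integers one at a
  time. This is the property that survives each step; keeping a single \<open>f\<close> invertible is enough,
  since finitely many elements are inverted together with their product.\<close>
definition specializable :: "'k::field set \<Rightarrow> bool" where
  "specializable B \<longleftrightarrow> subring_of B \<and> (\<forall>f\<in>B. f \<noteq> 0 \<longrightarrow>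
     (\<exists>A p. valuation_ring A \<and> prime (p::nat) \<and> of_nat p \<in> max_ideal A \<and> B \<subseteq> A \<and> inverse f \<in> A))"

lemma prime_not_dvd_int: "(z::int) \<noteq> 0 \<Longrightarrow> \<exists>p::nat. prime p \<and> \<not> int p dvd z"
proof -
  assume z: "z \<noteq> 0"
  obtain p :: nat where p: "prime p" "p > nat \<bar>z\<bar>" using bigger_prime by blast
  have "\<not> int p dvd z" using z p zdvd_imp_le[of "int p" "\<bar>z\<bar>"] by auto
  thus ?thesis using p by blast
qed

text \<open>Localize at a prime that does not divide \<open>f\<close>.\<close>
lemma specializable_integers:
  assumes "CHAR('k::field) = 0"
  shows "specializable (range of_int :: 'k set)"
  unfolding specializable_def
proof (intro conjI ballI impI)
  have inj: "of_int i = (0::'k) \<longleftrightarrow> i = 0" for i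
    using assms by (simp add: of_int_eq_0_iff_char_dvd)
  have inj': "of_int i = (of_int j::'k) \<longleftrightarrow> i = j" for i j
    using inj[of "i - j"] by simp
  show "subring_of (range of_int :: 'k set)"
    unfolding subring_of_def
  proof (intro conjI ballI)
    show "(1::'k) \<in> range of_int" by (rule range_eqI[of _ _ 1]) simp
    fix x y :: 'k assume "x \<in> range of_int" "y \<in> range of_int"
    then obtain i j where "x = of_int i" "y = of_int j" by blast
    hence "x - y = of_int (i - j)" "x * y = of_int (i * j)" by simp_all
    thus "x - y \<in> range of_int" "x * y \<in> range of_int" by blast+
  qed
  fix f :: 'k assume f: "f \<in> range of_int" "f \<noteq> 0"
  then obtain z where z: "f = of_int z" "z \<noteq> 0" by (metis imageE of_int_0)
  obtain p :: nat where p: "prime p" "\<not> int p dvd z" using prime_not_dvd_int[OF z(2)] by blast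
  have pp: "prime (int p)" using p by simp
  define C where "C = {of_int a / of_int b :: 'k | a b. \<not> int p dvd b}"
  have "subring_of C" unfolding subring_of_def
  proof (intro conjI ballI)
    have "\<not> int p dvd 1" using p(1) by (metis not_prime_unit pp)
    thus "1 \<in> C" unfolding C_def by (intro CollectI exI[of _ "1::int"]) auto
    fix x y assume "x \<in> C" "y \<in> C"
    then obtain a b c d where *: "x = of_int a / of_int b" "y = of_int c / of_int d"
      "\<not> int p dvd b" "\<not> int p dvd d" unfolding C_def by blast
    have "b \<noteq> 0" "d \<noteq> 0" using * by auto
    hence bd: "of_int b \<noteq> (0::'k)" "of_int d \<noteq> (0::'k)" using inj by blast+
    have "x - y = of_int (a * d - c * b) / of_int (b * d)" "x * y = of_int (a * c) / of_int (b * d)"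
      unfolding *(1,2) of_int_diff of_int_mult by (rule diff_frac_eq[OF bd] times_divide_times_eq)+
    moreover have "\<not> int p dvd b * d" using * pp prime_dvd_mult_iff by blast
    ultimately show "x - y \<in> C" "x * y \<in> C" unfolding C_def by blast+
  qed
  moreover have rC: "range of_int \<subseteq> C"
  proof
    fix x :: 'k assume "x \<in> range of_int"
    then obtain a where "x = of_int a" by auto
    moreover have "\<not> int p dvd 1" using p(1) by (metis not_prime_unit pp)
    ultimately show "x \<in> C" unfolding C_def by (intro CollectI exI[of _ a] exI[of _ "1::int"]) auto
  qed
  moreover have p0: "of_nat p \<noteq> (0::'k)" using inj[of "int p"] p(1) by auto
  moreover have "inverse (of_nat p :: 'k) \<notin> C"
  proof
    assume "inverse (of_nat p :: 'k) \<in> C"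
    then obtain a b where ab: "inverse (of_nat p :: 'k) = of_int a / of_int b" "\<not> int p dvd b" unfolding C_def by blast
    hence "b \<noteq> 0" by auto
    hence "of_int (int p * a) = (of_int b :: 'k)" using ab(1) p0 inj[of b] by (simp add: field_simps)
    hence "int p * a = b" by (simp only: inj')
    thus False using ab(2) by auto
  qed
  moreover have "(of_nat p :: 'k) \<in> C" using rC by (metis of_int_of_nat_eq rangeI subsetD)
  ultimately obtain A where A: "valuation_ring A" "C \<subseteq> A" "(of_nat p :: 'k) \<in> max_ideal A"
    using valuation_ring_extension[of C "of_nat p"] by blast
  have "inverse f = of_int 1 / of_int z" using z by (simp add: field_simps)
  hence "inverse f \<in> C" using p(2) unfolding C_def by blast
  thus "\<exists>A p. valuation_ring A \<and> prime (p::nat) \<and> of_nat p \<in> max_ideal A \<and> range of_int \<subseteq> A \<and> inverse f \<in> A"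
    using A rC p(1) by blast
qed

text \<open>Valuation rings are integrally closed: if \<open>x\<close> were not in \<open>A\<close>, dividing the equation by
  a power of \<open>x\<close> would put its leading coefficient into the maximal ideal.\<close>
lemma root_in_valuation_ring:
  assumes A: "valuation_ring A" and q: "\<forall>i. coeff q i \<in> A" "poly q x = 0" "degree q > 0"
    "inverse (lead_coeff q) \<in> A"
  shows "x \<in> A"
proof (rule ccontr)
  assume "x \<notin> A"
  hence i: "inverse x \<in> max_ideal A" by (rule inverse_in_max_ideal[OF A])
  have As: "subring_of A" using A by (rule valuation_ring_subring)
  have x0: "x \<noteq> 0" using \<open>x \<notin> A\<close> subring_of_zero[OF As] by auto
  define n where "n = degree q"
  have "0 = (\<Sum>j\<le>n. coeff q j * x ^ j)" using q(2) by (simp add: poly_altdef n_def)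
  also have "\<dots> = (\<Sum>j<n. coeff q j * x ^ j) + coeff q n * x ^ n"
    by (simp flip: lessThan_Suc_atMost)
  finally have e: "coeff q n * x ^ n = - (\<Sum>j<n. coeff q j * x ^ j)" by (simp add: add_eq_0_iff)
  have "coeff q n * (x ^ n * inverse x ^ n) = - (\<Sum>j<n. coeff q j * x ^ j) * inverse x ^ n"
    unfolding e[symmetric] by (rule mult.assoc[symmetric])
  moreover have "x ^ n * inverse x ^ n = 1" using x0 by (simp add: power_inverse)
  ultimately have "coeff q n = - (\<Sum>j<n. coeff q j * (x ^ j * inverse x ^ n))"
    by (simp add: sum_distrib_right mult.assoc)
  also have "(\<Sum>j<n. coeff q j * (x ^ j * inverse x ^ n)) = (\<Sum>j<n. coeff q j * inverse x ^ (n - j))"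
    using x0 by (intro sum.cong) (auto simp: power_diff field_simps power_inverse)
  also have "- (\<Sum>j<n. coeff q j * inverse x ^ (n - j)) \<in> max_ideal A"
  proof (intro max_ideal_uminus[OF A] max_ideal_sum[OF A] max_ideal_mult(2)[OF A])
    fix j assume "j \<in> {..<n}"
    hence "inverse x ^ (n - j) = inverse x * inverse x ^ (n - j - 1)"
      by (subst power_Suc[symmetric]) (simp add: Suc_diff_Suc)
    moreover have "inverse x ^ (n - j - 1) \<in> A" using i As by (intro subring_of_power) (auto dest: max_ideal_subset)
    ultimately show "inverse x ^ (n - j) \<in> max_ideal A" using max_ideal_mult(1)[OF A i] by simp
  qed (use q in auto)
  finally have "lead_coeff q \<in> max_ideal A" by (simp add: n_def)
  thus False using q(3,4) by (auto simp: max_ideal_def)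
qed

text \<open>If the leading coefficient of an equation for \<open>x\<close> is a unit then \<open>x\<close> is in the valuation
  ring, and if also a multiple \<open>c \<in> B\<close> of \<open>f\<close> is a unit then so is \<open>f\<close>.\<close>
lemma specializable_adjoin_algebraic:
  assumes B: "specializable B" and q: "\<forall>i. coeff q i \<in> B" "q \<noteq> 0" "poly q x = 0"
  shows "specializable (adjoin B x)"
  unfolding specializable_def
proof (intro conjI ballI impI)
  have Bs: "subring_of B" using B by (simp add: specializable_def)
  show "subring_of (adjoin B x)" using Bs by (rule adjoin_subring)
  fix f assume "f \<in> adjoin B x" "f \<noteq> 0"
  then obtain g where g: "f = poly g x" "\<forall>i. coeff g i \<in> B" unfolding adjoin_def by auto
  obtain v c where v: "\<forall>i. coeff v i \<in> B" "c \<in> B" "c \<noteq> 0" "c = poly v x * poly g x"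
    using algebraic_divides_base[OF Bs q g(2)] g(1) \<open>f \<noteq> 0\<close> by auto
  have "lead_coeff q * c \<in> B" "lead_coeff q * c \<noteq> 0" using q v Bs by (auto intro: subring_of_mult)
  then obtain A and p :: nat where A: "valuation_ring A" "prime p" "of_nat p \<in> max_ideal A" "B \<subseteq> A"
    "inverse (lead_coeff q * c) \<in> A"
    using B unfolding specializable_def by blast
  have As: "subring_of A" using A by (simp add: valuation_ring_def)
  have e: "c * inverse (lead_coeff q * c) = inverse (lead_coeff q)"
       "lead_coeff q * inverse (lead_coeff q * c) = inverse c"
    using v(3) q(2) by auto
  have "c * inverse (lead_coeff q * c) \<in> A" "lead_coeff q * inverse (lead_coeff q * c) \<in> A"
    using A(4,5) v(2) q(1) by (auto intro!: subring_of_mult[OF As] simp del: inverse_mult_distrib)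
  hence inv: "inverse (lead_coeff q) \<in> A" "inverse c \<in> A" unfolding e .
  have "degree q > 0" using q by (auto intro!: gr0I elim!: degree_eq_zeroE)
  hence x: "x \<in> A" using root_in_valuation_ring[OF A(1), of q x] q inv A(4) by blast
  have "poly v x \<in> A" using subring_of_poly[OF As x] v A(4) by blast
  hence "poly v x * inverse c \<in> A" using inv As by (intro subring_of_mult)
  moreover have "poly v x * inverse c = inverse f" using v(3,4) g(1) by (auto simp: field_simps)
  ultimately have "inverse f \<in> A" by simp
  thus "\<exists>A p. valuation_ring A \<and> prime (p::nat) \<and> of_nat p \<in> max_ideal A \<and> adjoin B x \<subseteq> A \<and> inverse f \<in> A"
    using A adjoin_least[OF As A(4) x] by blast
qed

text \<open>Gauss's lemma.\<close>
lemma primitive_mult: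
  assumes A: "valuation_ring A" and uv: "\<forall>i. coeff u i \<in> A" "\<forall>i. coeff v i \<in> A"
    "\<exists>i. coeff u i \<notin> max_ideal A" "\<exists>i. coeff v i \<notin> max_ideal A"
  shows "\<exists>i. coeff (u * v) i \<notin> max_ideal A"
proof -
  define i where "i = (LEAST i. coeff u i \<notin> max_ideal A)"
  define j where "j = (LEAST j. coeff v j \<notin> max_ideal A)"
  have i: "coeff u i \<notin> max_ideal A" "\<And>k. k < i \<Longrightarrow> coeff u k \<in> max_ideal A"
    unfolding i_def using LeastI_ex[OF uv(3)] not_less_Least by blast+
  have j: "coeff v j \<notin> max_ideal A" "\<And>k. k < j \<Longrightarrow> coeff v k \<in> max_ideal A"
    unfolding j_def using LeastI_ex[OF uv(4)] not_less_Least by blast+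
  define rest where "rest = (\<Sum>k\<in>{..i+j} - {i}. coeff u k * coeff v (i + j - k))"
  have e: "coeff (u * v) (i + j) - rest = coeff u i * coeff v j"
    unfolding coeff_mult rest_def by (subst sum.remove[of _ i]) auto
  have r: "rest \<in> max_ideal A" unfolding rest_def
  proof (intro max_ideal_sum[OF A])
    fix k assume k: "k \<in> {..i + j} - {i}"
    show "coeff u k * coeff v (i + j - k) \<in> max_ideal A"
    proof (cases "k < i")
      case True thus ?thesis using i(2) uv A by (intro max_ideal_mult) auto
    next
      case False
      hence "i + j - k < j" using k by auto
      thus ?thesis using j(2) uv A by (intro max_ideal_mult) auto
    qed
  qed
  have "coeff u i * coeff v j \<notin> max_ideal A"
    using max_ideal_prime[OF A, of "coeff u i" "coeff v j"] uv i(1) j(1) by blast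
  hence "coeff (u * v) (i + j) \<notin> max_ideal A"
    using max_ideal_diff[OF A _ r, of "coeff (u * v) (i + j)"] unfolding e by blast
  thus ?thesis by (rule exI)
qed

text \<open>The Gauss extension: quotients of polynomials in \<open>x\<close> whose denominator is primitive form
  a ring in which \<open>p\<close> is not invertible, while a polynomial whose leading coefficient is a unit
  becomes one.\<close>
lemma specializable_adjoin_transcendental:
  assumes B: "specializable B" and tr: "\<And>q. \<forall>i. coeff q i \<in> B \<Longrightarrow> poly q x = 0 \<Longrightarrow> q = 0"
  shows "specializable (adjoin B x)"
  unfolding specializable_def
proof (intro conjI ballI impI)
  have Bs: "subring_of B" using B by (simp add: specializable_def)
  show "subring_of (adjoin B x)" using Bs by (rule adjoin_subring)
  fix f assume "f \<in> adjoin B x" and f0: "f \<noteq> 0"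
  then obtain g where g: "f = poly g x" "\<forall>i. coeff g i \<in> B" unfolding adjoin_def by auto
  hence "lead_coeff g \<noteq> 0" using f0 by auto
  then obtain A and p :: nat where A: "valuation_ring A" "prime p" "of_nat p \<in> max_ideal A" "B \<subseteq> A"
    "inverse (lead_coeff g) \<in> A"
    using B g(2) unfolding specializable_def by blast
  define prim where "prim w \<longleftrightarrow> (\<forall>i. coeff w i \<in> B) \<and> (\<exists>i. coeff w i \<notin> max_ideal A)" for w
  have gp: "prim g" unfolding prim_def using g(2) A(5) \<open>lead_coeff g \<noteq> 0\<close>
    by (auto simp: max_ideal_def intro!: exI[of _ "degree g"])
  have one: "prim 1" unfolding prim_def using subring_of_one[OF Bs] subring_of_zero[OF Bs] max_ideal_one[OF A(1)]
    by (auto simp: coeff_1 intro!: exI[of _ 0])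
  have pm: "prim (u * w)" if "prim u" "prim w" for u w
    using that primitive_mult[OF A(1), of u w] subring_of_coeff_mult[OF Bs, of u w] A(4)
    unfolding prim_def by blast
  have p0: "poly w x \<noteq> 0" if "prim w" for w
    using tr[of w] that max_ideal_zero[OF A(1)] unfolding prim_def by fastforce
  define C where "C = {poly u x / poly w x | u w. (\<forall>i. coeff u i \<in> B) \<and> prim w}"
  have ad: "adjoin B x \<subseteq> C"
  proof
    fix y assume "y \<in> adjoin B x"
    then obtain u where "y = poly u x" "\<forall>i. coeff u i \<in> B" unfolding adjoin_def by auto
    thus "y \<in> C" unfolding C_def using one by (intro CollectI exI[of _ u] exI[of _ 1]) auto
  qed
  have Cs: "subring_of C" unfolding subring_of_def
  proof (intro conjI ballI)
    show "1 \<in> C" using ad adjoin_superset[OF Bs] subring_of_one[OF Bs] by blast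
    fix a b assume "a \<in> C" "b \<in> C"
    then obtain u w u' w' where *: "a = poly u x / poly w x" "b = poly u' x / poly w' x"
      "\<forall>i. coeff u i \<in> B" "prim w" "\<forall>i. coeff u' i \<in> B" "prim w'" unfolding C_def by blast
    have w: "\<forall>i. coeff w i \<in> B" "\<forall>i. coeff w' i \<in> B" using * by (auto simp: prim_def)
    have "a - b = poly (u * w' - u' * w) x / poly (w * w') x" "a * b = poly (u * u') x / poly (w * w') x"
      unfolding *(1,2) poly_diff poly_mult
      by (rule diff_frac_eq[OF p0[OF *(4)] p0[OF *(6)]] times_divide_times_eq)+
    moreover have "\<forall>i. coeff (u * w' - u' * w) i \<in> B" "\<forall>i. coeff (u * u') i \<in> B"
      using subring_of_coeff_mult[OF Bs] * w by (auto intro!: subring_of_diff[OF Bs])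
    ultimately show "a - b \<in> C" "a * b \<in> C" unfolding C_def using pm[OF *(4,6)] by blast+
  qed
  have pC: "of_nat p \<in> C" using ad adjoin_superset[OF Bs] subring_of_nat[OF Bs] by blast
  have "inverse (of_nat p) \<notin> C \<and> of_nat p \<noteq> (0::'a) \<or> of_nat p = (0::'a)"
  proof (cases "of_nat p = (0::'a)")
    case False
    have "inverse (of_nat p) \<notin> C"
    proof
      assume "inverse (of_nat p) \<in> C"
      then obtain u w where uw: "inverse (of_nat p) = poly u x / poly w x" "\<forall>i. coeff u i \<in> B" "prim w"
        unfolding C_def by blast
      hence "poly w x = of_nat p * poly u x" using False p0[OF uw(3)] by (simp add: field_simps)
      hence "poly (w - smult (of_nat p) u) x = 0" by simp
      moreover have "\<forall>i. coeff (w - smult (of_nat p) u) i \<in> B"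
        using uw subring_of_nat[OF Bs] by (auto simp: prim_def intro!: subring_of_diff[OF Bs] subring_of_mult[OF Bs])
      ultimately have "w = smult (of_nat p) u" using tr by fastforce
      hence "coeff w i \<in> max_ideal A" for i
        using A uw(2) by (auto intro!: max_ideal_mult(1)[OF A(1)])
      thus False using uw(3) by (auto simp: prim_def)
    qed
    thus ?thesis using False by blast
  qed simp
  moreover have fC: "inverse f \<in> C" unfolding C_def
    using gp one g(1) by (intro CollectI exI[of _ 1] exI[of _ g]) (auto simp: prim_def field_simps)
  ultimately show "\<exists>A p. valuation_ring A \<and> prime (p::nat) \<and> of_nat p \<in> max_ideal A \<and> adjoin B x \<subseteq> A \<and> inverse f \<in> A"
  proof (elim disjE)
    assume "inverse (of_nat p) \<notin> C \<and> of_nat p \<noteq> (0::'a)"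
    then obtain A' where "valuation_ring A'" "C \<subseteq> A'" "of_nat p \<in> max_ideal A'"
      using valuation_ring_extension[OF Cs pC] by blast
    thus ?thesis using A(2) ad fC by blast
  next
    assume "of_nat p = (0::'a)"
    moreover have "valuation_ring (UNIV :: 'a set)" by (simp add: valuation_ring_def subring_of_def)
    ultimately show ?thesis using A(2)
      by (intro exI[of _ UNIV] exI[of _ p]) (auto simp: max_ideal_def)
  qed
qed

text \<open>In positive characteristic the field itself is such a valuation ring. In characteristic
  zero the elements are adjoined to the integers one after the other.\<close>
theorem units_of_valuation_ring:
  fixes S :: "'k::field set"
  assumes "finite S" "0 \<notin> S"
  shows "\<exists>A p. valuation_ring A \<and> prime (p::nat) \<and> of_nat p \<in> max_ideal A \<and>
     (\<forall>x\<in>S. x \<in> A \<and> inverse x \<in> A)"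
proof (cases "CHAR('k) = 0")
  case False
  hence "prime (CHAR('k))" by (intro prime_CHAR_semidom) auto
  moreover have "valuation_ring (UNIV :: 'k set)" by (simp add: valuation_ring_def subring_of_def)
  ultimately show ?thesis
    by (intro exI[of _ UNIV] exI[of _ "CHAR('k)"]) (auto simp: max_ideal_def)
next
  case True
  have "\<exists>B. specializable B \<and> S \<subseteq> B" using assms(1)
  proof (induction S rule: finite_induct)
    case empty
    then show ?case using specializable_integers[OF True] by blast
  next
    case (insert x F)
    then obtain B where B: "specializable B" "F \<subseteq> B" by blast
    have Bs: "subring_of B" using B by (simp add: specializable_def)
    have "specializable (adjoin B x)"
      using specializable_adjoin_algebraic[OF B(1), of _ x] specializable_adjoin_transcendental[OF B(1), of x]
      by blast
    thus ?case using B adjoin_superset[OF Bs, of x] adjoin_self[OF Bs, of x] by blast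
  qed
  then obtain B where B: "specializable B" "S \<subseteq> B" by blast
  have Bs: "subring_of B" using B by (simp add: specializable_def)
  have "\<Prod>S \<in> B" "\<Prod>S \<noteq> 0" using assms B Bs by (auto intro!: subring_of_prod)
  then obtain A and p :: nat where A: "valuation_ring A" "prime p" "of_nat p \<in> max_ideal A" "B \<subseteq> A"
    "inverse (\<Prod>S) \<in> A"
    using B unfolding specializable_def by blast
  have As: "subring_of A" using A by (simp add: valuation_ring_def)
  have "inverse x \<in> A" if x: "x \<in> S" for x
  proof -
    have "\<Prod>S = x * \<Prod>(S - {x})" using assms x by (intro prod.remove) auto
    hence "inverse x = \<Prod>(S - {x}) * inverse (\<Prod>S)" using \<open>\<Prod>S \<noteq> 0\<close> by (simp add: field_simps)
    moreover have "\<Prod>(S - {x}) \<in> A" using B A by (intro subring_of_prod As) auto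
    ultimately show ?thesis using A(5) As by (metis subring_of_mult)
  qed
  thus ?thesis using A B by blast
qed

section \<open>Substitution homomorphisms of polynomial rings\<close>

text \<open>Homomorphisms between whole types, so that no carrier sets have to be tracked.\<close>
definition rhom :: "('a::semiring_1 \<Rightarrow> 'b::semiring_1) \<Rightarrow> bool" where
  "rhom F \<longleftrightarrow> F 0 = 0 \<and> F 1 = 1 \<and> (\<forall>a b. F (a + b) = F a + F b) \<and> (\<forall>a b. F (a * b) = F a * F b)"

lemma rhomD:
  assumes "rhom F"
  shows "F 0 = 0" "F 1 = 1" "F (a + b) = F a + F b" "F (a * b) = F a * F b"
  using assms by (auto simp: rhom_def)

lemma rhom_id: "rhom (\<lambda>x. x)"
  by (simp add: rhom_def)

lemma rhom_comp: "rhom F \<Longrightarrow> rhom G \<Longrightarrow> rhom (\<lambda>x. F (G x))"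
  by (simp add: rhom_def)

lemma rhom_sum: "rhom F \<Longrightarrow> F (sum f I) = (\<Sum>i\<in>I. F (f i))"
  by (induction I rule: infinite_finite_induct) (auto simp: rhom_def)

lemma rhom_prod:
  fixes F :: "'a::comm_semiring_1 \<Rightarrow> 'b::comm_semiring_1"
  shows "rhom F \<Longrightarrow> F (prod f I) = (\<Prod>i\<in>I. F (f i))"
  by (induction I rule: infinite_finite_induct) (auto simp: rhom_def)

lemma rhom_power: "rhom F \<Longrightarrow> F (x ^ n) = F x ^ n"
  by (induction n) (auto simp: rhom_def)

lemma rhom_uminus:
  fixes F :: "'a::ring_1 \<Rightarrow> 'b::ring_1"
  shows "rhom F \<Longrightarrow> F (- x) = - F x"
  using rhomD(3)[of F x "- x"] rhomD(1)[of F] by (simp add: eq_neg_iff_add_eq_0 add.commute)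

lemma rhom_diff:
  fixes F :: "'a::ring_1 \<Rightarrow> 'b::ring_1"
  shows "rhom F \<Longrightarrow> F (x - y) = F x - F y"
  using rhomD(3)[of F x "- y"] rhom_uminus[of F y] by simp

definition mdeg :: "('v \<Rightarrow>\<^sub>0 nat) \<Rightarrow> nat" where
  "mdeg \<mu> = (\<Sum>i\<in>Poly_Mapping.keys \<mu>. Poly_Mapping.lookup \<mu> i)"

abbreviation lookup where "lookup \<equiv> Poly_Mapping.lookup"
abbreviation keys where "keys \<equiv> Poly_Mapping.keys"
abbreviation single where "single \<equiv> Poly_Mapping.single"

lemma homogeneous_iff: "homogeneous d f \<longleftrightarrow> (\<forall>\<mu>\<in>keys f. mdeg \<mu> = d)"
  by (simp add: homogeneous_def mdeg_def)

lemma mdeg_eq_sum: "finite S \<Longrightarrow> keys \<mu> \<subseteq> S \<Longrightarrow> mdeg \<mu> = (\<Sum>i\<in>S. lookup \<mu> i)"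
  unfolding mdeg_def by (intro sum.mono_neutral_left) (auto simp: in_keys_iff)

lemma mdeg_add: "mdeg (\<mu> + \<nu>) = mdeg \<mu> + mdeg \<nu>"
proof -
  have "finite (keys \<mu> \<union> keys \<nu>)" by simp
  thus ?thesis using keys_add[of \<mu> \<nu>]
    by (subst (1 2 3) mdeg_eq_sum[of "keys \<mu> \<union> keys \<nu>"]) (auto simp: lookup_add sum.distrib)
qed

lemma mdeg_zero [simp]: "mdeg 0 = 0"
  by (simp add: mdeg_def)

lemma mdeg_single [simp]: "mdeg (single i n) = n"
  by (cases "n = 0") (auto simp: mdeg_def)

lemma mdeg_eq_0_iff: "mdeg \<mu> = 0 \<longleftrightarrow> \<mu> = 0"
proof
  assume "mdeg \<mu> = 0"
  thus "\<mu> = 0" by (intro poly_mapping_eqI) (auto simp: mdeg_def in_keys_iff)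
qed simp

definition monom_val :: "('v \<Rightarrow> 'b::comm_semiring_1) \<Rightarrow> ('v \<Rightarrow>\<^sub>0 nat) \<Rightarrow> 'b" where
  "monom_val \<sigma> \<mu> = (\<Prod>i\<in>keys \<mu>. \<sigma> i ^ lookup \<mu> i)"

lemma monom_val_eq_prod: "finite S \<Longrightarrow> keys \<mu> \<subseteq> S \<Longrightarrow> monom_val \<sigma> \<mu> = (\<Prod>i\<in>S. \<sigma> i ^ lookup \<mu> i)"
  unfolding monom_val_def by (intro prod.mono_neutral_left) (auto simp: in_keys_iff)

lemma monom_val_add: "monom_val \<sigma> (\<mu> + \<nu>) = monom_val \<sigma> \<mu> * monom_val \<sigma> \<nu>"
proof -
  have "finite (keys \<mu> \<union> keys \<nu>)" by simp
  thus ?thesis using keys_add[of \<mu> \<nu>]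
    by (subst (1 2 3) monom_val_eq_prod[of "keys \<mu> \<union> keys \<nu>"]) (auto simp: lookup_add power_add prod.distrib)
qed

lemma monom_val_zero [simp]: "monom_val \<sigma> 0 = 1"
  by (simp add: monom_val_def)

lemma monom_val_single [simp]: "monom_val \<sigma> (single i n) = \<sigma> i ^ n"
  by (cases "n = 0") (auto simp: monom_val_def)

definition substitute ::
  "('k::zero \<Rightarrow> 'b::comm_semiring_1) \<Rightarrow> ('v \<Rightarrow> 'b) \<Rightarrow> ('v, 'k) mpoly \<Rightarrow> 'b" where
  "substitute \<phi> \<sigma> f = (\<Sum>\<mu>\<in>keys f. \<phi> (lookup f \<mu>) * monom_val \<sigma> \<mu>)"

lemma substitute_eq_sum:
  "\<phi> 0 = 0 \<Longrightarrow> finite S \<Longrightarrow> keys f \<subseteq> S \<Longrightarrow> substitute \<phi> \<sigma> f = (\<Sum>\<mu>\<in>S. \<phi> (lookup f \<mu>) * monom_val \<sigma> \<mu>)"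
  unfolding substitute_def by (intro sum.mono_neutral_left) (auto simp: in_keys_iff)

lemma substitute_single: "\<phi> 0 = 0 \<Longrightarrow> substitute \<phi> \<sigma> (single \<mu> c) = \<phi> c * monom_val \<sigma> \<mu>"
  by (cases "c = 0") (auto simp: substitute_def)

lemma substitute_add:
  assumes "rhom \<phi>" shows "substitute \<phi> \<sigma> (f + g) = substitute \<phi> \<sigma> f + substitute \<phi> \<sigma> g"
proof -
  have "finite (keys f \<union> keys g)" by simp
  thus ?thesis using keys_add[of f g] rhomD[OF assms]
    by (subst (1 2 3) substitute_eq_sum[of _ "keys f \<union> keys g"]) (auto simp: lookup_add algebra_simps sum.distrib)
qed

lemma substitute_zero [simp]: "substitute \<phi> \<sigma> 0 = 0"
  by (simp add: substitute_def)

lemma substitute_sum: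
  "rhom \<phi> \<Longrightarrow> substitute \<phi> \<sigma> (sum f I) = (\<Sum>i\<in>I. substitute \<phi> \<sigma> (f i))"
  by (induction I rule: infinite_finite_induct) (auto simp: substitute_add)

lemma mpoly_eq_sum_single: "f = (\<Sum>\<mu>\<in>keys f. single \<mu> (lookup f \<mu>))"
proof (rule poly_mapping_eqI)
  fix \<kappa>
  have "lookup (\<Sum>\<mu>\<in>keys f. single \<mu> (lookup f \<mu>)) \<kappa> = (\<Sum>\<mu>\<in>keys f. if \<mu> = \<kappa> then lookup f \<mu> else 0)"
    by (auto simp: lookup_sum lookup_single when_def intro!: sum.cong)
  also have "\<dots> = lookup f \<kappa>" by (simp add: in_keys_iff)
  finally show "lookup f \<kappa> = lookup (\<Sum>\<mu>\<in>keys f. single \<mu> (lookup f \<mu>)) \<kappa>" by simp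
qed

lemma mpoly_mult_eq_sum:
  fixes f g :: "('v, 'k::comm_semiring_1) mpoly"
  shows "f * g = (\<Sum>\<mu>\<in>keys f. \<Sum>\<nu>\<in>keys g. single (\<mu> + \<nu>) (lookup f \<mu> * lookup g \<nu>))"
  by (subst mpoly_eq_sum_single[of f], subst mpoly_eq_sum_single[of g])
    (simp add: sum_product mult_single)

lemma lookup_mult_eq_sum:
  fixes f g :: "('v, 'k::comm_semiring_1) mpoly"
  shows "lookup (f * g) \<kappa> = (\<Sum>\<mu>\<in>keys f. \<Sum>\<nu>\<in>keys g. (lookup f \<mu> * lookup g \<nu> when \<mu> + \<nu> = \<kappa>))"
  by (subst mpoly_mult_eq_sum) (simp add: lookup_sum lookup_single)

lemma substitute_mult:
  fixes f g :: "('v, 'k::comm_semiring_1) mpoly"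
  assumes "rhom \<phi>" shows "substitute \<phi> \<sigma> (f * g) = substitute \<phi> \<sigma> f * substitute \<phi> \<sigma> g"
proof -
  have "substitute \<phi> \<sigma> (f * g) = (\<Sum>\<mu>\<in>keys f. \<Sum>\<nu>\<in>keys g. \<phi> (lookup f \<mu> * lookup g \<nu>) * monom_val \<sigma> (\<mu> + \<nu>))"
    by (subst mpoly_mult_eq_sum) (simp add: substitute_sum assms substitute_single rhomD[OF assms])
  also have "\<dots> = substitute \<phi> \<sigma> f * substitute \<phi> \<sigma> g"
    unfolding substitute_def sum_product by (intro sum.cong) (auto simp: rhomD[OF assms] monom_val_add mult_ac)
  finally show ?thesis .
qed

lemma rhom_substitute:
  fixes \<phi> :: "'k::comm_semiring_1 \<Rightarrow> 'b::comm_semiring_1"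
  assumes "rhom \<phi>" shows "rhom (substitute \<phi> \<sigma>)"
  using substitute_single[of \<phi> \<sigma> 0 1] rhomD[OF assms]
  unfolding rhom_def by (auto simp: substitute_add substitute_mult assms)

abbreviation Const :: "'k::zero \<Rightarrow> ('v, 'k) mpoly" where "Const c \<equiv> single 0 c"
definition Var :: "'v \<Rightarrow> ('v, 'k::zero_neq_one) mpoly" where "Var i = single (single i 1) 1"

lemma rhom_Const: "rhom (Const :: 'k::comm_semiring_1 \<Rightarrow> _)"
  by (simp add: rhom_def single_add mult_single)


definition scale_exp :: "nat \<Rightarrow> ('v \<Rightarrow>\<^sub>0 nat) \<Rightarrow> ('v \<Rightarrow>\<^sub>0 nat)" where
  "scale_exp n \<mu> = Poly_Mapping.map ((*) n) \<mu>"

lemma lookup_map_zero: "f 0 = 0 \<Longrightarrow> lookup (Poly_Mapping.map f \<mu>) i = f (lookup \<mu> i)"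
  by (simp add: map.rep_eq when_def)

lemma lookup_scale_exp [simp]: "lookup (scale_exp n \<mu>) i = n * lookup \<mu> i"
  by (simp add: scale_exp_def lookup_map_zero)

lemma mdeg_scale_exp [simp]: "mdeg (scale_exp n \<mu>) = n * mdeg \<mu>"
proof -
  have "keys (scale_exp n \<mu>) \<subseteq> keys \<mu>" by (auto simp: in_keys_iff)
  thus ?thesis by (subst (1 2) mdeg_eq_sum[of "keys \<mu>"]) (auto simp: sum_distrib_left)
qed

lemma single_power: "single \<mu> c ^ n = single (scale_exp n \<mu>) ((c::'k::comm_semiring_1) ^ n)"
proof (induction n)
  case 0
  have "scale_exp 0 \<mu> = 0" by (rule poly_mapping_eqI) simp
  thus ?case by simp
next
  case (Suc n)
  have "scale_exp (Suc n) \<mu> = \<mu> + scale_exp n \<mu>" by (rule poly_mapping_eqI) (simp add: lookup_add)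
  thus ?case by (simp add: Suc mult_single)
qed

lemma prod_single_one:
  "(\<Prod>i\<in>I. single (g i) (1::'k::comm_semiring_1)) = single (sum g I) 1"
  by (induction I rule: infinite_finite_induct) (auto simp: mult_single)

lemma monom_val_Var: "monom_val Var \<mu> = single \<mu> (1::'k::comm_semiring_1)"
proof -
  have "scale_exp n (single i (Suc 0)) = single i n" for n and i :: 'a
    by (rule poly_mapping_eqI) (simp add: lookup_single when_def)
  hence "monom_val Var \<mu> = (\<Prod>i\<in>keys \<mu>. single (single i (lookup \<mu> i)) (1::'k))"
    unfolding monom_val_def by (simp add: single_power Var_def)
  thus ?thesis by (simp add: prod_single_one flip: mpoly_eq_sum_single)
qed

lemma monom_val_hom:
  fixes F :: "'a::comm_semiring_1 \<Rightarrow> 'b::comm_semiring_1"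
  shows "rhom F \<Longrightarrow> F (monom_val \<sigma> \<mu>) = monom_val (\<lambda>i. F (\<sigma> i)) \<mu>"
  by (simp add: monom_val_def rhom_prod rhom_power)

lemma rhom_eq_substitute:
  fixes F :: "('v, 'k::comm_semiring_1) mpoly \<Rightarrow> 'b::comm_semiring_1"
  assumes "rhom F"
  shows "F f = substitute (\<lambda>c. F (Const c)) (\<lambda>i. F (Var i)) f"
proof -
  have *: "single \<mu> c = Const c * monom_val Var \<mu>" for \<mu> :: "'v \<Rightarrow>\<^sub>0 nat" and c :: 'k
    by (simp add: monom_val_Var mult_single)
  have "F f = F (\<Sum>\<mu>\<in>keys f. single \<mu> (lookup f \<mu>))" by (simp flip: mpoly_eq_sum_single)
  also have "\<dots> = (\<Sum>\<mu>\<in>keys f. F (Const (lookup f \<mu>) * monom_val Var \<mu>))"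
    by (subst rhom_sum[OF assms], subst *) simp
  also have "\<dots> = substitute (\<lambda>c. F (Const c)) (\<lambda>i. F (Var i)) f"
    unfolding substitute_def by (simp only: rhomD(4)[OF assms] monom_val_hom[OF assms])
  finally show ?thesis .
qed

lemma rhom_eqI:
  fixes F G :: "('v, 'k::comm_semiring_1) mpoly \<Rightarrow> 'b::comm_semiring_1"
  assumes "rhom F" "rhom G" "\<And>c. F (Const c) = G (Const c)" "\<And>i. F (Var i) = G (Var i)"
  shows "F f = G f"
  by (subst rhom_eq_substitute[OF assms(1)], subst rhom_eq_substitute[OF assms(2)]) (simp add: assms)

lemma substitute_Const: "rhom \<phi> \<Longrightarrow> substitute \<phi> \<sigma> (Const c) = \<phi> c"
  by (simp add: substitute_single rhomD)

lemma substitute_Var: "rhom \<phi> \<Longrightarrow> substitute \<phi> \<sigma> (Var i) = \<sigma> i"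
  by (simp add: Var_def substitute_single rhomD)

lemma substitute_cong:
  assumes "\<And>\<mu> i. \<mu> \<in> keys f \<Longrightarrow> i \<in> keys \<mu> \<Longrightarrow> \<sigma> i = \<tau> i"
  shows "substitute \<phi> \<sigma> f = substitute \<phi> \<tau> f"
  unfolding substitute_def monom_val_def using assms by (intro sum.cong prod.cong refl arg_cong2[where f="(*)"]) auto

lemma poly_eval_eq_substitute: "poly_eval a f = substitute (\<lambda>c. c) a f"
  by (simp add: poly_eval_def substitute_def monom_val_def)

lemma rhom_poly_eval: "rhom (poly_eval a)"
  unfolding poly_eval_eq_substitute[abs_def] by (intro rhom_substitute rhom_id)

lemma poly_eval_Const [simp]: "poly_eval a (Const c) = c"
  and poly_eval_Var [simp]: "poly_eval a (Var i) = a i"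
  unfolding poly_eval_eq_substitute by (simp_all add: substitute_Const substitute_Var rhom_id)

section \<open>Order of vanishing at a vector\<close>

text \<open>Taylor expansion at \<open>v\<close>. Its coefficients are the Hasse derivatives at \<open>v\<close>, which define
  the order of vanishing correctly in every characteristic.\<close>
definition shift :: "('v \<Rightarrow> 'k::comm_ring_1) \<Rightarrow> ('v, 'k) mpoly \<Rightarrow> ('v, 'k) mpoly" where
  "shift v = substitute Const (\<lambda>i. Var i + Const (v i))"

lemma rhom_shift: "rhom (shift v)"
  unfolding shift_def by (intro rhom_substitute rhom_Const)

lemma shift_Const [simp]: "shift v (Const c) = Const c"
  and shift_Var [simp]: "shift v (Var i) = Var i + Const (v i)"
  unfolding shift_def by (simp_all add: substitute_Const substitute_Var rhom_Const)

lemma shift_shift_neg: "shift (\<lambda>i. - v i) (shift v f) = f"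
  by (rule rhom_eqI[of "\<lambda>f. shift (\<lambda>i. - v i) (shift v f)" "\<lambda>f. f"])
    (auto intro: rhom_comp rhom_shift rhom_id simp: rhomD[OF rhom_shift] single_uminus)

lemma lookup_zero_eq_eval:
  fixes f :: "('a, 'b::comm_ring_1) mpoly"
  shows "lookup f 0 = poly_eval (\<lambda>_. 0) f"
proof -
  have m: "monom_val (\<lambda>_. 0::'b) \<mu> = (if \<mu> = 0 then 1 else 0)" for \<mu> :: "'a \<Rightarrow>\<^sub>0 nat"
  proof (cases "\<mu> = 0")
    case False
    then obtain i where "i \<in> keys \<mu>" by (metis keys_eq_empty ex_in_conv)
    hence "(0::'b) ^ lookup \<mu> i = 0" by (intro zero_power) (simp add: in_keys_iff)
    thus ?thesis using False \<open>i \<in> keys \<mu>\<close> unfolding monom_val_def by (auto intro!: prod_zero)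
  qed simp
  have "(\<Sum>\<mu>\<in>keys f. lookup f \<mu> * monom_val (\<lambda>_. 0) \<mu>) = (\<Sum>\<mu>\<in>keys f. if \<mu> = 0 then lookup f 0 else 0)"
    by (intro sum.cong) (auto simp: m)
  thus ?thesis unfolding poly_eval_eq_substitute substitute_def
    by (simp add: in_keys_iff)
qed

lemma lookup_shift_zero: "lookup (shift v f) 0 = poly_eval v f"
  unfolding lookup_zero_eq_eval
  by (rule rhom_eqI[of "\<lambda>f. poly_eval (\<lambda>_. 0) (shift v f)" "poly_eval v"])
    (auto intro: rhom_comp rhom_shift rhom_poly_eval simp: rhomD[OF rhom_poly_eval])

definition vanishes :: "nat \<Rightarrow> ('v \<Rightarrow> 'k::comm_ring_1) \<Rightarrow> ('v, 'k) mpoly \<Rightarrow> bool" where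
  "vanishes t v f \<longleftrightarrow> (\<forall>\<alpha>. mdeg \<alpha> < t \<longrightarrow> lookup (shift v f) \<alpha> = 0)"

text \<open>Introducing a parameter \<open>T\<close> by \<open>x\<^sub>i \<mapsto> T x\<^sub>i\<close> turns the total degree into the degree
  of a univariate polynomial, so that orders of vanishing become orders of polynomials
  over an integral domain.\<close>
definition grade :: "('v, 'k::comm_ring_1) mpoly \<Rightarrow> ('v, 'k) mpoly poly" where
  "grade = substitute (\<lambda>c. [:Const c:]) (\<lambda>i. [:0, Var i:])"

lemma rhom_pCons: "rhom F \<Longrightarrow> rhom (\<lambda>c. [:F c:])" for F :: "'a::comm_semiring_1 \<Rightarrow> 'b::comm_semiring_1"
  by (auto simp: rhom_def pCons_one mult.commute)

lemma rhom_grade: "rhom grade"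
  unfolding grade_def by (intro rhom_substitute rhom_pCons rhom_Const)

lemma monom_val_smult:
  fixes \<sigma> :: "'v \<Rightarrow> 'b::comm_ring_1"
  shows "monom_val (\<lambda>i. [:0, \<sigma> i:]) \<mu> = monom (monom_val \<sigma> \<mu>) (mdeg \<mu>)"
proof -
  have m: "monom (prod f I) (sum g I) = (\<Prod>i\<in>I. monom (f i) (g i))" for f :: "'v \<Rightarrow> 'b" and g I
    by (induction I rule: infinite_finite_induct) (simp_all flip: mult_monom)
  have "[:0, \<sigma> i:] = monom (\<sigma> i) 1" for i by (simp add: monom_altdef)
  thus ?thesis unfolding monom_val_def mdeg_def by (simp add: m monom_power)
qed

lemma lookup_coeff_grade: "lookup (coeff (grade f) j) \<alpha> = (if mdeg \<alpha> = j then lookup f \<alpha> else 0)"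
proof -
  have "grade f = (\<Sum>\<mu>\<in>keys f. monom (single \<mu> (lookup f \<mu>)) (mdeg \<mu>))"
    unfolding grade_def substitute_def monom_val_smult monom_val_Var
    by (simp add: smult_monom mult_single)
  hence "lookup (coeff (grade f) j) \<alpha> = (\<Sum>\<mu>\<in>keys f. if \<mu> = \<alpha> then (if mdeg \<alpha> = j then lookup f \<alpha> else 0) else 0)"
    by (simp only: coeff_sum lookup_sum) (rule sum.cong, auto simp: lookup_single when_def)
  also have "\<dots> = (if mdeg \<alpha> = j then lookup f \<alpha> else 0)" by (simp add: in_keys_iff)
  finally show ?thesis .
qed

lemma grade_eq_0_iff: "grade f = 0 \<longleftrightarrow> f = 0"
proof
  assume "grade f = 0"
  hence "lookup f \<alpha> = 0" for \<alpha> using lookup_coeff_grade[of f "mdeg \<alpha>" \<alpha>] by simp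
  thus "f = 0" by (intro poly_mapping_eqI) simp
qed (simp add: rhomD[OF rhom_grade])

lemma vanishes_iff_coeff: "vanishes t v f \<longleftrightarrow> (\<forall>j<t. coeff (grade (shift v f)) j = 0)"
proof
  assume "vanishes t v f"
  thus "\<forall>j<t. coeff (grade (shift v f)) j = 0"
    by (auto intro!: poly_mapping_eqI simp: lookup_coeff_grade vanishes_def)
next
  assume *: "\<forall>j<t. coeff (grade (shift v f)) j = 0"
  show "vanishes t v f" unfolding vanishes_def
  proof (intro allI impI)
    fix \<alpha> :: "'a \<Rightarrow>\<^sub>0 nat" assume "mdeg \<alpha> < t"
    thus "lookup (shift v f) \<alpha> = 0"
      using * lookup_coeff_grade[of "shift v f" "mdeg \<alpha>" \<alpha>] by simp
  qed
qed

lemma vanishes_iff_dvd: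
  fixes f :: "('v, 'k::comm_ring_1) mpoly"
  shows "vanishes t v f \<longleftrightarrow> [:0, 1:] ^ t dvd grade (shift v f)"
  unfolding vanishes_iff_coeff monom_1_dvd_iff'[symmetric] by (simp add: monom_altdef)

lemma vanishes_add: "vanishes t v f \<Longrightarrow> vanishes t v g \<Longrightarrow> vanishes t v (f + g)"
  by (simp add: vanishes_def rhomD[OF rhom_shift] lookup_add)

lemma vanishes_zero [simp]: "vanishes t v 0"
  by (simp add: vanishes_def rhomD[OF rhom_shift])

lemma vanishes_0 [simp]: "vanishes 0 v f"
  by (simp add: vanishes_def)

lemma vanishes_1_iff: "vanishes 1 v f \<longleftrightarrow> poly_eval v f = 0"
  by (auto simp: vanishes_def mdeg_eq_0_iff lookup_shift_zero)

lemma vanishes_mono: "vanishes t v f \<Longrightarrow> u \<le> t \<Longrightarrow> vanishes u v f"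
  by (auto simp: vanishes_def)

lemma vanishes_mult:
  fixes f :: "('v, 'k::comm_ring_1) mpoly"
  assumes "vanishes t v f" "vanishes u v g" shows "vanishes (t + u) v (f * g)"
  using assms unfolding vanishes_iff_dvd by (simp add: rhomD[OF rhom_shift] rhomD[OF rhom_grade] power_add mult_dvd_mono)

lemma vanishes_mult_left: "vanishes t v g \<Longrightarrow> vanishes t v (f * g)" for f :: "('v, 'k::comm_ring_1) mpoly"
  using vanishes_mult[of 0 v f t g] by simp

lemma vanishes_power:
  fixes f :: "('v, 'k::comm_ring_1) mpoly"
  shows "vanishes t v f \<Longrightarrow> vanishes (n * t) v (f ^ n)"
  by (induction n) (auto intro: vanishes_mult)

text \<open>Orders at \<open>0\<close> of univariate polynomials over a domain are additive.\<close>
lemma vanishes_mult_cancel: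
  fixes f g :: "('v::linorder, 'k::idom) mpoly"
  assumes "vanishes (t + u) v (f * g)" "\<not> vanishes (Suc u) v f"
  shows "vanishes t v g"
proof (cases "f * g = 0")
  case True
  have "f \<noteq> 0" using assms by auto
  thus ?thesis using True by simp
next
  case False
  define F G where "F = grade (shift v f)" and "G = grade (shift v g)"
  have nz: "F \<noteq> 0" "G \<noteq> 0"
    unfolding F_def G_def grade_eq_0_iff using False shift_shift_neg[of v f] shift_shift_neg[of v g]
    by (auto simp: rhomD[OF rhom_shift])
  have fg: "grade (shift v (f * g)) = F * G"
    by (simp add: F_def G_def rhomD[OF rhom_shift] rhomD[OF rhom_grade])
  have "\<not> [:0, 1:] ^ Suc u dvd F" using assms(2) by (simp add: vanishes_iff_dvd F_def)
  hence "order 0 F < Suc u" using nz by (metis order_divides[of 0] minus_zero not_less)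
  moreover have "[:0, 1:] ^ (t + u) dvd F * G" using assms(1) unfolding vanishes_iff_dvd fg .
  hence "t + u \<le> order 0 (F * G)" using nz by (metis order_divides[of 0] minus_zero no_zero_divisors)
  ultimately have "t \<le> order 0 G" using nz by (simp add: order_mult)
  hence "[:0, 1:] ^ t dvd G" using nz by (metis order_divides[of 0] minus_zero)
  thus ?thesis by (simp add: vanishes_iff_dvd G_def)
qed


definition vars_in :: "'v set \<Rightarrow> ('v, 'k::zero) mpoly \<Rightarrow> bool" where
  "vars_in V f \<longleftrightarrow> (\<forall>\<mu>\<in>keys f. keys \<mu> \<subseteq> V)"

lemma keys_add_exp: "keys (\<mu> + \<nu>) = keys \<mu> \<union> keys \<nu>" for \<mu> \<nu> :: "'v \<Rightarrow>\<^sub>0 nat"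
  by (auto simp: in_keys_iff lookup_add)

lemma vars_in_zero [simp]: "vars_in V 0"
  by (simp add: vars_in_def)

lemma vars_in_single: "keys \<mu> \<subseteq> V \<Longrightarrow> vars_in V (single \<mu> c)"
  by (auto simp: vars_in_def split: if_splits)

lemma vars_in_Const [simp]: "vars_in V (Const c)"
  by (intro vars_in_single) simp

lemma vars_in_one [simp]: "vars_in V (1 :: ('v, 'k::zero_neq_one) mpoly)"
  using vars_in_Const[of V "1::'k"] by simp

lemma vars_in_Var: "i \<in> V \<Longrightarrow> vars_in V (Var i)"
  unfolding Var_def by (intro vars_in_single) simp

lemma vars_in_add: "vars_in V f \<Longrightarrow> vars_in V g \<Longrightarrow> vars_in V (f + g)"
  unfolding vars_in_def using keys_add[of f g] by blast

lemma vars_in_uminus: "vars_in V f \<Longrightarrow> vars_in V (- f)" for f :: "('v, 'k::comm_ring_1) mpoly"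
  unfolding vars_in_def by (simp add: in_keys_iff)

lemma vars_in_diff: "vars_in V f \<Longrightarrow> vars_in V g \<Longrightarrow> vars_in V (f - g)" for f :: "('v, 'k::comm_ring_1) mpoly"
  using vars_in_add[of V f "- g"] vars_in_uminus[of V g] by simp

lemma vars_in_mult: "vars_in V f \<Longrightarrow> vars_in V g \<Longrightarrow> vars_in V (f * g)"
  for f :: "('v, 'k::comm_semiring_1) mpoly"
  unfolding vars_in_def using keys_mult[of f g] by (fastforce simp: keys_add_exp)

lemma vars_in_sum: "(\<And>i. i \<in> I \<Longrightarrow> vars_in V (f i)) \<Longrightarrow> vars_in V (sum f I)"
  by (induction I rule: infinite_finite_induct) (auto intro: vars_in_add)

lemma vars_in_prod: "(\<And>i. i \<in> I \<Longrightarrow> vars_in V (f i)) \<Longrightarrow> vars_in V (prod f I)"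
  for f :: "_ \<Rightarrow> ('v, 'k::comm_semiring_1) mpoly"
  by (induction I rule: infinite_finite_induct) (auto intro: vars_in_mult)

lemma vars_in_power: "vars_in V f \<Longrightarrow> vars_in V (f ^ n)" for f :: "('v, 'k::comm_semiring_1) mpoly"
  by (induction n) (auto intro: vars_in_mult)

lemma vars_in_induct [consumes 1, case_names Const Var add mult]:
  fixes f :: "('v, 'k::comm_semiring_1) mpoly"
  assumes f: "vars_in V f" and C: "\<And>c. P (Const c)" and X: "\<And>i. i \<in> V \<Longrightarrow> P (Var i)"
    and add: "\<And>f g. P f \<Longrightarrow> P g \<Longrightarrow> P (f + g)" and mult: "\<And>f g. P f \<Longrightarrow> P g \<Longrightarrow> P (f * g)"
  shows "P f"
proof -
  have P0: "P 0" "P 1" using C[of 0] C[of 1] by simp_all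
  have pw: "P g \<Longrightarrow> P (g ^ n)" for g n by (induction n) (auto intro: P0 mult)
  have m: "P (single \<mu> c)" if "keys \<mu> \<subseteq> V" for \<mu> c
  proof -
    have "P (\<Prod>i\<in>I. Var i ^ lookup \<mu> i)" if "I \<subseteq> V" for I
      using that by (induction I rule: infinite_finite_induct) (auto intro!: P0 mult pw X)
    hence "P (Const c * monom_val Var \<mu>)" using that by (auto simp: monom_val_def intro!: mult C)
    thus ?thesis by (simp add: monom_val_Var mult_single)
  qed
  have "P (\<Sum>\<mu>\<in>S. single \<mu> (lookup f \<mu>))" if "S \<subseteq> keys f" for S
    using that f by (induction S rule: infinite_finite_induct) (auto intro!: P0 add m simp: vars_in_def)
  thus ?thesis by (metis order_refl mpoly_eq_sum_single)
qed

lemma poly_eval_cong: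
  assumes "vars_in V f" "\<And>i. i \<in> V \<Longrightarrow> v i = w i"
  shows "poly_eval v f = poly_eval w f"
  unfolding poly_eval_eq_substitute using assms by (intro substitute_cong) (auto simp: vars_in_def)

lemma shift_cong: "vars_in V f \<Longrightarrow> (\<And>i. i \<in> V \<Longrightarrow> v i = w i) \<Longrightarrow> shift v f = shift w f"
  unfolding shift_def by (intro substitute_cong) (fastforce simp: vars_in_def)

lemma vanishes_cong:
  "vars_in V f \<Longrightarrow> (\<And>i. i \<in> V \<Longrightarrow> v i = w i) \<Longrightarrow> vanishes t v f \<longleftrightarrow> vanishes t w f"
  using shift_cong[of V f v w] by (simp add: vanishes_def)

lemma homogeneous_zero [simp]: "homogeneous d 0"
  by (simp add: homogeneous_iff)

lemma homogeneous_single: "mdeg \<mu> = d \<Longrightarrow> homogeneous d (single \<mu> c)"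
  by (auto simp: homogeneous_iff split: if_splits)

lemma homogeneous_Const [simp]: "homogeneous 0 (Const c)"
  by (intro homogeneous_single) simp

lemma homogeneous_one [simp]: "homogeneous 0 (1 :: ('v, 'k::zero_neq_one) mpoly)"
  using homogeneous_Const[where 'a = 'v, of "1::'k"] by simp

lemma homogeneous_Var: "homogeneous 1 (Var i)"
  unfolding Var_def by (intro homogeneous_single) simp

lemma homogeneous_add: "homogeneous d f \<Longrightarrow> homogeneous d g \<Longrightarrow> homogeneous d (f + g)"
  unfolding homogeneous_iff using keys_add[of f g] by blast

lemma homogeneous_uminus: "homogeneous d f \<Longrightarrow> homogeneous d (- f)" for f :: "('v, 'k::comm_ring_1) mpoly"
  unfolding homogeneous_iff by (simp add: in_keys_iff)

lemma homogeneous_diff: "homogeneous d f \<Longrightarrow> homogeneous d g \<Longrightarrow> homogeneous d (f - g)"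
  for f :: "('v, 'k::comm_ring_1) mpoly"
  using homogeneous_add[of d f "- g"] homogeneous_uminus[of d g] by simp

lemma homogeneous_mult: "homogeneous d f \<Longrightarrow> homogeneous e g \<Longrightarrow> homogeneous (d + e) (f * g)"
  for f :: "('v, 'k::comm_semiring_1) mpoly"
  unfolding homogeneous_iff using keys_mult[of f g] by (fastforce simp: mdeg_add)

lemma homogeneous_sum: "(\<And>i. i \<in> I \<Longrightarrow> homogeneous d (f i)) \<Longrightarrow> homogeneous d (sum f I)"
  by (induction I rule: infinite_finite_induct) (auto intro: homogeneous_add)

lemma homogeneous_power: "homogeneous d f \<Longrightarrow> homogeneous (n * d) (f ^ n)"
  for f :: "('v, 'k::comm_semiring_1) mpoly"
  by (induction n) (auto intro: homogeneous_mult)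

lemma homogeneous_prod:
  fixes f :: "_ \<Rightarrow> ('v, 'k::comm_semiring_1) mpoly"
  shows "(\<And>i. i \<in> I \<Longrightarrow> homogeneous (d i) (f i)) \<Longrightarrow> homogeneous (sum d I) (prod f I)"
  by (induction I rule: infinite_finite_induct) (auto intro: homogeneous_mult)

lemma homogeneous_Const_Var: "homogeneous 1 (Const c * Var i)" for c :: "'k::comm_semiring_1"
  using homogeneous_mult[OF homogeneous_Const homogeneous_Var, of c i] by simp

lemma homogeneous_monom_val:
  fixes L :: "'v \<Rightarrow> ('w, 'k::comm_semiring_1) mpoly"
  assumes "\<And>i. homogeneous 1 (L i)"
  shows "homogeneous (mdeg \<mu>) (monom_val L \<mu>)"
  unfolding monom_val_def mdeg_def
  using homogeneous_power[OF assms] by (intro homogeneous_prod) simp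

lemma homogeneous_linear_substitute:
  fixes L :: "'v \<Rightarrow> ('w, 'k::comm_semiring_1) mpoly"
  assumes "\<And>i. homogeneous 1 (L i)" "homogeneous d f"
  shows "homogeneous d (substitute Const L f)"
  unfolding substitute_def
proof (rule homogeneous_sum)
  fix \<mu> assume "\<mu> \<in> keys f"
  hence "mdeg \<mu> = d" using assms(2) by (simp add: homogeneous_iff)
  thus "homogeneous d (Const (lookup f \<mu>) * monom_val L \<mu>)"
    using homogeneous_mult[OF homogeneous_Const homogeneous_monom_val[of L \<mu>, OF assms(1)]] by simp
qed

lemma lookup_linear_substitute_eq_0:
  fixes L :: "'v \<Rightarrow> ('w, 'k::comm_semiring_1) mpoly"
  assumes "\<And>i. homogeneous 1 (L i)" "\<And>\<mu>. mdeg \<mu> = mdeg \<alpha> \<Longrightarrow> lookup f \<mu> = 0"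
  shows "lookup (substitute Const L f) \<alpha> = 0"
proof -
  have "lookup (Const (lookup f \<mu>) * monom_val L \<mu>) \<alpha> = 0" if "\<mu> \<in> keys f" for \<mu>
  proof -
    have "homogeneous (mdeg \<mu>) (Const (lookup f \<mu>) * monom_val L \<mu>)"
      using homogeneous_mult[OF homogeneous_Const homogeneous_monom_val[of L \<mu>, OF assms(1)]] by simp
    moreover have "mdeg \<mu> \<noteq> mdeg \<alpha>" using that assms(2)[of \<mu>] by (auto simp: in_keys_iff)
    ultimately show ?thesis by (metis homogeneous_iff in_keys_iff)
  qed
  thus ?thesis unfolding substitute_def lookup_sum by (intro sum.neutral) auto
qed

lemma vanishes_scaled_substitute:
  fixes f :: "('v, 'k::comm_ring_1) mpoly" and j :: "'v \<Rightarrow> 'v"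
  assumes "vanishes t (\<lambda>i. a i * v (j i)) f"
  shows "vanishes t v (substitute Const (\<lambda>i. Const (a i) * Var (j i)) f)"
proof -
  define S where "S = substitute Const (\<lambda>i. Const (a i) * Var (j i) :: ('v, 'k) mpoly)"
  have S: "rhom S" unfolding S_def by (intro rhom_substitute rhom_Const)
  have SX: "S (Const c) = Const c" "S (Var i) = Const (a i) * Var (j i)" for c i
    unfolding S_def by (simp_all add: substitute_Const substitute_Var rhom_Const)
  have "shift v (S f) = S (shift (\<lambda>i. a i * v (j i)) f)"
    by (rule rhom_eqI[of "\<lambda>f. shift v (S f)" "\<lambda>f. S (shift (\<lambda>i. a i * v (j i)) f)"])
      (auto intro: rhom_comp rhom_shift S simp: rhomD[OF S] SX rhomD[OF rhom_shift] mult_single algebra_simps)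
  moreover have "lookup (S (shift (\<lambda>i. a i * v (j i)) f)) \<alpha> = 0" if "mdeg \<alpha> < t" for \<alpha>
    unfolding S_def using that assms
    by (intro lookup_linear_substitute_eq_0 homogeneous_Const_Var) (simp add: vanishes_def)
  ultimately show ?thesis by (simp add: vanishes_def S_def)
qed

lemma substitute_Const_eq_homogeneous:
  fixes f :: "('v, 'k::comm_ring_1) mpoly"
  assumes "homogeneous d f"
  shows "substitute Const (\<lambda>i. Const c * Var i) f = Const (c ^ d) * f"
proof -
  have "monom_val (\<lambda>i. Const c * Var i :: ('v, 'k) mpoly) \<mu> = single \<mu> (c ^ mdeg \<mu>)" for \<mu>
  proof -
    have "monom_val (\<lambda>i. Const c * Var i :: ('v, 'k) mpoly) \<mu> = (\<Prod>i\<in>keys \<mu>. Const c ^ lookup \<mu> i) * monom_val Var \<mu>"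
      by (simp add: monom_val_def power_mult_distrib prod.distrib)
    also have "(\<Prod>i\<in>keys \<mu>. Const c ^ lookup \<mu> i :: ('v, 'k) mpoly) = Const c ^ mdeg \<mu>"
      by (simp add: mdeg_def power_sum)
    also have "\<dots> = Const (c ^ mdeg \<mu>)" by (rule rhom_power[OF rhom_Const, symmetric])
    finally show ?thesis by (simp add: monom_val_Var mult_single)
  qed
  hence "substitute Const (\<lambda>i. Const c * Var i) f = (\<Sum>\<mu>\<in>keys f. Const (c ^ d) * single \<mu> (lookup f \<mu>))"
    unfolding substitute_def using assms by (intro sum.cong) (auto simp: homogeneous_iff mult_single mult.commute)
  also have "\<dots> = Const (c ^ d) * f" by (simp flip: sum_distrib_left mpoly_eq_sum_single)
  finally show ?thesis .
qed

lemma vanishes_scale: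
  fixes f :: "('v, 'k::field) mpoly"
  assumes "homogeneous d f" "c \<noteq> 0" "vanishes t (\<lambda>i. c * v i) f"
  shows "vanishes t v f"
proof -
  have "vanishes t v (Const (c ^ d) * f)"
    using vanishes_scaled_substitute[of t "\<lambda>_. c" v "\<lambda>i. i" f] assms(3)
    by (simp add: substitute_Const_eq_homogeneous[OF assms(1)])
  hence "vanishes t v (Const (inverse (c ^ d)) * (Const (c ^ d) * f))" by (rule vanishes_mult_left)
  thus ?thesis using assms(2) by (simp add: mult_single flip: mult.assoc)
qed

lemma grade_homogeneous: "homogeneous d f \<Longrightarrow> grade f = monom f d"
  by (intro poly_eqI poly_mapping_eqI) (auto simp: lookup_coeff_grade homogeneous_iff in_keys_iff)

lemma homogeneous_coeff_grade: "homogeneous j (coeff (grade f) j)"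
  by (auto simp: homogeneous_iff in_keys_iff lookup_coeff_grade split: if_splits)

lemma vars_in_coeff_grade: "vars_in V f \<Longrightarrow> vars_in V (coeff (grade f) j)"
  by (auto simp: vars_in_def in_keys_iff lookup_coeff_grade split: if_splits)

lemma mpoly_eq_sum_components:
  fixes f :: "('v, 'k::comm_ring_1) mpoly"
  shows "f = (\<Sum>j\<in>mdeg ` keys f. coeff (grade f) j)"
proof (rule poly_mapping_eqI)
  fix \<alpha> show "lookup f \<alpha> = lookup (\<Sum>j\<in>mdeg ` keys f. coeff (grade f) j) \<alpha>"
    unfolding lookup_sum lookup_coeff_grade by (simp add: image_iff, intro impI ccontr[of "lookup f \<alpha> = 0"]) (auto simp: in_keys_iff)
qed

text \<open>The restriction to the hyperplane \<open>x\<^sub>n = c x\<^sub>0\<close>, written in the remaining coordinates so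
  that forms go to forms.\<close>
definition restrict_hyperplane :: "nat \<Rightarrow> 'k::comm_ring_1 \<Rightarrow> (nat, 'k) mpoly \<Rightarrow> (nat, 'k) mpoly" where
  "restrict_hyperplane n c = substitute Const (\<lambda>i. Const (if i = n then c else 1) * Var (if i = n then 0 else i))"

lemma rhom_restrict_hyperplane: "rhom (restrict_hyperplane n c)"
  unfolding restrict_hyperplane_def by (intro rhom_substitute rhom_Const)

lemma restrict_hyperplane_simps [simp]:
  "restrict_hyperplane n c (Const b) = Const b"
  "restrict_hyperplane n c (Var i) = (if i = n then Const c * Var 0 else Var i)"
  unfolding restrict_hyperplane_def by (simp_all add: substitute_Const substitute_Var rhom_Const)

lemma vanishes_restrict_hyperplane:
  assumes "vanishes t v f" "v n = c * v 0"
  shows "vanishes t v (restrict_hyperplane n c f)"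
proof -
  have "(\<lambda>i. (if i = n then c else 1) * v (if i = n then 0 else i)) = v" using assms by auto
  thus ?thesis unfolding restrict_hyperplane_def using assms(1) by (intro vanishes_scaled_substitute) simp
qed

lemma homogeneous_restrict_hyperplane:
  "homogeneous d f \<Longrightarrow> homogeneous d (restrict_hyperplane n c f)"
  unfolding restrict_hyperplane_def
  by (intro homogeneous_linear_substitute homogeneous_Const_Var)

lemma vars_in_restrict_hyperplane:
  assumes "vars_in {0..n} f" "n > 0"
  shows "vars_in {0..n - 1} (restrict_hyperplane n c f)"
  using assms(1) by (induction rule: vars_in_induct)
    (use assms(2) in \<open>auto simp: rhomD[OF rhom_restrict_hyperplane] intro!: vars_in_add vars_in_mult vars_in_Var\<close>)

lemma hyperplane_dvd_diff_restrict:
  assumes "vars_in V f" "n \<in> V" "0 \<in> V"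
  shows "\<exists>g. vars_in V g \<and> f - restrict_hyperplane n c f = (Var n - Const c * Var 0) * g"
  using assms(1)
proof -
  have "vars_in V f \<and> vars_in V (restrict_hyperplane n c f) \<and>
    (\<exists>g. vars_in V g \<and> f - restrict_hyperplane n c f = (Var n - Const c * Var 0) * g)"
    using assms(1)
  proof (induction rule: vars_in_induct)
    case (Const b) show ?case by (intro conjI exI[of _ 0]) simp_all
  next
    case (Var i)
    have "vars_in V (restrict_hyperplane n c (Var i))"
      using Var assms by (cases "i = n") (simp_all add: vars_in_Var vars_in_mult)
    thus ?case using Var by (intro conjI exI[of _ "if i = n then 1 else 0"]) (simp_all add: vars_in_Var)
  next
    case (add f g)
    then obtain h k where *: "vars_in V h" "f - restrict_hyperplane n c f = (Var n - Const c * Var 0) * h"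
      "vars_in V k" "g - restrict_hyperplane n c g = (Var n - Const c * Var 0) * k" by blast
    have "f + g - (restrict_hyperplane n c f + restrict_hyperplane n c g)
        = (f - restrict_hyperplane n c f) + (g - restrict_hyperplane n c g)" by simp
    also have "\<dots> = (Var n - Const c * Var 0) * (h + k)" unfolding * by (simp add: distrib_left)
    finally show ?case using add *(1,3) unfolding rhomD[OF rhom_restrict_hyperplane]
      by (intro conjI exI[of _ "h + k"] vars_in_add) simp_all
  next
    case (mult f g)
    then obtain h k where *: "vars_in V h" "f - restrict_hyperplane n c f = (Var n - Const c * Var 0) * h"
      "vars_in V k" "g - restrict_hyperplane n c g = (Var n - Const c * Var 0) * k" by blast
    have "f * g - restrict_hyperplane n c f * restrict_hyperplane n c g
        = (f - restrict_hyperplane n c f) * g + restrict_hyperplane n c f * (g - restrict_hyperplane n c g)"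
      by (simp add: algebra_simps)
    also have "\<dots> = (Var n - Const c * Var 0) * (h * g + restrict_hyperplane n c f * k)"
      unfolding * by (simp add: algebra_simps)
    finally show ?case using mult *(1,3) unfolding rhomD[OF rhom_restrict_hyperplane]
      by (intro conjI exI[of _ "h * g + restrict_hyperplane n c f * k"] vars_in_add vars_in_mult) simp_all
  qed
  thus ?thesis by blast
qed

text \<open>A polynomial differs from its restriction by a multiple of the equation of the
  hyperplane; of the quotient, only the component of degree \<open>d - 1\<close> contributes.\<close>
lemma homogeneous_divide_hyperplane:
  fixes f :: "(nat, 'k::field) mpoly"
  assumes f: "vars_in {0..n} f" "homogeneous d f" "f \<noteq> 0" and r: "restrict_hyperplane n c f = 0"
  shows "\<exists>g. d > 0 \<and> vars_in {0..n} g \<and> homogeneous (d - 1) g \<and> g \<noteq> 0 \<and> f = (Var n - Const c * Var 0) * g"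
proof -
  obtain g where g: "vars_in {0..n} g" "f = (Var n - Const c * Var 0) * g"
    using hyperplane_dvd_diff_restrict[OF f(1), of n c] r by auto
  have l: "homogeneous 1 (Var n - Const c * Var 0 :: (nat, 'k) mpoly)"
    by (intro homogeneous_diff homogeneous_Var homogeneous_Const_Var)
  have "grade f = grade (Var n - Const c * Var 0) * grade g"
    by (subst g(2)) (rule rhomD(4)[OF rhom_grade])
  hence "monom f d = monom (Var n - Const c * Var 0) 1 * grade g"
    unfolding grade_homogeneous[OF l] grade_homogeneous[OF f(2)] .
  moreover have "f = coeff (monom f d) d" by simp
  ultimately have "f = coeff (monom (Var n - Const c * Var 0) 1 * grade g) d" by argo
  also have "\<dots> = (if d = 0 then 0 else (Var n - Const c * Var 0) * coeff (grade g) (d - 1))"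
    by (simp add: coeff_monom_mult)
  finally have *: "d > 0" "f = (Var n - Const c * Var 0) * coeff (grade g) (d - 1)"
    using f(3) by (auto split: if_splits)
  moreover have "coeff (grade g) (d - 1) \<noteq> 0" using * f(3) by auto
  ultimately show ?thesis using g(1) homogeneous_coeff_grade vars_in_coeff_grade by blast
qed

text \<open>The equation of a hyperplane has order one at its points and order zero elsewhere.\<close>
lemma vanishes_divide_hyperplane:
  fixes g :: "(nat, 'k::field) mpoly"
  assumes "vanishes t v ((Var n - Const c * Var 0) * g)" "n \<noteq> 0"
  shows "vanishes (t - 1) v g" "v n \<noteq> c * v 0 \<Longrightarrow> vanishes t v g"
proof -
  have ev: "poly_eval v (Var n - Const c * Var 0) = v n - c * v 0"
    by (simp add: rhom_diff[OF rhom_poly_eval] rhomD[OF rhom_poly_eval])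
  show "vanishes t v g" if "v n \<noteq> c * v 0"
  proof (rule vanishes_mult_cancel)
    show "vanishes (t + 0) v ((Var n - Const c * Var 0) * g)" using assms by simp
    show "\<not> vanishes (Suc 0) v (Var n - Const c * Var 0)"
      using vanishes_1_iff[of v "Var n - Const c * Var 0"] that unfolding ev One_nat_def by simp
  qed
  have "lookup (shift v (Var n - Const c * Var 0 :: (nat, 'k) mpoly)) (single n 1) = 1"
  proof -
    have ne: "single 0 (1::nat) \<noteq> single n 1" "0 \<noteq> single n (1::nat)"
      using assms(2) by (metis lookup_single_eq lookup_single_not_eq zero_neq_one,
          metis lookup_single_eq lookup_zero zero_neq_one)
    have "shift v (Var n - Const c * Var 0) = Var n - Const c * Var 0 + (Const (v n) - Const c * Const (v 0))"
      by (simp only: rhom_diff[OF rhom_shift] rhomD(3,4)[OF rhom_shift] shift_Const shift_Var distrib_left) simp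
    also have "\<dots> = single (single n 1) 1 - single (single 0 1) c + (single 0 (v n) - single 0 (c * v 0))"
      by (simp only: Var_def mult_single) simp
    finally show ?thesis
      by (simp only: lookup_add lookup_minus lookup_single_eq lookup_single_not_eq[OF ne(1)] lookup_single_not_eq[OF ne(2)]) simp
  qed
  hence "\<not> vanishes 2 v (Var n - Const c * Var 0)"
    unfolding vanishes_def using mdeg_single[of n 1] by (intro notI) (drule spec[of _ "single n 1"], simp)
  hence nv: "\<not> vanishes (Suc 1) v (Var n - Const c * Var 0 :: (nat, 'k) mpoly)" by (simp add: numeral_2_eq_2)
  show "vanishes (t - 1) v g"
  proof (cases t)
    case (Suc u)
    show ?thesis unfolding Suc diff_Suc_1
      by (rule vanishes_mult_cancel[OF _ nv]) (use assms(1) Suc in simp)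
  qed simp
qed

section \<open>Extracting p-th roots modulo the maximal ideal\<close>

definition coeffs_in :: "'k set \<Rightarrow> ('v, 'k::zero) mpoly \<Rightarrow> bool" where
  "coeffs_in A f \<longleftrightarrow> (\<forall>\<mu>. lookup f \<mu> \<in> A)"

lemma coeffs_inD: "coeffs_in A f \<Longrightarrow> lookup f \<mu> \<in> A"
  by (simp add: coeffs_in_def)

context
  fixes A :: "'k::field set"
  assumes A: "valuation_ring A"
begin

private lemma As: "subring_of A"
  using A by (rule valuation_ring_subring)

lemma coeffs_in_single: "c \<in> A \<Longrightarrow> coeffs_in A (single \<mu> c)"
  by (simp add: coeffs_in_def lookup_single when_def subring_of_zero[OF As])

lemma coeffs_in_max_single: "c \<in> max_ideal A \<Longrightarrow> coeffs_in (max_ideal A) (single \<mu> c)"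
  by (simp add: coeffs_in_def lookup_single when_def max_ideal_zero[OF A])

lemma coeffs_in_add: "coeffs_in A f \<Longrightarrow> coeffs_in A g \<Longrightarrow> coeffs_in A (f + g)"
  by (simp add: coeffs_in_def lookup_add subring_of_add[OF As])

lemma coeffs_in_max_add:
  "coeffs_in (max_ideal A) f \<Longrightarrow> coeffs_in (max_ideal A) g \<Longrightarrow> coeffs_in (max_ideal A) (f + g)"
  by (simp add: coeffs_in_def lookup_add max_ideal_add[OF A])

lemma coeffs_in_max_diff:
  "coeffs_in (max_ideal A) f \<Longrightarrow> coeffs_in (max_ideal A) g \<Longrightarrow> coeffs_in (max_ideal A) (f - g)"
  by (simp add: coeffs_in_def lookup_minus max_ideal_diff[OF A])

lemma coeffs_in_sum: "(\<And>i. i \<in> I \<Longrightarrow> coeffs_in A (f i)) \<Longrightarrow> coeffs_in A (sum f I)"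
  by (simp add: coeffs_in_def lookup_sum subring_of_sum[OF As])

lemma coeffs_in_max_sum:
  "(\<And>i. i \<in> I \<Longrightarrow> coeffs_in (max_ideal A) (f i)) \<Longrightarrow> coeffs_in (max_ideal A) (sum f I)"
  by (simp add: coeffs_in_def lookup_sum max_ideal_sum[OF A])

lemma coeffs_in_mult:
  assumes "coeffs_in A f" "coeffs_in A g" shows "coeffs_in A (f * g)"
  unfolding coeffs_in_def lookup_mult_eq_sum using assms
  by (intro allI subring_of_sum[OF As])
    (simp add: when_def subring_of_mult[OF As] subring_of_zero[OF As] coeffs_inD)

lemma coeffs_in_max_mult:
  assumes "coeffs_in A f" "coeffs_in (max_ideal A) g" shows "coeffs_in (max_ideal A) (f * g)"
  unfolding coeffs_in_def lookup_mult_eq_sum using assms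
  by (intro allI max_ideal_sum[OF A])
    (simp add: when_def max_ideal_mult(2)[OF A] max_ideal_zero[OF A] coeffs_inD)

lemma coeffs_in_one: "coeffs_in A 1"
  using coeffs_in_single[OF subring_of_one[OF As], of 0] by simp

lemma coeffs_in_power: "coeffs_in A f \<Longrightarrow> coeffs_in A (f ^ n)"
  by (induction n) (auto intro: coeffs_in_mult coeffs_in_one)

lemma coeffs_in_prod: "(\<And>i. i \<in> I \<Longrightarrow> coeffs_in A (f i)) \<Longrightarrow> coeffs_in A (prod f I)"
  by (induction I rule: infinite_finite_induct) (auto intro: coeffs_in_mult coeffs_in_one)

lemma coeffs_in_shift_monom:
  assumes "\<And>i. v i \<in> A"
  shows "coeffs_in A (monom_val (\<lambda>i. Var i + Const (v i)) \<mu>)"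
  unfolding monom_val_def Var_def
  using assms by (intro coeffs_in_prod coeffs_in_power coeffs_in_add coeffs_in_single subring_of_one[OF As])

lemma coeffs_in_shift:
  assumes "\<And>i. v i \<in> A" "coeffs_in A f" shows "coeffs_in A (shift v f)"
  unfolding shift_def substitute_def
  using assms by (intro coeffs_in_sum coeffs_in_mult coeffs_in_shift_monom coeffs_in_single coeffs_inD)

lemma coeffs_in_max_shift:
  assumes "\<And>i. v i \<in> A" "coeffs_in (max_ideal A) f" shows "coeffs_in (max_ideal A) (shift v f)"
  unfolding shift_def substitute_def
  by (subst mult.commute)
    (intro coeffs_in_max_sum coeffs_in_max_mult coeffs_in_shift_monom coeffs_in_max_single coeffs_inD assms)

definition cong_max :: "('v, 'k) mpoly \<Rightarrow> ('v, 'k) mpoly \<Rightarrow> bool" where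
  "cong_max f g \<longleftrightarrow> coeffs_in (max_ideal A) (f - g)"

lemma cong_max_refl: "cong_max f f"
  by (simp add: cong_max_def coeffs_in_def max_ideal_zero[OF A])

lemma cong_max_trans: "cong_max f g \<Longrightarrow> cong_max g h \<Longrightarrow> cong_max f h"
  unfolding cong_max_def using coeffs_in_max_add[of "f - g" "g - h"] by simp

lemma cong_max_add: "cong_max f g \<Longrightarrow> cong_max f' g' \<Longrightarrow> cong_max (f + f') (g + g')"
  unfolding cong_max_def using coeffs_in_max_add[of "f - g" "f' - g'"] by (simp add: algebra_simps)

lemma cong_max_sum: "(\<And>i. i \<in> I \<Longrightarrow> cong_max (f i) (g i)) \<Longrightarrow> cong_max (sum f I) (sum g I)"
  by (induction I rule: infinite_finite_induct) (auto intro: cong_max_add cong_max_refl)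

lemma cong_max_mult_left: "coeffs_in A f \<Longrightarrow> cong_max g h \<Longrightarrow> cong_max (f * g) (f * h)"
  unfolding cong_max_def using coeffs_in_max_mult[of f "g - h"] by (simp add: algebra_simps)

lemma cong_max_sym: "cong_max f g \<Longrightarrow> cong_max g f"
  unfolding cong_max_def using coeffs_in_max_diff[of 0 "f - g"]
  by (simp add: coeffs_in_def max_ideal_zero[OF A])

lemma cong_max_lookup: "cong_max f g \<Longrightarrow> lookup f \<mu> \<in> max_ideal A \<longleftrightarrow> lookup g \<mu> \<in> max_ideal A"
  unfolding cong_max_def
  using max_ideal_diff[OF A, of "lookup f \<mu>" "lookup (f - g) \<mu>"]
    max_ideal_add[OF A, of "lookup g \<mu>" "lookup (f - g) \<mu>"]
  by (auto simp: coeffs_in_def lookup_minus)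

lemma cong_max_shift: "(\<And>i. v i \<in> A) \<Longrightarrow> cong_max f g \<Longrightarrow> cong_max (shift v f) (shift v g)"
  unfolding cong_max_def by (metis coeffs_in_max_shift rhom_diff rhom_shift)

text \<open>The inner binomial coefficients are divisible by \<open>p\<close>.\<close>
lemma frobenius_add:
  assumes p: "prime p" "of_nat p \<in> max_ideal A" and fg: "coeffs_in A f" "coeffs_in A g"
  shows "cong_max ((f + g) ^ p) (f ^ p + g ^ p)"
proof -
  have p0: "p > 0" using p(1) prime_gt_0_nat by blast
  define h where "h k = of_nat (p choose k) * f ^ k * g ^ (p - k)" for k
  have "(f + g) ^ p = (\<Sum>k\<le>p. h k)" unfolding h_def by (rule binomial_ring)
  also have "\<dots> = (\<Sum>k\<in>{0, p}. h k) + (\<Sum>k\<in>{..p} - {0, p}. h k)"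
    using p0 by (intro sum.subset_diff[of "{0, p}", THEN trans] add.commute) auto
  also have "(\<Sum>k\<in>{0, p}. h k) = f ^ p + g ^ p" using p0 by (simp add: h_def)
  finally have "(f + g) ^ p - (f ^ p + g ^ p) = (\<Sum>k\<in>{..p} - {0, p}. h k)" by simp
  moreover have "coeffs_in (max_ideal A) (h k)" if "k \<in> {..p} - {0, p}" for k
  proof -
    have "p dvd (p choose k)" using p(1) that by (intro dvd_choose_prime) auto
    then obtain c where "p choose k = p * c" by auto
    hence "of_nat (p choose k) = of_nat p * (of_nat c :: 'k)" by simp
    hence "of_nat (p choose k) \<in> max_ideal A"
      using max_ideal_mult(1)[OF A p(2), of "of_nat c"] subring_of_nat[OF As] by simp
    hence "coeffs_in (max_ideal A) ((f ^ k * g ^ (p - k)) * Const (of_nat (p choose k)))"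
      using fg by (intro coeffs_in_max_mult coeffs_in_mult coeffs_in_power coeffs_in_max_single)
    thus ?thesis by (simp add: h_def mult_ac)
  qed
  ultimately show ?thesis unfolding cong_max_def by (metis (no_types, lifting) coeffs_in_max_sum)
qed

lemma frobenius_sum:
  assumes p: "prime p" "of_nat p \<in> max_ideal A" and f: "\<And>i. i \<in> I \<Longrightarrow> coeffs_in A (f i)"
  shows "cong_max ((\<Sum>i\<in>I. f i) ^ p) (\<Sum>i\<in>I. f i ^ p)"
  using f
proof (induction I rule: infinite_finite_induct)
  case (insert i I)
  have "cong_max ((\<Sum>i\<in>insert i I. f i) ^ p) (f i ^ p + (\<Sum>i\<in>I. f i) ^ p)"
    using insert frobenius_add[OF p, of "f i" "\<Sum>i\<in>I. f i"] by (simp add: coeffs_in_sum)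
  moreover have "cong_max (f i ^ p + (\<Sum>i\<in>I. f i) ^ p) (f i ^ p + (\<Sum>i\<in>I. f i ^ p))"
    using insert by (intro cong_max_add cong_max_refl) auto
  ultimately show ?case using insert(1,2) cong_max_trans by simp
qed (use p(1) prime_gt_0_nat[of p] in \<open>auto simp: cong_max_refl zero_power\<close>)

definition vanishes_mod :: "nat \<Rightarrow> ('v \<Rightarrow> 'k) \<Rightarrow> ('v, 'k) mpoly \<Rightarrow> bool" where
  "vanishes_mod t v f \<longleftrightarrow> (\<forall>\<alpha>. mdeg \<alpha> < t \<longrightarrow> lookup (shift v f) \<alpha> \<in> max_ideal A)"

lemma vanishes_imp_vanishes_mod: "vanishes t v f \<Longrightarrow> vanishes_mod t v f"
  by (simp add: vanishes_def vanishes_mod_def max_ideal_zero[OF A])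

end

definition mod_exp :: "nat \<Rightarrow> ('v \<Rightarrow>\<^sub>0 nat) \<Rightarrow> ('v \<Rightarrow>\<^sub>0 nat)" where
  "mod_exp p \<mu> = Poly_Mapping.map (\<lambda>n. n mod p) \<mu>"

definition div_exp :: "nat \<Rightarrow> ('v \<Rightarrow>\<^sub>0 nat) \<Rightarrow> ('v \<Rightarrow>\<^sub>0 nat)" where
  "div_exp p \<mu> = Poly_Mapping.map (\<lambda>n. n div p) \<mu>"

lemma lookup_mod_exp [simp]: "lookup (mod_exp p \<mu>) i = lookup \<mu> i mod p"
  and lookup_div_exp [simp]: "lookup (div_exp p \<mu>) i = lookup \<mu> i div p"
  by (simp_all add: mod_exp_def div_exp_def lookup_map_zero)

lemma keys_mod_exp: "keys (mod_exp p \<mu>) \<subseteq> keys \<mu>"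
  by (metis in_keys_iff lookup_mod_exp mod_0 subsetI)

lemma keys_div_exp: "keys (div_exp p \<mu>) \<subseteq> keys \<mu>"
  by (metis in_keys_iff lookup_div_exp div_0 subsetI)

lemma scale_div_plus_mod: "scale_exp p (div_exp p \<mu>) + mod_exp p \<mu> = \<mu>"
  by (rule poly_mapping_eqI) (simp add: lookup_add)

text \<open>Translation only lowers exponents. So a monomial whose exponents are digits in base \<open>p\<close>
  keeps this property, and \<open>scale_add_digit_eq_iff\<close> applies to its Taylor expansion.\<close>
lemma keys_shift_monom:
  fixes v :: "'v \<Rightarrow> 'k::comm_ring_1"
  assumes "\<kappa> \<in> keys (shift v (single b 1))"
  shows "lookup \<kappa> i \<le> lookup b i"
proof -
  have pw: "\<exists>m\<le>n. \<kappa> = single i m" if "\<kappa> \<in> keys ((Var i + Const c) ^ n :: ('v, 'k) mpoly)" for \<kappa> i n c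
    using that
  proof (induction n arbitrary: \<kappa>)
    case (Suc n)
    obtain \<alpha> \<beta> where *: "\<kappa> = \<alpha> + \<beta>" "\<alpha> \<in> keys (Var i + Const c :: ('v, 'k) mpoly)" "\<beta> \<in> keys ((Var i + Const c) ^ n :: ('v, 'k) mpoly)"
      using Suc.prems keys_mult[of "Var i + Const c :: ('v, 'k) mpoly" "(Var i + Const c) ^ n"] by auto
    from Suc.IH[OF *(3)] obtain m where m: "m \<le> n" "\<beta> = single i m" by blast
    have "\<alpha> = single i 1 \<or> \<alpha> = 0"
      using *(2) keys_add[of "Var i" "Const c :: ('v, 'k) mpoly"] by (auto simp: Var_def split: if_splits)
    thus ?case
    proof
      assume "\<alpha> = single i 1"
      thus ?thesis using m * by (intro exI[of _ "Suc m"]) (simp flip: single_add)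
    next
      assume "\<alpha> = 0"
      thus ?thesis using m * by (intro exI[of _ m]) simp
    qed
  qed (auto intro: exI[of _ 0])
  have pr: "(\<forall>i\<in>I. lookup \<kappa> i \<le> n i) \<and> (\<forall>i. i \<notin> I \<longrightarrow> lookup \<kappa> i = 0)"
    if "finite I" "\<kappa> \<in> keys (\<Prod>i\<in>I. (Var i + Const (v i)) ^ n i)" for I n \<kappa>
    using that
  proof (induction I arbitrary: \<kappa> rule: finite_induct)
    case (insert j J)
    obtain \<alpha> \<beta> where *: "\<kappa> = \<alpha> + \<beta>" "\<alpha> \<in> keys ((Var j + Const (v j)) ^ n j)" "\<beta> \<in> keys (\<Prod>i\<in>J. (Var i + Const (v i)) ^ n i)"
      using insert keys_mult[of "(Var j + Const (v j)) ^ n j" "\<Prod>i\<in>J. (Var i + Const (v i)) ^ n i"] by auto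
    obtain m where "m \<le> n j" "\<alpha> = single j m" using pw[OF *(2)] by blast
    thus ?case using insert.IH[OF *(3)] insert.hyps *(1) by (auto simp: lookup_add lookup_single when_def)
  qed simp
  have "shift v (single b 1) = (\<Prod>i\<in>keys b. (Var i + Const (v i)) ^ lookup b i)"
    unfolding shift_def by (simp add: substitute_single monom_val_def)
  with assms have "(\<forall>i\<in>keys b. lookup \<kappa> i \<le> lookup b i) \<and> (\<forall>i. i \<notin> keys b \<longrightarrow> lookup \<kappa> i = 0)"
    using pr[of "keys b" \<kappa> "lookup b"] by simp
  thus ?thesis by (cases "i \<in> keys b") auto
qed

text \<open>Exponents with entries below \<open>p\<close> are the digits in base \<open>p\<close>.\<close>
lemma scale_add_digit_eq_iff:
  assumes "\<And>i. lookup b i < p" "\<And>i. lookup c i < p"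
  shows "b + scale_exp p \<alpha> = c + scale_exp p \<beta> \<longleftrightarrow> b = c \<and> \<alpha> = \<beta>"
proof
  assume e: "b + scale_exp p \<alpha> = c + scale_exp p \<beta>"
  have *: "lookup b i + p * lookup \<alpha> i = lookup c i + p * lookup \<beta> i" for i
    using arg_cong[OF e, of "\<lambda>x. lookup x i"] by (simp add: lookup_add)
  have "lookup b i = lookup c i \<and> lookup \<alpha> i = lookup \<beta> i" for i
  proof -
    have "(lookup b i + p * lookup \<alpha> i) mod p = lookup b i" "(lookup c i + p * lookup \<beta> i) mod p = lookup c i"
      using assms by simp_all
    hence "lookup b i = lookup c i" using *[of i] by simp
    thus ?thesis using *[of i] assms(1)[of i] by auto
  qed
  thus "b = c \<and> \<alpha> = \<beta>" by (auto intro: poly_mapping_eqI)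
qed simp

lemma lookup_mult_scaled:
  fixes f :: "('v, 'k::comm_ring_1) mpoly"
  assumes f: "\<And>\<mu> i. \<mu> \<in> keys f \<Longrightarrow> lookup \<mu> i < p" and c: "\<And>i. lookup c i < p" and S: "finite S"
  shows "lookup (f * (\<Sum>\<alpha>\<in>S. single (scale_exp p \<alpha>) (g \<alpha>))) (c + scale_exp p \<beta>)
     = (if \<beta> \<in> S then lookup f c * g \<beta> else 0)"
proof -
  have "f * (\<Sum>\<alpha>\<in>S. single (scale_exp p \<alpha>) (g \<alpha>))
      = (\<Sum>\<mu>\<in>keys f. \<Sum>\<alpha>\<in>S. single (\<mu> + scale_exp p \<alpha>) (lookup f \<mu> * g \<alpha>))"
    by (subst mpoly_eq_sum_single[of f]) (simp add: sum_product mult_single)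
  hence "lookup (f * (\<Sum>\<alpha>\<in>S. single (scale_exp p \<alpha>) (g \<alpha>))) (c + scale_exp p \<beta>)
      = (\<Sum>\<mu>\<in>keys f. \<Sum>\<alpha>\<in>S. if \<mu> = c \<and> \<alpha> = \<beta> then lookup f \<mu> * g \<alpha> else 0)"
    using f c by (simp add: lookup_sum lookup_single when_def scale_add_digit_eq_iff)
  also have "\<dots> = (\<Sum>\<mu>\<in>keys f. if \<mu> = c then (\<Sum>\<alpha>\<in>S. if \<alpha> = \<beta> then lookup f c * g \<alpha> else 0) else 0)"
    by (intro sum.cong refl) auto
  also have "\<dots> = (if \<beta> \<in> S then lookup f c * g \<beta> else 0)"
    using S by (simp add: in_keys_iff)
  finally show ?thesis .
qed


lemma mpoly_eq_sum_digits:
  fixes F :: "('v, 'k::comm_ring_1) mpoly"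
  shows "F = (\<Sum>b\<in>mod_exp p ` keys F. single b 1 *
    (\<Sum>\<mu>\<in>{\<mu>\<in>keys F. mod_exp p \<mu> = b}. single (scale_exp p (div_exp p \<mu>)) (lookup F \<mu>)))"
proof -
  have "(\<Sum>\<mu>\<in>keys F. single \<mu> (lookup F \<mu>)) =
      (\<Sum>b\<in>mod_exp p ` keys F. \<Sum>\<mu>\<in>{\<mu>\<in>keys F. mod_exp p \<mu> = b}. single \<mu> (lookup F \<mu>))"
    by (rule sum.image_gen[of "keys F" "\<lambda>\<mu>. single \<mu> (lookup F \<mu>)" "mod_exp p", OF finite_keys])
  also have "\<dots> = (\<Sum>b\<in>mod_exp p ` keys F. single b 1 *
    (\<Sum>\<mu>\<in>{\<mu>\<in>keys F. mod_exp p \<mu> = b}. single (scale_exp p (div_exp p \<mu>)) (lookup F \<mu>)))"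
    unfolding sum_distrib_left mult_single
  proof (rule sum.cong[OF refl], rule sum.cong[OF refl])
    fix b \<mu> assume "\<mu> \<in> {\<mu>\<in>keys F. mod_exp p \<mu> = b}"
    hence "b + scale_exp p (div_exp p \<mu>) = \<mu>" using scale_div_plus_mod[of p \<mu>] by (simp add: add.commute)
    thus "single \<mu> (lookup F \<mu>) = single (b + scale_exp p (div_exp p \<mu>)) (1 * lookup F \<mu>)" by simp
  qed
  finally show ?thesis by (rule trans[OF mpoly_eq_sum_single])
qed

text \<open>The polynomials \<open>G\<^sub>b\<close> in \<open>F = \<Sum>\<^sub>b x\<^sup>b G\<^sub>b\<^sup>p\<close> exist because \<open>p\<close>-th roots of the
  coefficients do. After translation to \<open>v\<close> the right-hand side is still a combination of \<open>p\<close>-th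
  powers, with coefficients \<open>shift v x\<^sup>b\<close> whose exponents are digits. Hence the coefficient of
  \<open>F\<close> at \<open>c + p \<alpha>\<close>, for digits \<open>c\<close>, only involves the coefficients of the \<open>G\<^sub>b\<close> at \<open>\<alpha>\<close>. Its
  degree is at most \<open>(p - 1) |V| + p (t - 1)\<close> if \<open>\<alpha>\<close> has degree below \<open>t\<close>, so it is in the
  maximal ideal. Translating back separates the different \<open>b\<close>.\<close>
lemma frobenius_descent:
  fixes F :: "('v, 'k::alg_closed_field) mpoly"
  assumes A: "valuation_ring A" and p: "prime p" "of_nat p \<in> max_ideal A" and V: "finite V"
    and F: "vars_in V F" "homogeneous D F" "coeffs_in A F" "\<not> coeffs_in (max_ideal A) F"
  shows "\<exists>G d. vars_in V G \<and> homogeneous d G \<and> p * d \<le> D \<and> coeffs_in A G \<and>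
    \<not> coeffs_in (max_ideal A) G \<and>
    (\<forall>v T t. (\<forall>i. v i \<in> A) \<longrightarrow> vanishes_mod A T v F \<longrightarrow> p * (t + card V) \<le> T + card V \<longrightarrow> vanishes_mod A t v G)"
proof -
  have As: "subring_of A" using A by (rule valuation_ring_subring)
  have p0: "p > 0" using p(1) prime_gt_0_nat by blast
  define rt where "rt c = (SOME y::'k. y ^ p = c)" for c
  have rt: "rt c ^ p = c" for c
    unfolding rt_def by (rule someI_ex) (use nth_root_exists[of p c] p0 in blast)
  have rtA: "rt c \<in> A" if "c \<in> A" for c
    using valuation_ring_power_closed[OF A _ p0, of "rt c"] rt that by simp
  define fib where "fib b = {\<mu>\<in>keys F. mod_exp p \<mu> = b}" for b
  define G where "G b = (\<Sum>\<mu>\<in>fib b. single (div_exp p \<mu>) (rt (lookup F \<mu>)))" for b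
  define B where "B = mod_exp p ` keys F"
  have finB: "finite B" "finite (fib b)" for b by (auto simp: B_def fib_def)
  have FA: "lookup F \<mu> \<in> A" for \<mu> using F(3) by (simp add: coeffs_in_def)
  have GA: "coeffs_in A (G b)" for b
    unfolding G_def by (intro coeffs_in_sum[OF A] coeffs_in_single[OF A] rtA FA)
  have dinj: "inj_on (div_exp p) (fib b)" for b
    by (rule inj_onI) (metis (mono_tags, lifting) fib_def mem_Collect_eq scale_div_plus_mod)
  have lG: "lookup (G b) (div_exp p \<mu>) = rt (lookup F \<mu>)" if "\<mu> \<in> fib b" for b \<mu>
  proof -
    have "lookup (G b) (div_exp p \<mu>) = (\<Sum>\<nu>\<in>fib b. if \<nu> = \<mu> then rt (lookup F \<mu>) else 0)"
      unfolding G_def lookup_sum lookup_single when_def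
      using inj_onD[OF dinj[of b]] that by (intro sum.cong refl) auto
    thus ?thesis using that finB by simp
  qed
  have keysG: "\<exists>\<mu>\<in>fib b. \<gamma> = div_exp p \<mu>" if "\<gamma> \<in> keys (G b)" for \<gamma> b
  proof -
    have "\<gamma> \<in> (\<Union>\<mu>\<in>fib b. keys (single (div_exp p \<mu>) (rt (lookup F \<mu>))))"
      using that keys_sum[of "\<lambda>\<mu>. single (div_exp p \<mu>) (rt (lookup F \<mu>))" "fib b"] unfolding G_def by blast
    thus ?thesis by (auto split: if_splits)
  qed
  have Geq: "cong_max A (G b ^ p) (\<Sum>\<mu>\<in>fib b. single (scale_exp p (div_exp p \<mu>)) (lookup F \<mu>))" for b
  proof -
    have "cong_max A (G b ^ p) (\<Sum>\<mu>\<in>fib b. single (div_exp p \<mu>) (rt (lookup F \<mu>)) ^ p)"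
      unfolding G_def by (intro frobenius_sum[OF A p] coeffs_in_single[OF A] rtA FA)
    thus ?thesis by (simp add: single_power rt)
  qed
  have mdd: "scale_exp p (div_exp p \<mu>) + b = \<mu>" if "\<mu> \<in> fib b" for \<mu> b
    using that scale_div_plus_mod[of p \<mu>] unfolding fib_def by blast
  have Fsum: "F = (\<Sum>b\<in>B. single b 1 * (\<Sum>\<mu>\<in>fib b. single (scale_exp p (div_exp p \<mu>)) (lookup F \<mu>)))"
    unfolding B_def fib_def by (rule mpoly_eq_sum_digits)
  have FG: "cong_max A F (\<Sum>b\<in>B. single b 1 * G b ^ p)"
    by (subst Fsum, intro cong_max_sum[OF A] cong_max_mult_left[OF A] cong_max_sym[OF A Geq] coeffs_in_single[OF A]
        subring_of_one[OF As])
  have keysB: "keys b \<subseteq> V" if b: "b \<in> B" for b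
  proof -
    from b have "b \<in> mod_exp p ` keys F" unfolding B_def .
    then obtain \<mu> where \<mu>: "\<mu> \<in> keys F" "b = mod_exp p \<mu>" by (elim imageE)
    have "keys \<mu> \<subseteq> V" using \<mu>(1) F(1) unfolding vars_in_def by (rule bspec[rotated])
    thus ?thesis unfolding \<mu>(2) by (rule subset_trans[OF keys_mod_exp])
  qed
  have digB: "lookup b i < p" if b: "b \<in> B" for b i
  proof -
    from b have "b \<in> mod_exp p ` keys F" unfolding B_def .
    then obtain \<mu> where \<mu>: "b = mod_exp p \<mu>" by (elim imageE)
    show ?thesis unfolding \<mu> lookup_mod_exp using p0 by (rule mod_less_divisor)
  qed
  have van: "vanishes_mod A t v (G b)"
    if v: "\<And>i. v i \<in> A" and T: "vanishes_mod A T v F" "p * (t + card V) \<le> T + card V" and b: "b \<in> B" for v T t b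
  proof -
    \<comment> \<open>\<open>P\<close> below is the Taylor expansion of \<open>\<Sum>\<^sub>b x\<^sup>b G\<^sub>b\<^sup>p\<close>, and \<open>Q\<close> collects the coefficients at a fixed \<open>\<alpha>\<close>\<close>
    define g where "g b \<alpha> = lookup (shift v (G b)) \<alpha>" for b \<alpha>
    have gA: "g b \<alpha> \<in> A" for b \<alpha> unfolding g_def by (intro coeffs_inD coeffs_in_shift[OF A] v GA)
    define K where "K = (\<Union>b\<in>B. keys (shift v (G b)))"
    have finK: "finite K" using finB by (auto simp: K_def)
    have SG: "cong_max A (shift v (G b) ^ p) (\<Sum>\<alpha>\<in>K. single (scale_exp p \<alpha>) (g b \<alpha> ^ p))" if "b \<in> B" for b
    proof -
      have "shift v (G b) = (\<Sum>\<alpha>\<in>keys (shift v (G b)). single \<alpha> (g b \<alpha>))"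
        unfolding g_def by (rule mpoly_eq_sum_single)
      also have "\<dots> = (\<Sum>\<alpha>\<in>K. single \<alpha> (g b \<alpha>))"
        using that finK by (intro sum.mono_neutral_left) (auto simp: K_def g_def in_keys_iff)
      finally have "shift v (G b) ^ p = (\<Sum>\<alpha>\<in>K. single \<alpha> (g b \<alpha>)) ^ p" by simp
      also have "cong_max A \<dots> (\<Sum>\<alpha>\<in>K. single \<alpha> (g b \<alpha>) ^ p)"
        by (intro frobenius_sum[OF A p] coeffs_in_single[OF A] gA)
      finally show ?thesis by (simp add: single_power)
    qed
    define P where "P = (\<Sum>b\<in>B. shift v (single b 1) * (\<Sum>\<alpha>\<in>K. single (scale_exp p \<alpha>) (g b \<alpha> ^ p)))"
    have "cong_max A (shift v F) (shift v (\<Sum>b\<in>B. single b 1 * G b ^ p))"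
      by (intro cong_max_shift[OF A] v FG)
    also have "shift v (\<Sum>b\<in>B. single b 1 * G b ^ p) = (\<Sum>b\<in>B. shift v (single b 1) * shift v (G b) ^ p)"
      by (simp add: rhom_sum[OF rhom_shift] rhomD[OF rhom_shift] rhom_power[OF rhom_shift])
    finally have "cong_max A (shift v F) (\<Sum>b\<in>B. shift v (single b 1) * shift v (G b) ^ p)" .
    moreover have "cong_max A (\<Sum>b\<in>B. shift v (single b 1) * shift v (G b) ^ p) P"
      unfolding P_def by (intro cong_max_sum[OF A] cong_max_mult_left[OF A] SG coeffs_in_shift[OF A] v
          coeffs_in_single[OF A] subring_of_one[OF As])
    ultimately have FP: "cong_max A (shift v F) P" by (rule cong_max_trans[OF A])
    have "g b \<alpha> \<in> max_ideal A" if \<alpha>: "mdeg \<alpha> < t" for \<alpha>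
    proof (cases "\<alpha> \<in> K")
      case False
      thus ?thesis using b max_ideal_zero[OF A] by (auto simp: K_def g_def in_keys_iff)
    next
      case True
      define Q where "Q = (\<Sum>b\<in>B. single b (g b \<alpha> ^ p))"
      have sQ: "shift v Q = (\<Sum>b\<in>B. shift v (single b 1) * Const (g b \<alpha> ^ p))"
      proof -
        have "Q = (\<Sum>b\<in>B. single b 1 * Const (g b \<alpha> ^ p))" by (simp add: Q_def mult_single)
        thus ?thesis by (simp add: rhom_sum[OF rhom_shift] rhomD[OF rhom_shift])
      qed
      have lQ: "lookup (shift v Q) c = (\<Sum>b\<in>B. lookup (shift v (single b 1)) c * g b \<alpha> ^ p)" for c
      proof -
        have "lookup (f * Const y) c = lookup f c * y" for f :: "('v, 'k) mpoly" and y
        proof -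
          have "f * Const y = (\<Sum>\<mu>\<in>keys f. single \<mu> (lookup f \<mu> * y))"
            by (subst mpoly_eq_sum_single[of f]) (simp add: sum_distrib_right mult_single)
          thus ?thesis by (simp add: lookup_sum lookup_single when_def in_keys_iff)
        qed
        thus ?thesis by (simp add: sQ lookup_sum)
      qed
      \<comment> \<open>for digits \<open>c\<close> this is the coefficient of \<open>P\<close> at \<open>c + p \<alpha>\<close>, for other \<open>c\<close> it is zero\<close>
      have "lookup (shift v Q) c \<in> max_ideal A" for c
      proof (cases "(\<forall>i. lookup c i < p) \<and> keys c \<subseteq> V")
        case True
        have "lookup P (c + scale_exp p \<alpha>) = (\<Sum>b\<in>B. lookup (shift v (single b 1)) c * g b \<alpha> ^ p)"
          unfolding P_def lookup_sum
        proof (intro sum.cong refl)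
          fix b' assume b': "b' \<in> B"
          have "lookup \<mu> i < p" if "\<mu> \<in> keys (shift v (single b' 1))" for \<mu> i
            using keys_shift_monom[OF that, of i] digB[OF b', of i] by simp
          thus "lookup (shift v (single b' 1) * (\<Sum>\<alpha>\<in>K. single (scale_exp p \<alpha>) (g b' \<alpha> ^ p))) (c + scale_exp p \<alpha>)
              = lookup (shift v (single b' 1)) c * g b' \<alpha> ^ p"
            using lookup_mult_scaled[of "shift v (single b' 1)" p c K "\<lambda>\<alpha>. g b' \<alpha> ^ p" \<alpha>]
              True finK \<open>\<alpha> \<in> K\<close> by simp
        qed
        hence e: "lookup P (c + scale_exp p \<alpha>) = lookup (shift v Q) c" by (simp add: lQ)
        have "mdeg c = (\<Sum>i\<in>V. lookup c i)" using True V by (intro mdeg_eq_sum) auto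
        also have "\<dots> \<le> (\<Sum>i\<in>V. p - 1)" using True by (intro sum_mono) (metis Suc_diff_1 less_Suc_eq_le p0)
        finally have mc: "mdeg c \<le> card V * (p - 1)" by simp
        have h1: "p * mdeg \<alpha> + p \<le> p * t" using mult_le_mono2[of "mdeg \<alpha> + 1" t p] \<alpha> by simp
        have h2: "p * t + card V * p \<le> T + card V" using T(2) by (simp only: distrib_left mult.commute[of "card V" p])
        have h3: "card V * (p - 1) + card V = card V * p"
          using p0 by (metis Suc_diff_1 mult_Suc_right add.commute)
        have "mdeg c + p * mdeg \<alpha> < T" using h1 h2 h3 mc p0 by linarith
        hence "mdeg (c + scale_exp p \<alpha>) < T" by (simp add: mdeg_add)
        hence "lookup (shift v F) (c + scale_exp p \<alpha>) \<in> max_ideal A" using T(1) by (simp add: vanishes_mod_def[OF A])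
        thus ?thesis using cong_max_lookup[OF A FP] e by simp
      next
        case False
        have "lookup (shift v (single b' 1)) c = 0" if b': "b' \<in> B" for b'
        proof (rule ccontr)
          assume "lookup (shift v (single b' 1)) c \<noteq> 0"
          hence "c \<in> keys (shift v (single b' 1))" by (simp add: in_keys_iff)
          hence le: "lookup c i \<le> lookup b' i" for i by (rule keys_shift_monom)
          have "lookup c i < p" for i using le[of i] digB[OF b', of i] by simp
          moreover have "keys c \<subseteq> keys b'" using le by (auto simp: in_keys_iff) (metis le_zero_eq not_gr_zero)
          ultimately show False using False keysB[OF b'] by blast
        qed
        thus ?thesis using max_ideal_zero[OF A] by (simp add: lQ)
      qed
      hence "coeffs_in (max_ideal A) (shift v Q)" by (simp add: coeffs_in_def)
      hence "coeffs_in (max_ideal A) (shift (\<lambda>i. - v i) (shift v Q))"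
        using subring_of_uminus[OF As v] by (rule coeffs_in_max_shift[OF A, rotated])
      hence "lookup Q b \<in> max_ideal A" unfolding shift_shift_neg by (rule coeffs_inD)
      moreover have "lookup Q b = g b \<alpha> ^ p"
        unfolding Q_def lookup_sum lookup_single when_def using b finB by simp
      ultimately show ?thesis using max_ideal_power[OF A gA] by simp
    qed
    thus ?thesis by (simp add: vanishes_mod_def[OF A] g_def)
  qed
  obtain \<mu> where \<mu>: "lookup F \<mu> \<notin> max_ideal A" using F(4) by (auto simp: coeffs_in_def)
  have \<mu>F: "\<mu> \<in> keys F" using \<mu> max_ideal_zero[OF A] by (auto simp: in_keys_iff)
  define b where "b = mod_exp p \<mu>"
  have bB: "b \<in> B" and \<mu>b: "\<mu> \<in> fib b" using \<mu>F by (auto simp: B_def b_def fib_def)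
  have "rt (lookup F \<mu>) \<notin> max_ideal A"
  proof
    assume "rt (lookup F \<mu>) \<in> max_ideal A"
    hence "rt (lookup F \<mu>) * rt (lookup F \<mu>) ^ (p - 1) \<in> max_ideal A"
      by (intro max_ideal_mult(1)[OF A] subring_of_power[OF As] rtA FA)
    moreover have "rt (lookup F \<mu>) * rt (lookup F \<mu>) ^ (p - 1) = rt (lookup F \<mu>) ^ p"
      using p0 by (simp add: power_eq_if)
    ultimately show False using \<mu> rt by simp
  qed
  hence nG: "\<not> coeffs_in (max_ideal A) (G b)" using lG[OF \<mu>b] by (metis coeffs_inD)
  define d where "d = (D - mdeg b) div p"
  have deg: "p * mdeg (div_exp p \<nu>) + mdeg b = D" if "\<nu> \<in> fib b" for \<nu>
  proof -
    have "mdeg (scale_exp p (div_exp p \<nu>) + b) = D"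
      unfolding mdd[OF that] using that F(2) by (auto simp: fib_def homogeneous_iff)
    thus ?thesis by (simp add: mdeg_add)
  qed
  have hG: "homogeneous d (G b)"
    unfolding homogeneous_iff
  proof
    fix \<gamma> assume "\<gamma> \<in> keys (G b)"
    then obtain \<nu> where "\<nu> \<in> fib b" "\<gamma> = div_exp p \<nu>" using keysG by blast
    thus "mdeg \<gamma> = d" using deg[of \<nu>] p0 by (auto simp: d_def)
  qed
  have "p * d \<le> D - mdeg b" unfolding d_def by (rule times_div_less_eq_dividend)
  hence dD: "p * d \<le> D" by simp
  have vG: "vars_in V (G b)"
    unfolding vars_in_def
  proof
    fix \<gamma> assume "\<gamma> \<in> keys (G b)"
    then obtain \<nu> where \<nu>: "\<nu> \<in> fib b" "\<gamma> = div_exp p \<nu>" using keysG by blast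
    have "\<nu> \<in> keys F" using \<nu>(1) unfolding fib_def by simp
    hence "keys \<nu> \<subseteq> V" using F(1) unfolding vars_in_def by simp
    thus "keys \<gamma> \<subseteq> V" unfolding \<nu>(2) by (rule subset_trans[OF keys_div_exp])
  qed
  show ?thesis
  proof (intro exI[of _ "G b"] exI[of _ d] conjI allI impI vG hG dD GA nG)
    fix v T t assume "\<forall>i. v i \<in> A" "vanishes_mod A T v F" "p * (t + card V) \<le> T + card V"
    thus "vanishes_mod A t v (G b)" using van[of v T t b] bB by simp
  qed
qed

text \<open>Counting orders from \<open>- card V\<close> turns the loss in each step into a division by \<open>p\<close>, so
  that steps compose without accumulating an error.\<close>
lemma frobenius_descent_power:
  fixes F :: "('v, 'k::alg_closed_field) mpoly"
  assumes A: "valuation_ring A" and p: "prime p" "of_nat p \<in> max_ideal A" and V: "finite V"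
    and F: "vars_in V F" "homogeneous D F" "coeffs_in A F" "\<not> coeffs_in (max_ideal A) F"
  shows "\<exists>G d. vars_in V G \<and> homogeneous d G \<and> p ^ l * d \<le> D \<and> coeffs_in A G \<and>
    \<not> coeffs_in (max_ideal A) G \<and>
    (\<forall>v T t. (\<forall>i. v i \<in> A) \<longrightarrow> vanishes_mod A T v F \<longrightarrow> p ^ l * (t + card V) \<le> T + card V \<longrightarrow> vanishes_mod A t v G)"
proof (induction l)
  case 0
  have "vanishes_mod A t v F" if "vanishes_mod A T v F" "t \<le> T" for v T t
    using that by (auto simp: vanishes_mod_def[OF A])
  thus ?case using F by (intro exI[of _ F] exI[of _ D]) auto
next
  case (Suc l)
  then obtain G d where G: "vars_in V G" "homogeneous d G" "p ^ l * d \<le> D" "coeffs_in A G"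
    "\<not> coeffs_in (max_ideal A) G"
    and vG: "\<And>v T t. (\<forall>i. v i \<in> A) \<Longrightarrow> vanishes_mod A T v F \<Longrightarrow> p ^ l * (t + card V) \<le> T + card V \<Longrightarrow> vanishes_mod A t v G"
    by blast
  obtain H e where H: "vars_in V H" "homogeneous e H" "p * e \<le> d" "coeffs_in A H"
    "\<not> coeffs_in (max_ideal A) H"
    and vH: "\<And>v T t. (\<forall>i. v i \<in> A) \<Longrightarrow> vanishes_mod A T v G \<Longrightarrow> p * (t + card V) \<le> T + card V \<Longrightarrow> vanishes_mod A t v H"
    using frobenius_descent[OF A p V G(1,2,4,5)] by blast
  have p0: "p > 0" using p(1) prime_gt_0_nat by blast
  have "p ^ Suc l * e = p ^ l * (p * e)" by simp
  also have "\<dots> \<le> p ^ l * d" using H(3) by (rule mult_le_mono2)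
  also have "\<dots> \<le> D" by (rule G(3))
  finally have "p ^ Suc l * e \<le> D" .
  moreover have "vanishes_mod A t v H"
    if v: "\<forall>i. v i \<in> A" and T: "vanishes_mod A T v F" and t: "p ^ Suc l * (t + card V) \<le> T + card V" for v T t
  proof -
    define u where "u = p * (t + card V) - card V"
    have u: "u + card V = p * (t + card V)" 
    proof -
      have "card V \<le> 1 * (t + card V)" by simp
      also have "\<dots> \<le> p * (t + card V)" using p0 by (intro mult_le_mono1) simp
      finally have "card V \<le> p * (t + card V)" .
      thus ?thesis unfolding u_def by (rule le_add_diff_inverse2)
    qed
    have "vanishes_mod A u v G" using t by (intro vG[OF v T]) (simp add: u mult_ac)
    thus ?thesis using vH[OF v, of u t] u by simp
  qed
  ultimately show ?case using H by (intro exI[of _ H] exI[of _ e] conjI) blast+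
qed

section \<open>Linear algebra\<close>

lemma underdetermined_system:
  fixes M :: "'j \<Rightarrow> 'i \<Rightarrow> 'k::field"
  assumes "finite J" "finite I" "card J < card I"
  shows "\<exists>x. (\<exists>i\<in>I. x i \<noteq> 0) \<and> (\<forall>j\<in>J. (\<Sum>i\<in>I. M j i * x i) = 0)"
  using assms
proof (induction J arbitrary: I M rule: finite_induct)
  case empty
  then obtain i where "i \<in> I" by fastforce
  thus ?case by (intro exI[of _ "\<lambda>_. 1"]) auto
next
  case (insert j J)
  show ?case
  proof (cases "\<forall>i\<in>I. M j i = 0")
    case True
    obtain x where "\<exists>i\<in>I. x i \<noteq> 0" "\<forall>j\<in>J. (\<Sum>i\<in>I. M j i * x i) = 0"
      using insert.IH[of I M] insert.prems insert.hyps by auto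
    thus ?thesis using True by (intro exI[of _ x]) auto
  next
    case False
    then obtain i0 where i0: "i0 \<in> I" "M j i0 \<noteq> 0" by blast
    define M' where "M' l i = M l i - M l i0 * M j i / M j i0" for l i
    have "card J < card (I - {i0})" using insert i0 by simp
    then obtain y where y: "\<exists>i\<in>I - {i0}. y i \<noteq> 0" "\<forall>l\<in>J. (\<Sum>i\<in>I - {i0}. M' l i * y i) = 0"
      using insert.IH[of "I - {i0}" M'] insert.prems by auto
    define x where "x = y(i0 := - (\<Sum>i\<in>I - {i0}. M j i * y i) / M j i0)"
    have sp: "(\<Sum>i\<in>I. M l i * x i) = M l i0 * x i0 + (\<Sum>i\<in>I - {i0}. M l i * y i)" for l
    proof -
      have "(\<Sum>i\<in>I. M l i * x i) = M l i0 * x i0 + (\<Sum>i\<in>I - {i0}. M l i * x i)"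
        using insert.prems(1) i0(1) by (rule sum.remove)
      also have "(\<Sum>i\<in>I - {i0}. M l i * x i) = (\<Sum>i\<in>I - {i0}. M l i * y i)"
        by (rule sum.cong) (auto simp: x_def)
      finally show ?thesis .
    qed
    have "(\<Sum>i\<in>I. M l i * x i) = 0" if l: "l \<in> insert j J" for l
    proof (cases "l = j")
      case True
      have "x i0 = - (\<Sum>i\<in>I - {i0}. M j i * y i) / M j i0" by (simp add: x_def)
      thus ?thesis using i0(2) unfolding sp True by simp
    next
      case False
      have "(\<Sum>i\<in>I - {i0}. M' l i * y i) = (\<Sum>i\<in>I - {i0}. M l i * y i - M l i0 / M j i0 * (M j i * y i))"
        by (rule sum.cong) (auto simp: M'_def algebra_simps)
      also have "\<dots> = (\<Sum>i\<in>I - {i0}. M l i * y i) - M l i0 / M j i0 * (\<Sum>i\<in>I - {i0}. M j i * y i)"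
        by (simp add: sum_subtractf sum_distrib_left)
      finally have "(\<Sum>i\<in>I - {i0}. M l i * y i) = M l i0 / M j i0 * (\<Sum>i\<in>I - {i0}. M j i * y i)"
        using y(2) l False by simp
      moreover have "x i0 = - (\<Sum>i\<in>I - {i0}. M j i * y i) / M j i0" by (simp add: x_def)
      ultimately show ?thesis unfolding sp by simp
    qed
    moreover have "\<exists>i\<in>I. x i \<noteq> 0" using y(1) by (auto simp: x_def)
    ultimately show ?thesis by blast
  qed
qed

text \<open>Polynomial functions with integer coefficients. These make sense over every ring at
  once; at parameters from a subring they take values in that subring.\<close>
inductive int_poly_fun :: "'i set \<Rightarrow> (('i \<Rightarrow> 'k::comm_ring_1) \<Rightarrow> 'k) \<Rightarrow> bool" for I where
  one: "int_poly_fun I (\<lambda>_. 1)"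
| var: "i \<in> I \<Longrightarrow> int_poly_fun I (\<lambda>a. a i)"
| diff: "int_poly_fun I f \<Longrightarrow> int_poly_fun I g \<Longrightarrow> int_poly_fun I (\<lambda>a. f a - g a)"
| mult: "int_poly_fun I f \<Longrightarrow> int_poly_fun I g \<Longrightarrow> int_poly_fun I (\<lambda>a. f a * g a)"

lemma int_poly_fun_zero: "int_poly_fun I (\<lambda>_. 0)"
  using int_poly_fun.diff[OF int_poly_fun.one int_poly_fun.one, of I] by simp

lemma int_poly_fun_add:
  assumes "int_poly_fun I f" "int_poly_fun I g" shows "int_poly_fun I (\<lambda>a. f a + g a)"
  using int_poly_fun.diff[OF assms(1) int_poly_fun.diff[OF int_poly_fun_zero assms(2)]] by simp

lemma int_poly_fun_prod:
  "(\<And>i. i \<in> J \<Longrightarrow> int_poly_fun I (f i)) \<Longrightarrow> int_poly_fun I (\<lambda>a. \<Prod>i\<in>J. f i a)"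
  by (induction J rule: infinite_finite_induct) (auto intro: int_poly_fun.intros)

lemma int_poly_fun_in_subring:
  fixes f :: "('i \<Rightarrow> 'k::field) \<Rightarrow> 'k"
  assumes "int_poly_fun I f" "subring_of A" "\<And>i. i \<in> I \<Longrightarrow> a i \<in> A"
  shows "f a \<in> A"
  using assms(1)
  by induction (auto intro: subring_of_one subring_of_diff subring_of_mult assms)

text \<open>Fraction-free Gaussian elimination: \<open>\<Delta>\<close> is the product of the pivots chosen at \<open>a0\<close>.
  Only ring operations are used, so the elimination can be repeated modulo the maximal ideal
  wherever \<open>\<Delta>\<close> is a unit.\<close>
lemma independence_certificate:
  fixes f :: "'c \<Rightarrow> 'x \<Rightarrow> ('i \<Rightarrow> 'k::field) \<Rightarrow> 'k"
  assumes "finite C" "\<And>c x. c \<in> C \<Longrightarrow> x \<in> X \<Longrightarrow> int_poly_fun I (f c x)"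
    "\<And>w. (\<And>x. x \<in> X \<Longrightarrow> (\<Sum>c\<in>C. w c * f c x a0) = 0) \<Longrightarrow> (\<forall>c\<in>C. w c = 0)"
  shows "\<exists>\<Delta>. int_poly_fun I \<Delta> \<and> \<Delta> a0 \<noteq> 0 \<and>
    (\<forall>A a w. valuation_ring A \<longrightarrow> (\<forall>i\<in>I. a i \<in> A) \<longrightarrow> \<Delta> a \<notin> max_ideal A \<longrightarrow>
      (\<forall>c\<in>C. w c \<in> A) \<longrightarrow> (\<forall>x\<in>X. (\<Sum>c\<in>C. w c * f c x a) \<in> max_ideal A) \<longrightarrow>
      (\<forall>c\<in>C. w c \<in> max_ideal A))"
  using assms
proof (induction C arbitrary: f rule: finite_induct)
  case empty
  show ?case by (intro exI[of _ "\<lambda>_. 1"]) (auto intro: int_poly_fun.one)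
next
  case (insert c0 C)
  have "\<exists>x0\<in>X. f c0 x0 a0 \<noteq> 0"
  proof (rule ccontr)
    assume n: "\<not> ?thesis"
    define w :: "'c \<Rightarrow> 'k" where "w c = (if c = c0 then 1 else 0)" for c
    have "(\<Sum>c\<in>insert c0 C. w c * f c x a0) = 0" if "x \<in> X" for x
      using n that by (intro sum.neutral) (auto simp: w_def)
    hence "\<forall>c\<in>insert c0 C. w c = 0" by (rule insert.prems(2))
    thus False by (simp add: w_def)
  qed
  then obtain x0 where x0: "x0 \<in> X" "f c0 x0 a0 \<noteq> 0" by blast
  define g where "g c x a = f c0 x0 a * f c x a - f c x0 a * f c0 x a" for c x a
  have ig: "int_poly_fun I (g c x)" if "c \<in> C" "x \<in> X" for c x
    unfolding g_def[abs_def] using that x0 insert.prems(1) by (intro int_poly_fun.diff int_poly_fun.mult) auto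
  have key: "(\<Sum>c\<in>C. w c * g c x a) = f c0 x0 a * (\<Sum>c\<in>insert c0 C. w c * f c x a)
      - f c0 x a * (\<Sum>c\<in>insert c0 C. w c * f c x0 a)" for w x a
  proof -
    have "(\<Sum>c\<in>C. w c * g c x a) = f c0 x0 a * (\<Sum>c\<in>C. w c * f c x a) - f c0 x a * (\<Sum>c\<in>C. w c * f c x0 a)"
      unfolding g_def sum_distrib_left sum_subtractf[symmetric] by (rule sum.cong) (auto simp: algebra_simps)
    thus ?thesis using insert.hyps by (simp add: algebra_simps)
  qed
  have indg: "\<forall>c\<in>C. w c = 0" if w: "\<And>x. x \<in> X \<Longrightarrow> (\<Sum>c\<in>C. w c * g c x a0) = 0" for w
  proof -
    define w' where "w' c = (if c = c0 then - (\<Sum>c\<in>C. w c * f c x0 a0) / f c0 x0 a0 else w c)" for c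
    have eq: "(\<Sum>c\<in>C. w' c * h c) = (\<Sum>c\<in>C. w c * h c)" for h :: "'c \<Rightarrow> 'k"
      using insert.hyps by (intro sum.cong) (auto simp: w'_def)
    have z: "(\<Sum>c\<in>insert c0 C. w' c * f c x0 a0) = 0"
      using insert.hyps x0(2) by (simp add: eq) (simp add: w'_def)
    have "(\<Sum>c\<in>insert c0 C. w' c * f c x a0) = 0" if "x \<in> X" for x
      using key[of w' x a0] w[OF that] x0(2) by (simp only: eq z) simp
    hence "\<forall>c\<in>insert c0 C. w' c = 0" by (rule insert.prems(2))
    thus ?thesis using insert.hyps by (auto simp: w'_def split: if_splits)
  qed
  obtain D where D: "int_poly_fun I D" "D a0 \<noteq> 0" and DA: "\<And>A a w. valuation_ring A \<Longrightarrow> \<forall>i\<in>I. a i \<in> A \<Longrightarrow>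
      D a \<notin> max_ideal A \<Longrightarrow> \<forall>c\<in>C. w c \<in> A \<Longrightarrow> \<forall>x\<in>X. (\<Sum>c\<in>C. w c * g c x a) \<in> max_ideal A \<Longrightarrow>
      \<forall>c\<in>C. w c \<in> max_ideal A"
    using insert.IH[of g, OF ig indg] by blast
  define \<Delta> where "\<Delta> a = D a * f c0 x0 a" for a
  show ?case
  proof (intro exI[of _ \<Delta>] conjI allI impI)
    have i0: "int_poly_fun I (f c0 x0)" using insert.prems(1) x0 by auto
    show "int_poly_fun I \<Delta>" unfolding \<Delta>_def[abs_def] by (rule int_poly_fun.mult[OF D(1) i0])
    show "\<Delta> a0 \<noteq> 0" using D x0 by (simp add: \<Delta>_def)
    fix A a w
    assume A: "valuation_ring A" and a: "\<forall>i\<in>I. a i \<in> A" and d: "\<Delta> a \<notin> max_ideal A"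
      and w: "\<forall>c\<in>insert c0 C. w c \<in> A" and s: "\<forall>x\<in>X. (\<Sum>c\<in>insert c0 C. w c * f c x a) \<in> max_ideal A"
    have As: "subring_of A" by (rule valuation_ring_subring[OF A])
    have fA: "f c x a \<in> A" if "c \<in> insert c0 C" "x \<in> X" for c x
      using int_poly_fun_in_subring[OF insert.prems(1)[OF that] As] a by blast
    have DA': "D a \<in> A" using int_poly_fun_in_subring[OF D(1) As] a by blast
    have f0: "f c0 x0 a \<in> A" using fA x0 by simp
    have d1: "D a \<notin> max_ideal A" "f c0 x0 a \<notin> max_ideal A"
      using d max_ideal_mult[OF A _ f0, of "D a"] max_ideal_mult[OF A _ DA', of "f c0 x0 a"]
      unfolding \<Delta>_def by blast+
    have "(\<Sum>c\<in>C. w c * g c x a) \<in> max_ideal A" if x: "x \<in> X" for x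
      unfolding key using s x x0 fA[of c0 x] f0
      by (intro max_ideal_diff[OF A] max_ideal_mult(2)[OF A]) auto
    hence wc: "\<forall>c\<in>C. w c \<in> max_ideal A" using DA[OF A a d1(1)] w by simp
    have "(\<Sum>c\<in>C. w c * f c x0 a) \<in> max_ideal A"
      using wc fA x0 by (intro max_ideal_sum[OF A] max_ideal_mult(1)[OF A]) auto
    moreover have "(\<Sum>c\<in>insert c0 C. w c * f c x0 a) \<in> max_ideal A" using s x0 by blast
    ultimately have "(\<Sum>c\<in>insert c0 C. w c * f c x0 a) - (\<Sum>c\<in>C. w c * f c x0 a) \<in> max_ideal A"
      by (intro max_ideal_diff[OF A])
    hence "w c0 * f c0 x0 a \<in> max_ideal A" using insert.hyps by simp
    hence "w c0 \<in> max_ideal A" using max_ideal_prime[OF A _ f0, of "w c0"] w d1 by auto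
    thus "\<forall>c\<in>insert c0 C. w c \<in> max_ideal A" using wc by simp
  qed
qed

section \<open>Numerical estimates\<close>

text \<open>The number of words of length \<open>N\<close> over \<open>k + 1\<close> letters in which a distinguished letter
  occurs at most \<open>r\<close> times.\<close>
definition few_tops_count :: "nat \<Rightarrow> nat \<Rightarrow> nat \<Rightarrow> nat" where
  "few_tops_count k N r = (\<Sum>i\<le>r. (N choose i) * k ^ (N - i))"

text \<open>The bound for the configuration of these words: \<open>k\<close> for \<open>r = 0\<close>, the grid on \<open>k\<close>
  letters, and \<open>k + 1\<close> for \<open>r = N\<close>, the grid on \<open>k + 1\<close> letters.\<close>
definition alpha_bound :: "nat \<Rightarrow> nat \<Rightarrow> nat \<Rightarrow> real" where
  "alpha_bound k N r = (if r \<ge> N then real k + 1 else real k + real k * real r / (real N + (real k - 1) * real r))"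

lemma choose_eq_prod: "real (n choose N) = (\<Prod>j<N. real n - real j) / fact N"
  by (simp add: binomial_gbinomial gbinomial_prod_rev atLeast0LessThan)

lemma prod_strict_mono_one:
  fixes f g :: "nat \<Rightarrow> real"
  assumes "\<And>j. j < N \<Longrightarrow> 0 < g j" "\<And>j. j < N \<Longrightarrow> g j \<le> f j" "g 0 < f 0" "N > 0"
  shows "(\<Prod>j<N. g j) < (\<Prod>j<N. f j)"
proof -
  obtain n where n: "N = Suc n" using assms(4) by (cases N) auto
  have "(\<Prod>j<n. g (Suc j)) \<le> (\<Prod>j<n. f (Suc j))" "(\<Prod>j<n. g (Suc j)) > 0"
    using assms n by (auto intro!: prod_mono prod_pos simp: less_imp_le)
  hence "g 0 * (\<Prod>j<n. g (Suc j)) < f 0 * (\<Prod>j<n. f (Suc j))"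
    using assms by (intro mult_less_le_imp_less) (auto simp: n less_imp_le)
  thus ?thesis unfolding n prod.lessThan_Suc_shift .
qed

lemma prod_paired: "(\<Prod>j<N. h j) ^ 2 = (\<Prod>j<N. h j * h (N - 1 - j))" for h :: "nat \<Rightarrow> real"
proof -
  have "(\<Prod>j<N. h (N - 1 - j)) = (\<Prod>j<N. h j)"
    using prod.nat_diff_reindex[of h N] by simp
  thus ?thesis by (simp add: prod.distrib power2_eq_square)
qed

text \<open>Pairing the factors \<open>j\<close> and \<open>N - 1 - j\<close> reduces the comparison of two binomial
  coefficients to the comparison of the centres of the two products; it is strict because the
  extreme pair is strictly better than the centre.\<close>
lemma choose_ratio_bound:
  fixes c \<sigma> :: real
  assumes N: "N \<ge> 2" and M: "M \<ge> N" and \<sigma>: "\<sigma> > 1" and c: "c \<ge> 1"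
    and key: "c * real M - (real N - 1) / 2 \<ge> \<sigma> * (real M - (real N - 1) / 2)"
    and e: "real e \<ge> c * real M"
  shows "real (e choose N) > \<sigma> ^ N * real (M choose N)"
proof -
  define x where "x = c * real M"
  define P where "P y = (\<Prod>j<N. y - real j)" for y
  have xM: "x \<ge> real M" unfolding x_def using c mult_right_mono[of 1 c "real M"] by simp
  have Ppos: "P (real M) > 0" unfolding P_def using M by (intro prod_pos) auto
  have Px: "P x > 0" unfolding P_def using M xM by (intro prod_pos) auto
  have Pe: "P (real e) \<ge> P x" unfolding P_def
  proof (rule prod_mono)
    fix j assume "j \<in> {..<N}"
    hence "real j \<le> x" using xM M by simp
    thus "0 \<le> x - real j \<and> x - real j \<le> real e - real j" using e by (simp add: x_def)
  qed
  define y where "y j = ((real N - 1) / 2 - real j) ^ 2" for j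
  define A where "A = x - (real N - 1) / 2"
  define B where "B = real M - (real N - 1) / 2"
  have B0: "B > 0" unfolding B_def using M N by (simp add: field_simps)
  have AB: "A \<ge> \<sigma> * B" using key by (simp add: A_def B_def x_def)
  have A2: "A ^ 2 \<ge> \<sigma> ^ 2 * B ^ 2"
    using power_mono[OF AB, of 2] B0 \<sigma> by (simp add: power_mult_distrib)
  have s2: "\<sigma> ^ 2 > 1" using \<sigma> by (simp add: one_less_power)
  have fx: "(z - real j) * (z - real (N - 1 - j)) = (z - (real N - 1) / 2) ^ 2 - y j" if "j < N" for z j
  proof -
    have "real (N - 1 - j) = real N - 1 - real j" using that by (simp add: of_nat_diff)
    thus ?thesis unfolding y_def by (simp add: power2_eq_square field_simps)
  qed
  have "(\<sigma> ^ N * P (real M)) ^ 2 = (\<Prod>j<N. \<sigma> ^ 2) * (\<Prod>j<N. real M - real j) ^ 2"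
    by (simp add: P_def power_mult_distrib flip: power_mult) (simp add: mult.commute power_mult)
  also have "\<dots> = (\<Prod>j<N. \<sigma> ^ 2 * ((real M - real j) * (real M - real (N - 1 - j))))"
    unfolding prod_paired by (rule prod.distrib[symmetric])
  also have "\<dots> < (\<Prod>j<N. (x - real j) * (x - real (N - 1 - j)))"
  proof (rule prod_strict_mono_one)
    fix j assume j: "j < N"
    show "0 < \<sigma> ^ 2 * ((real M - real j) * (real M - real (N - 1 - j)))"
      using j M s2 by (intro mult_pos_pos) auto
    have "y j \<ge> 0" by (simp add: y_def)
    hence "\<sigma> ^ 2 * y j \<ge> 1 * y j" using s2 by (intro mult_right_mono) auto
    thus "\<sigma> ^ 2 * ((real M - real j) * (real M - real (N - 1 - j))) \<le> (x - real j) * (x - real (N - 1 - j))"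
      unfolding fx[OF j] using A2 by (simp add: A_def B_def algebra_simps)
  next
    have j: "0 < N" using N by simp
    have "y 0 > 0" unfolding y_def using N by simp
    hence "\<sigma> ^ 2 * y 0 > 1 * y 0" using s2 by (intro mult_strict_right_mono) auto
    thus "\<sigma> ^ 2 * ((real M - real 0) * (real M - real (N - 1 - 0))) < (x - real 0) * (x - real (N - 1 - 0))"
      unfolding fx[OF j] using A2 by (simp add: A_def B_def algebra_simps)
  qed (use N in auto)
  also have "\<dots> = (P x) ^ 2" unfolding P_def prod_paired ..
  finally have "\<sigma> ^ N * P (real M) < P x" by (rule power_less_imp_less_base) (use Px in simp)
  hence "\<sigma> ^ N * P (real M) < P (real e)" using Pe by linarith
  thus ?thesis unfolding choose_eq_prod P_def[symmetric] by (simp add: divide_strict_right_mono)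
qed

lemma few_tops_count_0: "few_tops_count k N 0 = k ^ N"
  by (simp add: few_tops_count_def)

text \<open>Exponential weights: \<open>l\<^sup>r \<le> l\<^sup>i\<close> for \<open>i \<le> r\<close>, followed by the binomial theorem.\<close>
lemma few_tops_count_chernoff:
  fixes l :: real
  assumes "r \<le> N" "0 < l" "l \<le> 1"
  shows "real (few_tops_count 2 N r) * l ^ r \<le> (2 + l) ^ N"
proof -
  have "real (few_tops_count 2 N r) * l ^ r = (\<Sum>i\<le>r. real (N choose i) * 2 ^ (N - i) * l ^ r)"
    by (simp add: few_tops_count_def sum_distrib_right)
  also have "\<dots> \<le> (\<Sum>i\<le>r. real (N choose i) * 2 ^ (N - i) * l ^ i)"
    using assms by (intro sum_mono mult_left_mono power_decreasing) auto
  also have "\<dots> \<le> (\<Sum>i\<le>N. real (N choose i) * 2 ^ (N - i) * l ^ i)"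
    using assms by (intro sum_mono2) auto
  also have "\<dots> = (l + 2) ^ N" unfolding binomial_ring by (intro sum.cong) auto
  finally show ?thesis by (simp add: add.commute)
qed

lemma few_tops_count_1: "N \<ge> 1 \<Longrightarrow> few_tops_count 2 N 1 = 2 ^ N + N * 2 ^ (N - 1)"
  by (simp add: few_tops_count_def)

lemma few_tops_count_2: "N \<ge> 2 \<Longrightarrow> few_tops_count 2 N 2 = 2 ^ N + N * 2 ^ (N - 1) + (N choose 2) * 2 ^ (N - 2)"
  by (simp add: few_tops_count_def numeral_2_eq_2)

text \<open>The case \<open>\<epsilon> > 0.618\<close>, where \<open>s > 2.618\<^sup>N\<close>. About \<open>N / 19\<close> top letters suffice to raise
  the bound to \<open>2.1\<close>, and the weight \<open>l = 1/5\<close> shows that they fit. Small \<open>N\<close> are treated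
  separately because of the rounding of \<open>N / 19\<close>.\<close>
lemma few_tops_count_golden:
  assumes N: "N \<ge> 5"
  shows "real (few_tops_count 2 N ((N + 18) div 19)) \<le> (1309 / 500) ^ N"
proof (cases "N \<le> 17")
  case True
  hence "N = 5 \<or> N = 6 \<or> N = 7 \<or> N = 8 \<or> N = 9 \<or> N = 10 \<or> N = 11 \<or> N = 12 \<or> N = 13 \<or> N = 14 \<or> N = 15 \<or> N = 16 \<or> N = 17"
    using N by arith
  moreover have "(N + 18) div 19 = 1" using True N by auto
  ultimately show ?thesis by (elim disjE) (simp_all add: few_tops_count_1[simplified] power_divide)
next
  case False
  define r where "r = (N + 18) div 19"
  have r: "19 * r \<le> N + 18" "r \<le> N" using False by (auto simp: r_def)
  have "(5::real) ^ (19 * r) \<le> 5 ^ (N + 18)" using r by (intro power_increasing) auto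
  also have "\<dots> \<le> 5 ^ N * 5 ^ N"
    unfolding power_add using False by (intro mult_left_mono power_increasing) auto
  also have "\<dots> = 25 ^ N" by (simp flip: power_mult_distrib)
  also have "\<dots> \<le> ((119/100) ^ 19) ^ N" by (intro power_mono) (auto simp: power_divide)
  finally have "((5::real) ^ r) ^ 19 \<le> ((119/100) ^ N) ^ 19" by (simp add: mult.commute flip: power_mult)
  hence *: "(5::real) ^ r \<le> (119/100) ^ N" by (rule power_le_imp_le_base[of _ 18, simplified]) simp
  have "real (few_tops_count 2 N r) * (1/5) ^ r \<le> (2 + 1/5) ^ N" using r by (intro few_tops_count_chernoff) auto
  hence "real (few_tops_count 2 N r) \<le> (11/5) ^ N * 5 ^ r" by (simp add: power_divide field_simps)
  also have "\<dots> \<le> (11/5) ^ N * (119/100) ^ N" using * by (intro mult_left_mono) auto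
  also have "\<dots> = (1309/500) ^ N" by (simp flip: power_mult_distrib)
  finally show ?thesis by (simp add: r_def)
qed

text \<open>The case \<open>\<epsilon> > 0.8\<close>, where \<open>s > 2.8\<^sup>N\<close>: about \<open>N / 9\<close> top letters raise the bound to
  \<open>2.2\<close>.\<close>
lemma few_tops_count_large:
  assumes N: "N \<ge> 5"
  shows "real (few_tops_count 2 N ((N + 8) div 9)) \<le> (14 / 5) ^ N"
proof (cases "N \<le> 15")
  case True
  hence "N = 5 \<or> N = 6 \<or> N = 7 \<or> N = 8 \<or> N = 9 \<or> (N = 10 \<or> N = 11 \<or> N = 12 \<or> N = 13 \<or> N = 14 \<or> N = 15)"
    using N by arith
  moreover have "(N + 8) div 9 = 1" if "N \<le> 9" using that N by auto
  moreover have "(N + 8) div 9 = 2" if "N \<ge> 10" using that True by auto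
  ultimately show ?thesis
    by (elim disjE) (simp_all add: few_tops_count_1[simplified] few_tops_count_2 power_divide choose_two)
next
  case False
  define r where "r = (N + 8) div 9"
  have r: "9 * r \<le> N + 8" "r \<le> N" using False by (auto simp: r_def)
  have "(5/2::real) ^ 8 \<le> (8/5) ^ 16" by (simp add: power_divide)
  also have "\<dots> \<le> (8/5) ^ N" using False by (intro power_increasing) auto
  finally have 16: "(5/2::real) ^ 8 \<le> (8/5) ^ N" .
  have "(5/2::real) ^ (9 * r) \<le> (5/2) ^ (N + 8)" using r by (intro power_increasing) auto
  also have "\<dots> \<le> (5/2) ^ N * (8/5) ^ N" unfolding power_add using 16 by (intro mult_left_mono) auto
  also have "\<dots> = 4 ^ N" by (simp flip: power_mult_distrib)
  also have "\<dots> \<le> ((7/6) ^ 9) ^ N" by (intro power_mono) (auto simp: power_divide)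
  finally have "((5/2::real) ^ r) ^ 9 \<le> ((7/6) ^ N) ^ 9" by (simp add: mult.commute flip: power_mult)
  hence *: "(5/2::real) ^ r \<le> (7/6) ^ N" by (rule power_le_imp_le_base[of _ 8, simplified]) simp
  have "real (few_tops_count 2 N r) * (2/5) ^ r \<le> (2 + 2/5) ^ N" using r by (intro few_tops_count_chernoff) auto
  hence "real (few_tops_count 2 N r) \<le> (12/5) ^ N * (5/2) ^ r" by (simp add: power_divide field_simps)
  also have "\<dots> \<le> (12/5) ^ N * (7/6) ^ N" using * by (intro mult_left_mono) auto
  also have "\<dots> = (14/5) ^ N" by (simp flip: power_mult_distrib)
  finally show ?thesis by (simp add: r_def)
qed

lemma alpha_bound_0: "N \<ge> 1 \<Longrightarrow> alpha_bound k N 0 = real k"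
  by (simp add: alpha_bound_def)

lemma alpha_bound_2_ge:
  assumes "r \<le> N" "N \<ge> 1" "2 * real r \<ge> g * (real N + real r)"
  shows "alpha_bound 2 N r \<ge> 2 + g"
proof -
  have "alpha_bound 2 N r = 2 + 2 * real r / (real N + real r)"
    using assms(1,2) by (cases "r = N") (auto simp: alpha_bound_def)
  moreover have "2 * real r / (real N + real r) \<ge> g" using assms by (simp add: field_simps)
  ultimately show ?thesis by simp
qed

text \<open>With \<open>c = alpha_bound \<kappa> N r\<close>, \<open>M = m + N - 1\<close> and \<open>d + N\<close> the least integer above \<open>c M\<close>,
  the last inequality is automatic and the dimension count follows from \<open>choose_ratio_bound\<close>.
  Its hypothesis \<open>\<sigma> (2 m + N - 1) \<le> 2 c M - (N - 1)\<close>, where \<open>\<sigma> = k + \<epsilon>\<close>, holds for the plain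
  grid, \<open>c = k\<close>, if \<open>\<epsilon> (2 m + N - 1) \<le> (k - 1) (N - 1)\<close>. The assumption on \<open>s\<close> reads
  \<open>(1 + \<epsilon>) 2 m \<le> (k - 1) (N - 1)\<close>; it implies the former unless \<open>k = 2\<close> and \<open>\<epsilon>\<^sup>2 + \<epsilon> > 1\<close>.\<close>
lemma configuration_exists:
  fixes N m s :: nat and k :: int and \<epsilon> :: real
  assumes N: "N \<ge> 3" and m: "m \<ge> 1" and s: "s \<ge> 1"
    and root: "root N (real s) = of_int k + \<epsilon>" and e: "0 \<le> \<epsilon>" "\<epsilon> < 1"
    and hyp: "real s \<ge> ((1 + \<epsilon>) * (2 * real m) / (real N - 1) + 1 + \<epsilon>) ^ N"
  shows "\<exists>\<kappa> r d. \<kappa> \<ge> 1 \<and> few_tops_count \<kappa> N r \<le> s \<and>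
    s * (m + N - 1 choose N) < (d + N choose N) \<and>
    real d + real N - 1 < alpha_bound \<kappa> N r * (real m + real N - 1)"
proof -
  define \<sigma> where "\<sigma> = of_int k + \<epsilon>"
  define n where "n = real N - 1"
  define M where "M = m + N - 1"
  define X where "X = 2 * real m"
  have n2: "n \<ge> 2" using N by (simp add: n_def)
  have X2: "X \<ge> 2" using m by (simp add: X_def)
  have sN: "\<sigma> ^ N = real s" unfolding \<sigma>_def root[symmetric] using N by (simp add: real_root_pow_pos2)
  have M: "real M = real m + n" "M \<ge> N" using N m by (auto simp: M_def n_def of_nat_diff)
  have s0: "\<sigma> \<ge> 0" unfolding \<sigma>_def root[symmetric] by (rule real_root_ge_zero) simp
  have "((1 + \<epsilon>) * X / n + 1 + \<epsilon>) ^ N \<le> \<sigma> ^ N" using hyp by (simp add: sN X_def n_def)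
  hence "(1 + \<epsilon>) * X / n + 1 + \<epsilon> \<le> \<sigma>" by (rule power_mono_iff[THEN iffD1, rotated 3]) (use N e n2 X2 s0 in auto)
  hence "(1 + \<epsilon>) * X / n \<le> of_int k - 1" by (simp add: \<sigma>_def)
  hence h: "(1 + \<epsilon>) * X \<le> (of_int k - 1) * n" using n2 by (simp add: field_simps)
  have "(1 + \<epsilon>) * X > 0" using e X2 by (intro mult_pos_pos) auto
  hence "(of_int k - 1) * n > 0" using h by linarith
  hence "real_of_int k - 1 > 0" using n2 by (simp add: zero_less_mult_iff)
  hence k2: "k \<ge> 2" by simp
  have \<sigma>1: "\<sigma> > 1" using k2 e by (simp add: \<sigma>_def)
  have finish: ?thesis
    if \<kappa>: "\<kappa> \<ge> 1" and cnt: "real (few_tops_count \<kappa> N r) \<le> \<sigma> ^ N" and c: "alpha_bound \<kappa> N r \<ge> c" "c \<ge> 1"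
      and key: "c * (2 * real m + 2 * n) - n \<ge> \<sigma> * (2 * real m + n)" for \<kappa> r c
  proof -
    define c' where "c' = alpha_bound \<kappa> N r"
    have c': "c' \<ge> 1" using c by (simp add: c'_def)
    \<comment> \<open>\<open>e'\<close> is \<open>d + N\<close>\<close>
    define e' where "e' = nat \<lceil>c' * real M\<rceil>"
    have cM: "c' * real M \<ge> real M" using c' mult_right_mono[of 1 c' "real M"] by simp
    have e1: "real e' \<ge> c' * real M" "real e' < c' * real M + 1" unfolding e'_def using cM by linarith+
    have eN: "e' \<ge> N" using e1(1) cM M(2) by linarith
    have "c * (2 * real m + 2 * n) \<le> c' * (2 * real m + 2 * n)"
      using c n2 unfolding c'_def by (intro mult_right_mono) auto
    hence "c' * real M - (real N - 1) / 2 \<ge> \<sigma> * (real M - (real N - 1) / 2)"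
      using key unfolding M(1) n_def[symmetric] by (simp add: field_simps)
    hence "real (e' choose N) > \<sigma> ^ N * real (M choose N)"
      using N M(2) \<sigma>1 c' e1(1) by (intro choose_ratio_bound) auto
    hence "real (e' choose N) > real (s * (M choose N))" by (simp add: sN)
    hence 1: "s * (M choose N) < (e' choose N)" by (simp only: of_nat_less_iff)
    show ?thesis
    proof (rule exI[of _ \<kappa>], rule exI[of _ r], rule exI[of _ "e' - N"], intro conjI \<kappa>)
      show "few_tops_count \<kappa> N r \<le> s" using cnt unfolding sN by simp
      show "s * (m + N - 1 choose N) < (e' - N + N choose N)" using 1 eN by (simp add: M_def)
      show "real (e' - N) + real N - 1 < alpha_bound \<kappa> N r * (real m + real N - 1)"
        using e1(2) eN M(1) by (simp add: c'_def n_def of_nat_diff algebra_simps)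
    qed
  qed
  show ?thesis
  proof (cases "\<epsilon> * (X + n) \<le> (of_int k - 1) * n")
    case True
    have kk: "real (nat k) = of_int k" using k2 by simp
    show ?thesis
    proof (rule finish[of "nat k" 0 "of_int k"])
      show "real (few_tops_count (nat k) N 0) \<le> \<sigma> ^ N"
        using k2 e by (simp add: few_tops_count_0 kk \<sigma>_def power_mono)
      show "alpha_bound (nat k) N 0 \<ge> of_int k" using N by (simp add: alpha_bound_0 kk)
      show "\<sigma> * (2 * real m + n) \<le> of_int k * (2 * real m + 2 * n) - n"
        using True unfolding \<sigma>_def X_def by (simp add: algebra_simps)
    qed (use k2 in auto)
  next
    case False
    have eX: "\<epsilon> * X \<le> X" using e X2 mult_right_mono[of \<epsilon> 1 X] by simp
    have en: "\<epsilon> * n \<le> n" using e n2 mult_right_mono[of \<epsilon> 1 n] by simp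
    have "k < 3"
    proof (rule ccontr)
      assume "\<not> k < 3"
      hence k3: "(of_int k - 1) * n \<ge> 2 * n" using n2 by (intro mult_right_mono) auto
      have "2 * (\<epsilon> * X) \<le> (1 + \<epsilon>) * X" using eX by (simp add: algebra_simps)
      hence "2 * (\<epsilon> * X) \<le> (of_int k - 1) * n" using h by linarith
      hence "\<epsilon> * X + \<epsilon> * n \<le> (of_int k - 1) * n" using en k3 by linarith
      thus False using False by (simp add: algebra_simps)
    qed
    hence k: "k = 2" using k2 by simp
    have h': "X + \<epsilon> * X \<le> n" using h by (simp add: k algebra_simps)
    have w: "\<epsilon> * X + \<epsilon> * n > n" using False by (simp add: k algebra_simps)
    have golden: "\<epsilon> > 618 / 1000"
    proof (rule ccontr)
      assume "\<not> ?thesis"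
      hence l: "\<epsilon> \<le> 618/1000" by simp
      have "\<epsilon> * X + \<epsilon> * n \<le> 618/1000 * X + 618/1000 * n"
        using l X2 n2 by (intro add_mono mult_right_mono) auto
      hence "382 * n < 618 * X" using w by linarith
      have "(1 + \<epsilon>) * (n - \<epsilon> * n) < (1 + \<epsilon>) * (\<epsilon> * X)"
        using w e by (intro mult_strict_left_mono) auto
      also have "\<dots> = \<epsilon> * (X + \<epsilon> * X)" by (simp add: algebra_simps)
      also have "\<dots> \<le> \<epsilon> * n" using h' e by (intro mult_left_mono) auto
      finally have "n * (1 - \<epsilon> * \<epsilon> - \<epsilon>) < 0" by (simp add: algebra_simps)
      hence "1 < \<epsilon> * \<epsilon> + \<epsilon>" using n2 by (simp add: mult_less_0_iff)
      moreover have "\<epsilon> * \<epsilon> \<le> 618/1000 * (618/1000)" using l e by (intro mult_mono) auto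
      ultimately show False using l by simp
    qed
    have "618/1000 * X \<le> \<epsilon> * X" using golden X2 by (intro mult_right_mono) auto
    hence "n > 3" using h' X2 by linarith
    hence N5: "N \<ge> 5" unfolding n_def by linarith
    show ?thesis
    proof (cases "\<epsilon> \<le> 4/5")
      case True
      define r where "r = (N + 18) div 19"
      have r: "19 * r \<ge> N" "r \<le> N" using N5 by (auto simp: r_def)
      have rr: "19 * real r \<ge> real N" using r(1) by linarith
      show ?thesis
      proof (rule finish[of 2 r "2 + 1/10"])
        have "(1309/500) ^ N \<le> \<sigma> ^ N" using golden by (intro power_mono) (auto simp: \<sigma>_def k)
        thus "real (few_tops_count 2 N r) \<le> \<sigma> ^ N" using few_tops_count_golden[OF N5] unfolding r_def by linarith
        show "alpha_bound 2 N r \<ge> 2 + 1/10" using rr r N by (intro alpha_bound_2_ge) auto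
        define p q where "p = \<epsilon> * X" and "q = \<epsilon> * n"
        have "p \<le> 4/5 * X" "q \<le> 4/5 * n" "X + p \<le> n"
          unfolding p_def q_def using True X2 n2 h' by (auto intro: mult_right_mono)
        hence "6 * p \<le> 24/5 * X" "4 * p \<le> 4 * n - 4 * X" "10 * q \<le> 8 * n" by linarith+
        moreover from this(1,2) have "10 * p \<le> 4 * n + X" using X2 by linarith
        ultimately have "10 * p + 10 * q \<le> 12 * n + X" by linarith
        hence "n + 1/10 * (X + 2 * n) \<ge> p + q" by (simp add: field_simps)
        hence "n + 1/10 * (X + 2 * n) \<ge> \<epsilon> * X + \<epsilon> * n" unfolding p_def q_def .
        thus "\<sigma> * (2 * real m + n) \<le> (2 + 1/10) * (2 * real m + 2 * n) - n"
          by (simp add: \<sigma>_def k X_def algebra_simps)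
      qed (use r in auto)
    next
      case False
      define r where "r = (N + 8) div 9"
      have r: "9 * r \<ge> N" "r \<le> N" using N5 by (auto simp: r_def)
      have rr: "9 * real r \<ge> real N" using r(1) by linarith
      show ?thesis
      proof (rule finish[of 2 r "2 + 1/5"])
        have "(14/5) ^ N \<le> \<sigma> ^ N" using False by (intro power_mono) (auto simp: \<sigma>_def k)
        thus "real (few_tops_count 2 N r) \<le> \<sigma> ^ N" using few_tops_count_large[OF N5] unfolding r_def by linarith
        show "alpha_bound 2 N r \<ge> 2 + 1/5" using rr r N by (intro alpha_bound_2_ge) auto
        define p q where "p = \<epsilon> * X" and "q = \<epsilon> * n"
        have "4 * p \<le> 4 * n - 4 * X" "6 * p \<le> 6 * X" and q: "10 * q \<le> 10 * n"
          using h' eX en unfolding p_def q_def by linarith+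
        hence "10 * p \<le> 4 * n + 2 * X" by linarith
        hence "10 * p + 10 * q \<le> 14 * n + 2 * X" using q by linarith
        hence "n + 1/5 * (X + 2 * n) \<ge> p + q" by (simp add: field_simps)
        hence "n + 1/5 * (X + 2 * n) \<ge> \<epsilon> * X + \<epsilon> * n" unfolding p_def q_def .
        thus "\<sigma> * (2 * real m + n) \<le> (2 + 1/5) * (2 * real m + 2 * n) - n"
          by (simp add: \<sigma>_def k X_def algebra_simps)
      qed (use r in auto)
    qed
  qed
qed

section \<open>Symbolic powers of ideals of points\<close>

definition ring_on :: "'a set \<Rightarrow> 'a::comm_ring_1 ring" where
  "ring_on S = \<lparr>carrier = S, monoid.mult = (*), one = 1, zero = 0, add = (+)\<rparr>"

lemma ring_on_simps [simp]:
  "carrier (ring_on S) = S" "x \<otimes>\<^bsub>ring_on S\<^esub> y = x * y" "x \<oplus>\<^bsub>ring_on S\<^esub> y = x + y"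
  "\<one>\<^bsub>ring_on S\<^esub> = 1" "\<zero>\<^bsub>ring_on S\<^esub> = 0"
  by (simp_all add: ring_on_def)

definition closed_subring :: "'a::comm_ring_1 set \<Rightarrow> bool" where
  "closed_subring S \<longleftrightarrow> 1 \<in> S \<and> (\<forall>x\<in>S. - x \<in> S) \<and> (\<forall>x\<in>S. \<forall>y\<in>S. x + y \<in> S \<and> x * y \<in> S)"

lemma closed_subringD:
  assumes "closed_subring S"
  shows "1 \<in> S" "0 \<in> S" "x \<in> S \<Longrightarrow> - x \<in> S" "x \<in> S \<Longrightarrow> y \<in> S \<Longrightarrow> x + y \<in> S"
    "x \<in> S \<Longrightarrow> y \<in> S \<Longrightarrow> x * y \<in> S"
proof -
  have "1 + - 1 \<in> S" using assms unfolding closed_subring_def by blast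
  thus "0 \<in> S" by simp
qed (use assms in \<open>auto simp: closed_subring_def\<close>)

lemma cring_ring_on:
  assumes "closed_subring S" shows "cring (ring_on S)"
proof (rule cringI)
  note S = closed_subringD[OF assms]
  show "abelian_group (ring_on S)"
  proof (rule abelian_groupI)
    fix x assume "x \<in> carrier (ring_on S)"
    thus "\<exists>y\<in>carrier (ring_on S). y \<oplus>\<^bsub>ring_on S\<^esub> x = \<zero>\<^bsub>ring_on S\<^esub>"
      using S(3)[of x] by (intro bexI[of _ "- x"]) simp_all
  qed (simp_all add: S algebra_simps)
  show "Group.comm_monoid (ring_on S)"
    by (rule comm_monoidI) (simp_all add: S mult_ac)
qed (simp add: algebra_simps)

lemma ideal_ring_on_iff:
  assumes S: "closed_subring S"
  shows "ideal J (ring_on S) \<longleftrightarrow> J \<subseteq> S \<and> 0 \<in> J \<and> (\<forall>x\<in>J. \<forall>y\<in>J. x + y \<in> J) \<and> (\<forall>x\<in>J. \<forall>r\<in>S. r * x \<in> J)"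
proof
  assume J: "ideal J (ring_on S)"
  interpret ideal J "ring_on S" by fact
  show "J \<subseteq> S \<and> 0 \<in> J \<and> (\<forall>x\<in>J. \<forall>y\<in>J. x + y \<in> J) \<and> (\<forall>x\<in>J. \<forall>r\<in>S. r * x \<in> J)"
    using Icarr I_l_closed additive_subgroup.zero_closed[OF ideal.axioms(1)[OF J]]
      additive_subgroup.a_closed[OF ideal.axioms(1)[OF J]] by auto
next
  assume J: "J \<subseteq> S \<and> 0 \<in> J \<and> (\<forall>x\<in>J. \<forall>y\<in>J. x + y \<in> J) \<and> (\<forall>x\<in>J. \<forall>r\<in>S. r * x \<in> J)"
  have R: "cring (ring_on S)" by (rule cring_ring_on[OF S])
  interpret cring "ring_on S" by fact
  have minus: "\<ominus>\<^bsub>ring_on S\<^esub> x = - x" if "x \<in> S" for x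
    using that closed_subringD(3)[OF S that] by (intro minus_equality) simp_all
  show "ideal J (ring_on S)"
  proof (rule idealI)
    show "subgroup J (add_monoid (ring_on S))"
    proof (rule add.subgroupI)
      fix a assume a: "a \<in> J"
      have "- 1 \<in> S" using closed_subringD[OF S] by blast
      hence "- 1 * a \<in> J" using J a by blast
      thus "\<ominus>\<^bsub>ring_on S\<^esub> a \<in> J" using minus[of a] a J by auto
    qed (use J in auto)
  qed (use J ring_axioms in \<open>auto simp: mult.commute\<close>)
qed

text \<open>Clearing denominators: the fractions with numerator in \<open>J\<close> already form an ideal.\<close>
lemma local_contraction_iff:
  fixes S :: "'a::idom set"
  assumes S: "closed_subring S" and p: "p \<subseteq> S" "1 \<notin> p" "0 \<in> p"
    and prime: "\<And>a b. a \<in> S \<Longrightarrow> b \<in> S \<Longrightarrow> a * b \<in> p \<Longrightarrow> a \<in> p \<or> b \<in> p"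
    and J: "ideal J (ring_on S)"
  shows "f \<in> local_contraction (ring_on S) p J \<longleftrightarrow> f \<in> S \<and> (\<exists>b\<in>S - p. b * f \<in> J)"
proof -
  define T where "T = {Fract a b | a b. a \<in> S \<and> b \<in> S - p}"
  have L: "localization (ring_on S) p = ring_on T" by (simp add: localization_def ring_on_def T_def)
  note Sc = closed_subringD[OF S]
  note Jc = J[unfolded ideal_ring_on_iff[OF S]]
  have nz: "b \<noteq> 0" if "b \<in> S - p" for b using that p by auto
  have pm: "b * c \<in> S - p" if "b \<in> S - p" "c \<in> S - p" for b c
    using that prime[of b c] Sc(5)[of b c] by auto
  have one: "1 \<in> S - p" using Sc p by blast
  have T: "closed_subring T"
    unfolding closed_subring_def
  proof (intro conjI ballI)
    show "1 \<in> T" unfolding T_def using one Sc by (auto simp: One_fract_def)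
    fix x assume "x \<in> T"
    then obtain a b where x: "x = Fract a b" "a \<in> S" "b \<in> S - p" unfolding T_def by blast
    hence "- x = Fract (- a) b" "- a \<in> S" using Sc by auto
    thus "- x \<in> T" unfolding T_def using x(3) by blast
    fix y assume "y \<in> T"
    then obtain c d where y: "y = Fract c d" "c \<in> S" "d \<in> S - p" unfolding T_def by blast
    have "x + y = Fract (a * d + c * b) (b * d)" "x * y = Fract (a * c) (b * d)"
      using nz x y by simp_all
    moreover have "a * d + c * b \<in> S" "a * c \<in> S" using x y Sc by auto
    ultimately show "x + y \<in> T" "x * y \<in> T" unfolding T_def using pm[OF x(3) y(3)] by blast+
  qed
  show ?thesis
  proof
    assume "f \<in> local_contraction (ring_on S) p J"
    hence f: "f \<in> S" "Fract f 1 \<in> Idl\<^bsub>ring_on T\<^esub> ((\<lambda>g. Fract g 1) ` J)"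
      by (auto simp: local_contraction_def L)
    interpret T: cring "ring_on T" by (rule cring_ring_on[OF T])
    define K where "K = {Fract a b | a b. a \<in> J \<and> b \<in> S - p}"
    have "ideal K (ring_on T)"
      unfolding ideal_ring_on_iff[OF T]
    proof (intro conjI ballI)
      show "K \<subseteq> T" using Jc unfolding K_def T_def by blast
      show "0 \<in> K" unfolding K_def using Jc one by (auto simp: Zero_fract_def)
      fix x assume "x \<in> K"
      then obtain a b where x: "x = Fract a b" "a \<in> J" "b \<in> S - p" unfolding K_def by blast
      show "x + y \<in> K" if "y \<in> K" for y
      proof -
        from that obtain c d where y: "y = Fract c d" "c \<in> J" "d \<in> S - p" unfolding K_def by blast
        have "x + y = Fract (a * d + c * b) (b * d)" using nz x y by simp
        moreover have "d * a \<in> J" "b * c \<in> J" using Jc x y by auto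
        hence "a * d + c * b \<in> J" using Jc by (metis mult.commute)
        ultimately show ?thesis unfolding K_def using pm[OF x(3) y(3)] by blast
      qed
      show "y * x \<in> K" if "y \<in> T" for y
      proof -
        from that obtain c d where y: "y = Fract c d" "c \<in> S" "d \<in> S - p" unfolding T_def by blast
        have "y * x = Fract (c * a) (d * b)" using x y by simp
        moreover have "c * a \<in> J" using Jc x y by auto
        ultimately show ?thesis unfolding K_def using pm[OF y(3) x(3)] by blast
      qed
    qed
    moreover have "(\<lambda>g. Fract g 1) ` J \<subseteq> K" unfolding K_def using one by blast
    ultimately have "Fract f 1 \<in> K" using f(2) T.genideal_minimal by blast
    then obtain a b where ab: "Fract f 1 = Fract a b" "a \<in> J" "b \<in> S - p" unfolding K_def by blast
    hence "f * b = a" using nz by (simp add: eq_fract)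
    thus "f \<in> S \<and> (\<exists>b\<in>S - p. b * f \<in> J)" using f(1) ab by (auto simp: mult.commute)
  next
    assume "f \<in> S \<and> (\<exists>b\<in>S - p. b * f \<in> J)"
    then obtain b where f: "f \<in> S" and b: "b \<in> S - p" "b * f \<in> J" by blast
    have "Fract f 1 \<in> Q" if Q: "ideal Q (ring_on T)" "(\<lambda>g. Fract g 1) ` J \<subseteq> Q" for Q
    proof -
      have "Fract 1 b \<in> T" unfolding T_def using b Sc by blast
      moreover have "Fract (b * f) 1 \<in> Q" using Q(2) b(2) by blast
      ultimately have "Fract 1 b * Fract (b * f) 1 \<in> Q" using Q(1)[unfolded ideal_ring_on_iff[OF T]] by blast
      moreover have "Fract 1 b * Fract (b * f) 1 = Fract f 1" using nz[OF b(1)] by (simp add: eq_fract)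
      ultimately show ?thesis by simp
    qed
    thus "f \<in> local_contraction (ring_on S) p J"
      using f by (auto simp: local_contraction_def L genideal_def)
  qed
qed

lemma infinite_UNIV_alg_closed: "infinite (UNIV :: 'k::alg_closed_field set)"
proof
  assume fin: "finite (UNIV :: 'k set)"
  define P where "P = (\<Prod>a\<in>(UNIV::'k set). [:- a, 1:])"
  have nz: "P \<noteq> 0" unfolding P_def using fin by simp
  have root: "poly P x = 0" for x unfolding P_def poly_prod using fin by (intro prod_zero) auto
  have "degree P > 0"
  proof (rule ccontr)
    assume "\<not> degree P > 0"
    then obtain b where "P = [:b:]" by (auto elim: degree_eq_zeroE)
    thus False using root[of 0] nz by simp
  qed
  hence "degree (P + 1) > 0" using degree_add_eq_left[of 1 P] by simp
  then obtain x where "poly (P + 1) x = 0" using alg_closed_imp_poly_has_root by blast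
  thus False using root[of x] by simp
qed

text \<open>The restriction to the line through the origin and \<open>v\<close>. It is zero if and only if every
  homogeneous component vanishes at \<open>v\<close>, so it describes the homogeneous ideal of the point
  without mentioning components.\<close>
definition on_line :: "('v \<Rightarrow> 'k::comm_ring_1) \<Rightarrow> ('v, 'k) mpoly \<Rightarrow> 'k poly" where
  "on_line v = substitute (\<lambda>c. [:c:]) (\<lambda>i. [:0, v i:])"

lemma rhom_on_line: "rhom (on_line v)"
  unfolding on_line_def by (intro rhom_substitute rhom_pCons rhom_id)

lemma on_line_homogeneous: "homogeneous d f \<Longrightarrow> on_line v f = monom (poly_eval v f) d"
proof -
  assume f: "homogeneous d f"
  have "monom_val (\<lambda>i. [:0, v i:]) \<mu> = monom (monom_val v \<mu>) (mdeg \<mu>)" for \<mu>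
    by (rule monom_val_smult)
  hence "on_line v f = (\<Sum>\<mu>\<in>keys f. monom (lookup f \<mu> * monom_val v \<mu>) d)"
    unfolding on_line_def substitute_def using f by (intro sum.cong) (auto simp: homogeneous_iff smult_monom)
  also have "\<dots> = monom (\<Sum>\<mu>\<in>keys f. lookup f \<mu> * monom_val v \<mu>) d" by (simp add: monom_sum)
  finally show ?thesis by (simp add: poly_eval_eq_substitute substitute_def)
qed

lemma poly_on_line: "poly (on_line v f) c = poly_eval (\<lambda>i. c * v i) f"
proof -
  have "rhom (\<lambda>f. poly (on_line v f) c)"
    by (rule rhom_comp[of "\<lambda>p. poly p c"]) (auto simp: rhom_def rhomD[OF rhom_on_line])
  thus ?thesis
    by (rule rhom_eqI[OF _ rhom_poly_eval])
      (auto simp: on_line_def substitute_Const substitute_Var rhom_pCons rhom_id)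
qed

lemma on_line_nonzero_point:
  fixes f :: "('v, 'k::alg_closed_field) mpoly"
  assumes "on_line v f \<noteq> 0"
  shows "\<exists>c. c \<noteq> 0 \<and> poly_eval (\<lambda>i. c * v i) f \<noteq> 0"
proof (rule ccontr)
  assume "\<not> ?thesis"
  hence "UNIV - {0} \<subseteq> {c. poly (on_line v f) c = 0}" by (auto simp: poly_on_line)
  hence "finite (UNIV - {0::'k})" using poly_roots_finite[OF assms] finite_subset by blast
  thus False using infinite_UNIV_alg_closed[where 'k = 'k] by simp
qed

lemma poly_ring_eq_ring_on: "poly_ring V = ring_on {f. vars_in V f}"
  by (simp add: poly_ring_def ring_on_def vars_in_def)

lemma closed_subring_vars_in: "closed_subring {f :: ('v, 'k::comm_ring_1) mpoly. vars_in V f}"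
  unfolding closed_subring_def by (auto intro: vars_in_add vars_in_mult vars_in_uminus)

text \<open>Finitely many points of projective space outside the hyperplane \<open>x\<^sub>0 = 0\<close>, with
  normalized coordinates.\<close>
locale projective_points =
  fixes N :: nat and W :: "(nat \<Rightarrow> 'k::alg_closed_field) set"
  assumes finite_W: "finite W" and first_coord: "v \<in> W \<Longrightarrow> v 0 = 1"
    and separated: "v \<in> W \<Longrightarrow> w \<in> W \<Longrightarrow> v \<noteq> w \<Longrightarrow> \<exists>j\<in>{1..N}. v j \<noteq> w j"
begin

definition coord_ring :: "(nat, 'k) mpoly set" where "coord_ring = {f. vars_in {0..N} f}"

definition ideal_of_points :: "(nat, 'k) mpoly set" where "ideal_of_points = {f \<in> coord_ring. \<forall>v\<in>W. on_line v f = 0}"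

lemma ring_eq: "poly_ring {0..N} = ring_on coord_ring"
  by (simp add: poly_ring_eq_ring_on coord_ring_def)

lemma closed_subring_coord_ring: "closed_subring coord_ring"
  unfolding coord_ring_def by (rule closed_subring_vars_in)

lemmas coord_ring_closed = closed_subringD[OF closed_subring_coord_ring]

lemma cring_coord_ring: "cring (ring_on coord_ring)"
  by (rule cring_ring_on[OF closed_subring_coord_ring])

lemma ideal_ideal_of_points: "ideal ideal_of_points (ring_on coord_ring)"
  unfolding ideal_ring_on_iff[OF closed_subring_coord_ring] ideal_of_points_def
  by (auto simp: coord_ring_closed rhomD[OF rhom_on_line])

lemma eval_on_proj_point:
  assumes "u \<in> proj_point N v" "f \<in> coord_ring" "homogeneous d f"
  shows "\<exists>c. poly_eval u f = c ^ d * poly_eval v f"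
proof -
  obtain c where u: "u = (\<lambda>j\<in>{0..N}. c * v j)" using assms(1) by (auto simp: proj_point_def)
  have "poly_eval u f = poly_eval (\<lambda>i. c * v i) f"
    using assms(2) by (intro poly_eval_cong[of "{0..N}"]) (auto simp: coord_ring_def u)
  also have "\<dots> = poly (on_line v f) c" by (simp add: poly_on_line)
  also have "\<dots> = c ^ d * poly_eval v f" by (simp add: on_line_homogeneous[OF assms(3)] poly_monom)
  finally show ?thesis by blast
qed

text \<open>The homogeneous components of \<open>f\<close> contribute different powers to \<open>on_line v f\<close>, so each
  of them is a generator of the defining ideal.\<close>
lemma defining_ideal_eq: "defining_ideal N (proj_point N ` W) = ideal_of_points"
proof -
  define G where "G = {f \<in> coord_ring. (\<exists>d. homogeneous d f) \<and> (\<forall>P\<in>proj_point N ` W. \<forall>v\<in>P. poly_eval v f = 0)}"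
  have D: "defining_ideal N (proj_point N ` W) = Idl\<^bsub>ring_on coord_ring\<^esub> G"
    by (simp add: defining_ideal_def ring_eq G_def)
  interpret R: cring "ring_on coord_ring" by (rule cring_coord_ring)
  have "G \<subseteq> ideal_of_points"
  proof
    fix f assume f: "f \<in> G"
    then obtain d where d: "homogeneous d f" and fS: "f \<in> coord_ring" by (auto simp: G_def)
    have "on_line v f = 0" if v: "v \<in> W" for v
    proof -
      define u where "u = (\<lambda>j\<in>{0..N}. 1 * v j)"
      have "u \<in> proj_point N v" unfolding u_def proj_point_def by (intro CollectI exI[of _ 1]) simp
      hence "poly_eval u f = 0" using f v by (auto simp: G_def)
      moreover have "poly_eval u f = poly_eval v f"
        using fS by (intro poly_eval_cong[of "{0..N}"]) (auto simp: coord_ring_def u_def)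
      ultimately show ?thesis by (simp add: on_line_homogeneous[OF d])
    qed
    thus "f \<in> ideal_of_points" using fS by (simp add: ideal_of_points_def)
  qed
  hence 1: "Idl\<^bsub>ring_on coord_ring\<^esub> G \<subseteq> ideal_of_points" by (rule R.genideal_minimal[OF ideal_ideal_of_points])
  have idl: "ideal (Idl\<^bsub>ring_on coord_ring\<^esub> G) (ring_on coord_ring)" by (rule R.genideal_ideal) (auto simp: G_def)
  note ic = idl[unfolded ideal_ring_on_iff[OF closed_subring_coord_ring]]
  have "f \<in> Idl\<^bsub>ring_on coord_ring\<^esub> G" if f: "f \<in> ideal_of_points" for f
  proof -
    have fS: "f \<in> coord_ring" using f by (simp add: ideal_of_points_def)
    have cS: "coeff (grade f) j \<in> coord_ring" for j using fS by (simp add: coord_ring_def vars_in_coeff_grade)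
    have "poly_eval v (coeff (grade f) j) = 0" if v: "v \<in> W" for v j
    proof (cases "j \<in> mdeg ` keys f")
      case True
      have "0 = on_line v f" using f v by (simp add: ideal_of_points_def)
      also have "\<dots> = on_line v (\<Sum>j\<in>mdeg ` keys f. coeff (grade f) j)" by (simp flip: mpoly_eq_sum_components)
      also have "\<dots> = (\<Sum>j\<in>mdeg ` keys f. monom (poly_eval v (coeff (grade f) j)) j)"
        by (simp add: rhom_sum[OF rhom_on_line] on_line_homogeneous[OF homogeneous_coeff_grade])
      finally have "coeff (\<Sum>j\<in>mdeg ` keys f. monom (poly_eval v (coeff (grade f) j)) j) j = 0" by simp
      thus ?thesis using True by (simp add: coeff_sum)
    next
      case False
      hence "coeff (grade f) j = 0"
        by (intro poly_mapping_eqI) (auto simp: lookup_coeff_grade in_keys_iff image_iff)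
      thus ?thesis by (simp add: rhomD[OF rhom_poly_eval])
    qed
    hence "coeff (grade f) j \<in> G" for j
      using eval_on_proj_point[OF _ cS homogeneous_coeff_grade] cS homogeneous_coeff_grade[of j f]
      unfolding G_def by fastforce
    hence "coeff (grade f) j \<in> Idl\<^bsub>ring_on coord_ring\<^esub> G" for j
      using R.genideal_self[of G] by (auto simp: G_def)
    hence "(\<Sum>j\<in>J. coeff (grade f) j) \<in> Idl\<^bsub>ring_on coord_ring\<^esub> G" for J
      by (induction J rule: infinite_finite_induct) (use ic in auto)
    thus ?thesis using mpoly_eq_sum_components[of f] by metis
  qed
  thus ?thesis using 1 D by blast
qed

definition linear_form :: "(nat \<Rightarrow> 'k) \<Rightarrow> nat \<Rightarrow> (nat, 'k) mpoly" where
  "linear_form w j = Var j - Const (w j) * Var 0"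

lemma linear_form_coord_ring: "j \<le> N \<Longrightarrow> linear_form w j \<in> coord_ring"
  unfolding linear_form_def coord_ring_def by (auto intro!: vars_in_diff vars_in_mult vars_in_Var)

lemma homogeneous_linear_form: "homogeneous 1 (linear_form w j)"
  unfolding linear_form_def by (intro homogeneous_diff homogeneous_Var homogeneous_Const_Var)

lemma on_line_linear_form: "v 0 = 1 \<Longrightarrow> on_line v (linear_form w j) = monom (v j - w j) 1"
  by (simp only: on_line_homogeneous[OF homogeneous_linear_form])
    (simp add: linear_form_def rhom_diff[OF rhom_poly_eval] rhomD[OF rhom_poly_eval])

text \<open>A product of hyperplanes, one through each other point, all missing \<open>v\<close>.\<close>
lemma separating_form:
  assumes "v \<in> W"
  shows "\<exists>h\<in>coord_ring. on_line v h \<noteq> 0 \<and> (\<forall>w\<in>W - {v}. on_line w h = 0)"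
proof -
  have "\<exists>j\<in>{1..N}. v j \<noteq> w j" if "w \<in> W - {v}" for w using separated[of v w] assms that by blast
  then obtain j where j: "\<And>w. w \<in> W - {v} \<Longrightarrow> j w \<in> {1..N} \<and> v (j w) \<noteq> w (j w)" by metis
  define h where "h = (\<Prod>w\<in>W - {v}. linear_form w (j w))"
  have "h \<in> coord_ring" unfolding h_def coord_ring_def using j linear_form_coord_ring by (auto intro!: vars_in_prod simp: coord_ring_def)
  moreover have "on_line v h \<noteq> 0"
    unfolding h_def using finite_W j first_coord[OF assms]
    by (simp add: rhom_prod[OF rhom_on_line] on_line_linear_form monom_eq_0_iff)
  moreover have "on_line w h = 0" if w: "w \<in> W - {v}" for w
    unfolding h_def rhom_prod[OF rhom_on_line] using finite_W w first_coord[of w]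
    by (intro prod_zero bexI[of _ w]) (auto simp: on_line_linear_form)
  ultimately show ?thesis by blast
qed

definition point_ideal :: "(nat \<Rightarrow> 'k) \<Rightarrow> (nat, 'k) mpoly set" where
  "point_ideal v = {f \<in> coord_ring. on_line v f = 0}"

lemma primeideal_point_ideal: "primeideal (point_ideal v) (ring_on coord_ring)"
proof (rule primeidealI)
  show "ideal (point_ideal v) (ring_on coord_ring)"
    unfolding ideal_ring_on_iff[OF closed_subring_coord_ring] point_ideal_def by (auto simp: coord_ring_closed rhomD[OF rhom_on_line])
  show "carrier (ring_on coord_ring) \<noteq> point_ideal v"
  proof
    assume e: "carrier (ring_on coord_ring) = point_ideal v"
    have "1 \<in> carrier (ring_on coord_ring)" using coord_ring_closed(1) by simp
    thus False unfolding e by (simp add: point_ideal_def rhomD[OF rhom_on_line])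
  qed
qed (auto simp: cring_coord_ring point_ideal_def rhomD[OF rhom_on_line])

text \<open>The ideal \<open>(I : f)\<close> is the intersection of the ideals of the points where \<open>f\<close> is
  nonzero, and a prime ideal that is a finite intersection of ideals equals one of them.
  Conversely the separating forms realize every point.\<close>
lemma associated_primes_eq: "associated_primes (ring_on coord_ring) ideal_of_points = point_ideal ` W"
proof (intro equalityI subsetI)
  fix p assume "p \<in> point_ideal ` W"
  then obtain v where v: "v \<in> W" "p = point_ideal v" by auto
  obtain h where h: "h \<in> coord_ring" "on_line v h \<noteq> 0" "\<forall>w\<in>W - {v}. on_line w h = 0"
    using separating_form[OF v(1)] by blast
  have "point_ideal v = {g \<in> coord_ring. g * h \<in> ideal_of_points}"
    using h v(1) by (auto simp: point_ideal_def ideal_of_points_def coord_ring_closed rhomD[OF rhom_on_line])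
  thus "p \<in> associated_primes (ring_on coord_ring) ideal_of_points"
    using primeideal_point_ideal[of v] v h(1) by (auto simp: associated_primes_def)
next
  fix p assume "p \<in> associated_primes (ring_on coord_ring) ideal_of_points"
  then obtain f where p: "primeideal p (ring_on coord_ring)" and f: "f \<in> coord_ring" "p = {g \<in> coord_ring. g * f \<in> ideal_of_points}"
    by (auto simp: associated_primes_def)
  interpret p: primeideal p "ring_on coord_ring" by (rule p)
  define Q where "Q = {v \<in> W. on_line v f \<noteq> 0}"
  have p_iff: "g \<in> p \<longleftrightarrow> g \<in> coord_ring \<and> (\<forall>v\<in>Q. on_line v g = 0)" for g
    unfolding f(2) ideal_of_points_def Q_def using f(1) by (auto simp: coord_ring_closed rhomD[OF rhom_on_line])
  show "p \<in> point_ideal ` W"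
  proof (rule ccontr)
    assume n: "p \<notin> point_ideal ` W"
    have "\<exists>g\<in>coord_ring. on_line v g = 0 \<and> g \<notin> p" if v: "v \<in> Q" for v
    proof -
      have "p \<subseteq> point_ideal v" using p_iff v by (auto simp: point_ideal_def)
      moreover have "p \<noteq> point_ideal v" using n v by (auto simp: Q_def)
      ultimately show ?thesis by (auto simp: point_ideal_def)
    qed
    then obtain g where g: "\<And>v. v \<in> Q \<Longrightarrow> g v \<in> coord_ring \<and> on_line v (g v) = 0 \<and> g v \<notin> p" by metis
    have finQ: "finite Q" using finite_W by (simp add: Q_def)
    have one: "1 \<notin> p"
    proof
      assume "1 \<in> p"
      hence "coord_ring \<subseteq> p" using p.I_l_closed[of 1] by auto
      thus False using p.I_notcarr p.Icarr by auto
    qed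
    have "prod g J \<in> coord_ring - p" if "J \<subseteq> Q" for J
      using finite_subset[OF that finQ] that
    proof (induction J rule: finite_induct)
      case empty thus ?case using one coord_ring_closed by simp
    next
      case (insert v J)
      hence "g v \<in> coord_ring" "g v \<notin> p" "prod g J \<in> coord_ring" "prod g J \<notin> p" using g by auto
      hence "g v * prod g J \<notin> p" using p.I_prime[of "g v" "prod g J"] by auto
      thus ?case using insert.hyps coord_ring_closed(5)[OF \<open>g v \<in> coord_ring\<close> \<open>prod g J \<in> coord_ring\<close>] by simp
    qed
    moreover have "prod g Q \<in> p"
      unfolding p_iff
    proof (intro conjI ballI)
      show "prod g Q \<in> coord_ring" using calculation[of Q] by simp
      fix v assume v: "v \<in> Q"
      show "on_line v (prod g Q) = 0"
        unfolding rhom_prod[OF rhom_on_line] using g[OF v] finQ v by (intro prod_zero) auto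
    qed
    ultimately show False by blast
  qed
qed

definition ideal_power :: "nat \<Rightarrow> (nat, 'k) mpoly set" where
  "ideal_power t = ideal_of_points [^]\<^bsub>ideals_set (ring_on coord_ring)\<^esub> t"

lemma ideal_power_0: "ideal_power 0 = coord_ring"
  by (simp add: ideal_power_def ideals_set_def nat_pow_def)

lemma ideal_power_Suc: "ideal_power (Suc t) = ideal_prod (ring_on coord_ring) (ideal_power t) ideal_of_points"
  by (simp add: ideal_power_def ideals_set_def nat_pow_def)

lemma ideal_ideal_power: "ideal (ideal_power t) (ring_on coord_ring)"
proof (induction t)
  case 0
  show ?case unfolding ideal_power_0 ideal_ring_on_iff[OF closed_subring_coord_ring] by (auto simp: coord_ring_closed)
next
  case (Suc t)
  interpret R: cring "ring_on coord_ring" by (rule cring_coord_ring)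
  show ?case unfolding ideal_power_Suc by (rule R.ideal_prod_is_ideal[OF Suc ideal_ideal_of_points])
qed

lemmas ideal_power_closed = ideal_ideal_power[unfolded ideal_ring_on_iff[OF closed_subring_coord_ring]]

lemma ideal_power_Suc_mult: "f \<in> ideal_power t \<Longrightarrow> g \<in> ideal_of_points \<Longrightarrow> f * g \<in> ideal_power (Suc t)"
  unfolding ideal_power_Suc using ideal_prod.prod[of f "ideal_power t" g ideal_of_points "ring_on coord_ring"] by simp

lemma ideal_power_add: "ideal_power (t + u) = ideal_prod (ring_on coord_ring) (ideal_power t) (ideal_power u)"
proof -
  interpret R: cring "ring_on coord_ring" by (rule cring_coord_ring)
  interpret M: Group.comm_monoid "ideals_set (ring_on coord_ring)" by (rule R.ideals_set_is_comm_monoid)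
  have "ideal_of_points \<in> carrier (ideals_set (ring_on coord_ring))" using ideal_ideal_of_points by (simp add: ideals_set_def)
  from M.nat_pow_mult[OF this, of t u] show ?thesis by (simp add: ideal_power_def ideals_set_def)
qed

lemma ideal_power_mult: "f \<in> ideal_power t \<Longrightarrow> g \<in> ideal_power u \<Longrightarrow> f * g \<in> ideal_power (t + u)"
  unfolding ideal_power_add using ideal_prod.prod[of f "ideal_power t" g "ideal_power u" "ring_on coord_ring"] by simp

lemma ideal_power_antimono: "u \<le> t \<Longrightarrow> ideal_power t \<subseteq> ideal_power u"
proof (induction t rule: dec_induct)
  case (step n)
  interpret R: cring "ring_on coord_ring" by (rule cring_coord_ring)
  show ?case using R.ideal_prod_inter[OF ideal_ideal_power ideal_ideal_of_points, of n] step.IH unfolding ideal_power_Suc by blast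
qed simp

text \<open>The contraction of \<open>I\<^sup>t\<close> from the local ring at a point, with the denominator made
  explicit; by \<open>symbolic_power_iff\<close>, intersecting these gives the symbolic power.\<close>
definition local_power :: "(nat \<Rightarrow> 'k) \<Rightarrow> nat \<Rightarrow> (nat, 'k) mpoly set" where
  "local_power v t = {f \<in> coord_ring. \<exists>b\<in>coord_ring. on_line v b \<noteq> 0 \<and> b * f \<in> ideal_power t}"

lemma symbolic_power_iff:
  "f \<in> symbolic_power (ring_on coord_ring) ideal_of_points t \<longleftrightarrow> f \<in> coord_ring \<and> (\<forall>v\<in>W. f \<in> local_power v t)"
proof -
  have "f \<in> local_contraction (ring_on coord_ring) (point_ideal v) (ideal_power t) \<longleftrightarrow> f \<in> local_power v t" for v
  proof -
    have "f \<in> local_contraction (ring_on coord_ring) (point_ideal v) (ideal_power t) \<longleftrightarrow> f \<in> coord_ring \<and> (\<exists>b\<in>coord_ring - point_ideal v. b * f \<in> ideal_power t)"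
    proof (rule local_contraction_iff[OF closed_subring_coord_ring _ _ _ _ ideal_ideal_power])
      fix a b :: "(nat, 'k) mpoly"
      assume "a \<in> coord_ring" "b \<in> coord_ring" "a * b \<in> point_ideal v"
      thus "a \<in> point_ideal v \<or> b \<in> point_ideal v" by (auto simp: point_ideal_def rhomD[OF rhom_on_line])
    qed (auto simp: point_ideal_def rhomD[OF rhom_on_line] coord_ring_closed)
    thus ?thesis by (auto simp: local_power_def point_ideal_def)
  qed
  thus ?thesis by (auto simp: symbolic_power_def associated_primes_eq ideal_power_def)
qed

lemma local_power_mult:
  assumes "f \<in> local_power v t" "g \<in> local_power v u" shows "f * g \<in> local_power v (t + u)"
proof -
  obtain b c where b: "b \<in> coord_ring" "on_line v b \<noteq> 0" "b * f \<in> ideal_power t" "c \<in> coord_ring" "on_line v c \<noteq> 0" "c * g \<in> ideal_power u"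
    and fg: "f \<in> coord_ring" "g \<in> coord_ring" using assms by (auto simp: local_power_def)
  have "(b * f) * (c * g) \<in> ideal_power (t + u)" using b by (intro ideal_power_mult)
  hence "(b * c) * (f * g) \<in> ideal_power (t + u)" by (simp add: mult_ac)
  moreover have "b * c \<in> coord_ring" "f * g \<in> coord_ring" "on_line v (b * c) \<noteq> 0"
    using b fg by (auto simp: coord_ring_closed rhomD[OF rhom_on_line])
  ultimately show ?thesis by (auto simp: local_power_def)
qed

lemma local_power_0: "f \<in> coord_ring \<Longrightarrow> f \<in> local_power v 0"
  unfolding local_power_def ideal_power_0 by (auto intro!: bexI[of _ 1] simp: coord_ring_closed rhomD[OF rhom_on_line])

lemma local_power_mult_left: "f \<in> coord_ring \<Longrightarrow> g \<in> local_power v t \<Longrightarrow> f * g \<in> local_power v t"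
  using local_power_mult[of f v 0 g t] local_power_0[of f v] by simp

lemma local_power_add:
  assumes "f \<in> local_power v t" "g \<in> local_power v t" shows "f + g \<in> local_power v t"
proof -
  obtain b c where b: "b \<in> coord_ring" "on_line v b \<noteq> 0" "b * f \<in> ideal_power t" "c \<in> coord_ring" "on_line v c \<noteq> 0" "c * g \<in> ideal_power t"
    and fg: "f \<in> coord_ring" "g \<in> coord_ring" using assms by (auto simp: local_power_def)
  have "c * (b * f) + b * (c * g) \<in> ideal_power t" using b ideal_power_closed[of t] by blast
  hence "(b * c) * (f + g) \<in> ideal_power t" by (simp add: algebra_simps)
  moreover have "b * c \<in> coord_ring" "f + g \<in> coord_ring" "on_line v (b * c) \<noteq> 0"
    using b fg by (auto simp: coord_ring_closed rhomD[OF rhom_on_line])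
  ultimately show ?thesis by (auto simp: local_power_def)
qed

lemma local_power_sum:
  "finite J \<Longrightarrow> (\<And>i. i \<in> J \<Longrightarrow> f i \<in> local_power v t) \<Longrightarrow> sum f J \<in> local_power v t"
proof (induction J rule: finite_induct)
  case empty
  thus ?case using ideal_power_closed[of t] coord_ring_closed by (auto simp: local_power_def rhomD[OF rhom_on_line] intro!: bexI[of _ 1])
qed (auto intro: local_power_add)

lemma local_power_antimono: "u \<le> t \<Longrightarrow> f \<in> local_power v t \<Longrightarrow> f \<in> local_power v u"
  using ideal_power_antimono[of u t] by (auto simp: local_power_def)

text \<open>The separating form of \<open>v\<close> is invertible at \<open>v\<close> and pushes the linear form into the
  ideal of all the points.\<close>
lemma linear_form_local_power:
  assumes v: "v \<in> W" and j: "j \<le> N" shows "linear_form v j \<in> local_power v 1"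
proof -
  obtain h where h: "h \<in> coord_ring" "on_line v h \<noteq> 0" "\<forall>w\<in>W - {v}. on_line w h = 0"
    using separating_form[OF v(1)] by blast
  have "h * linear_form v j \<in> ideal_of_points"
    using h linear_form_coord_ring[OF j] on_line_linear_form[where v = v and w = v and j = j, OF first_coord[OF v]]
    by (auto simp: ideal_of_points_def coord_ring_closed rhomD[OF rhom_on_line])
  hence "1 * (h * linear_form v j) \<in> ideal_power 1" using ideal_power_Suc_mult[of 1 0] coord_ring_closed by (simp add: ideal_power_0)
  thus ?thesis using h linear_form_coord_ring[OF j] by (auto simp: local_power_def)
qed

lemma power_local_power: "f \<in> local_power v 1 \<Longrightarrow> f ^ n \<in> local_power v n"
proof (induction n)
  case (Suc n)
  thus ?case using local_power_mult[of f v 1 "f ^ n" n] by simp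
qed (simp add: local_power_0 coord_ring_closed)

lemma prod_local_power:
  "finite J \<Longrightarrow> (\<And>i. i \<in> J \<Longrightarrow> f i \<in> local_power v (n i)) \<Longrightarrow> prod f J \<in> local_power v (sum n J)"
  by (induction J rule: finite_induct) (auto intro: local_power_mult simp: local_power_0 coord_ring_closed)

lemma symbolic_power_mult:
  "f \<in> symbolic_power (ring_on coord_ring) ideal_of_points t \<Longrightarrow> g \<in> symbolic_power (ring_on coord_ring) ideal_of_points u \<Longrightarrow>
   f * g \<in> symbolic_power (ring_on coord_ring) ideal_of_points (t + u)"
  unfolding symbolic_power_iff by (auto intro: local_power_mult simp: coord_ring_closed)

lemma ideal_power_vanishes:
  assumes "f \<in> ideal_power t" "v \<in> W" shows "vanishes t (\<lambda>i. c * v i) f"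
  using assms(1)
proof (induction t arbitrary: f)
  case (Suc t)
  from Suc.prems[unfolded ideal_power_Suc] show ?case
  proof (induction rule: ideal_prod.induct)
    case (prod i j)
    have "poly_eval (\<lambda>i. c * v i) j = poly (on_line v j) c" by (simp add: poly_on_line)
    also have "\<dots> = 0" using prod(2) assms(2) by (simp add: ideal_of_points_def)
    finally have "vanishes 1 (\<lambda>i. c * v i) j" by (simp only: vanishes_1_iff)
    thus ?case using vanishes_mult[OF Suc.IH[OF prod(1)]] by fastforce
  qed (auto intro: vanishes_add)
qed simp

text \<open>The denominator \<open>b\<close> is nonzero at some nonzero multiple of \<open>v\<close>. There it can be
  cancelled, and \<open>f\<close>, being homogeneous, has the same order at \<open>v\<close>.\<close>
lemma symbolic_power_vanishes:
  assumes f: "f \<in> symbolic_power (ring_on coord_ring) ideal_of_points t" "homogeneous d f" and v: "v \<in> W"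
  shows "vanishes t v f"
proof -
  obtain b where b: "b \<in> coord_ring" "on_line v b \<noteq> 0" "b * f \<in> ideal_power t"
    using f(1) v by (auto simp: symbolic_power_iff local_power_def)
  obtain c where c: "c \<noteq> 0" "poly_eval (\<lambda>i. c * v i) b \<noteq> 0" using on_line_nonzero_point[OF b(2)] by blast
  have "\<not> vanishes (Suc 0) (\<lambda>i. c * v i) b" using c(2) vanishes_1_iff[of "\<lambda>i. c * v i" b] by simp
  moreover have "vanishes (t + 0) (\<lambda>i. c * v i) (b * f)" using ideal_power_vanishes[OF b(3) v] by simp
  ultimately have "vanishes t (\<lambda>i. c * v i) f" using vanishes_mult_cancel by blast
  thus ?thesis by (rule vanishes_scale[OF f(2) c(1)])
qed

text \<open>Products of powers of hyperplanes. This makes the initial degrees genuine minima.\<close>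
lemma symbolic_power_nonzero:
  assumes "N \<ge> 1"
  shows "\<exists>d. \<exists>f\<in>symbolic_power (ring_on coord_ring) ideal_of_points t. f \<noteq> 0 \<and> homogeneous d f"
proof -
  define f where "f = (\<Prod>v\<in>W. linear_form v 1 ^ t)"
  have lS: "linear_form v 1 ^ t \<in> coord_ring" for v
    using linear_form_coord_ring[of 1 v] assms by (auto simp: coord_ring_def intro!: vars_in_power)
  have pS: "prod (\<lambda>v. linear_form v 1 ^ t) J \<in> coord_ring" for J using lS by (auto simp: coord_ring_def intro!: vars_in_prod)
  have "f \<in> local_power v t" if v: "v \<in> W" for v
  proof -
    have "f = (\<Prod>w\<in>W - {v}. linear_form w 1 ^ t) * linear_form v 1 ^ t"
      unfolding f_def using finite_W v by (subst prod.remove[of _ v]) (auto simp: mult.commute)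
    thus ?thesis using pS power_local_power[OF linear_form_local_power[OF v, of 1], of t] assms
      by (auto intro!: local_power_mult_left)
  qed
  hence "f \<in> symbolic_power (ring_on coord_ring) ideal_of_points t" unfolding symbolic_power_iff using pS[of W] by (simp add: f_def)
  moreover have "homogeneous (\<Sum>v\<in>W. t * 1) f"
    unfolding f_def by (intro homogeneous_prod homogeneous_power homogeneous_linear_form)
  moreover have "linear_form v 1 \<noteq> 0" for v
  proof
    assume "linear_form v 1 = 0"
    hence "poly_eval (\<lambda>i. if i = 1 then 1 else 0) (linear_form v 1) = 0" by (simp add: rhomD[OF rhom_poly_eval])
    thus False by (simp add: linear_form_def rhom_diff[OF rhom_poly_eval] rhomD[OF rhom_poly_eval])
  qed
  hence "f \<noteq> 0" unfolding f_def using finite_W by simp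
  ultimately show ?thesis by blast
qed

end

section \<open>A special configuration\<close>

text \<open>The points \<open>(1, c\<^sub>w\<^sub>1, \<dots>, c\<^sub>w\<^sub>N)\<close>, \<open>w \<in> few_tops k N r\<close>, form the special configuration.
  Cut by \<open>x\<^sub>N = c\<^sub>l x\<^sub>0\<close> it becomes a configuration of the same kind in one dimension less: with
  the same \<open>r\<close> for the \<open>k\<close> ordinary letters \<open>l\<close>, and with \<open>r - 1\<close> for the top letter.\<close>
definition few_tops :: "nat \<Rightarrow> nat \<Rightarrow> nat \<Rightarrow> (nat \<Rightarrow> nat) set" where
  "few_tops k N r = {w \<in> {1..N} \<rightarrow>\<^sub>E {0..k}. card {i\<in>{1..N}. w i = k} \<le> r}"

definition word_point :: "(nat \<Rightarrow> 'k::zero_neq_one) \<Rightarrow> (nat \<Rightarrow> nat) \<Rightarrow> nat \<Rightarrow> 'k" where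
  "word_point c w i = (if i = 0 then 1 else c (w i))"

lemma few_tops_extend:
  assumes w: "w \<in> few_tops k N r" and l: "l \<le> k"
  shows "w(Suc N := l) \<in> few_tops k (Suc N) (if l = k then Suc r else r)"
proof -
  have wE: "w \<in> {1..N} \<rightarrow>\<^sub>E {0..k}" and c: "card {i\<in>{1..N}. w i = k} \<le> r"
    using w by (auto simp: few_tops_def)
  have "w(Suc N := l) \<in> {1..Suc N} \<rightarrow>\<^sub>E {0..k}"
    using wE l by (auto simp: PiE_iff extensional_def le_Suc_eq)
  moreover have "{i\<in>{1..Suc N}. (w(Suc N := l)) i = k} =
      (if l = k then insert (Suc N) {i\<in>{1..N}. w i = k} else {i\<in>{1..N}. w i = k})"
    by auto
  ultimately show ?thesis using c by (auto simp: few_tops_def)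
qed

lemma few_tops_extend_less:
  assumes "w \<in> few_tops k N r" "l < k" shows "w(Suc N := l) \<in> few_tops k (Suc N) r"
proof -
  have "(if l = k then Suc r else r) = r" using assms(2) by simp
  thus ?thesis using few_tops_extend[OF assms(1) less_imp_le[OF assms(2)]] by argo
qed

lemma few_tops_extend_top:
  assumes "w \<in> few_tops k N (r - 1)" "r \<ge> 1" shows "w(Suc N := k) \<in> few_tops k (Suc N) r"
proof -
  have "(if k = k then Suc (r - 1) else r - 1) = r" using assms(2) by simp
  thus ?thesis using few_tops_extend[OF assms(1) order_refl] by argo
qed

lemma alpha_bound_ge: "k \<ge> 1 \<Longrightarrow> alpha_bound k N r \<ge> real k"
  by (auto simp: alpha_bound_def intro!: divide_nonneg_nonneg add_nonneg_nonneg mult_nonneg_nonneg)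

lemma alpha_bound_le: "k \<ge> 1 \<Longrightarrow> alpha_bound k N r \<le> real k + 1"
proof (cases "r \<ge> N")
  case False
  assume k: "k \<ge> 1"
  have "real k * real r = (real k - 1) * real r + real r" by (simp add: algebra_simps)
  also have "\<dots> \<le> real N + (real k - 1) * real r" using False by simp
  finally have le: "real k * real r \<le> real N + (real k - 1) * real r" .
  have "real N + (real k - 1) * real r > 0" using False k by (intro add_pos_nonneg mult_nonneg_nonneg) auto
  thus ?thesis using False le by (simp add: alpha_bound_def divide_le_eq)
qed (simp add: alpha_bound_def)

text \<open>The numerical counterpart of the hyperplane sections: if \<open>k\<close> parallel hyperplanes carry
  sections with constant \<open>a\<close> and one more carries a section with constant \<open>b\<close>, the total
  constant is at least \<open>k + (1 - k/a) b\<close>.\<close>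
lemma alpha_bound_recursion:
  assumes k: "k \<ge> 1" and r: "r \<ge> 1"
  shows "alpha_bound k (Suc N) r \<le> real k + (1 - real k / alpha_bound k N r) * alpha_bound k N (r - 1)"
proof (cases "r \<ge> Suc N")
  case True
  have a: "alpha_bound k N r = real k + 1" "alpha_bound k N (r - 1) = real k + 1" "alpha_bound k (Suc N) r = real k + 1"
    using True by (auto simp: alpha_bound_def)
  have "(1 - real k / (real k + 1)) * (real k + 1) = 1" by (simp add: field_simps)
  thus ?thesis unfolding a by linarith
next
  case False
  hence rN: "r \<le> N" by simp
  define A where "A = real N + real k * real r"
  define B where "B = real N + (real k - 1) * real r"
  have Bpos: "B > 0" unfolding B_def using rN r k by (intro add_pos_nonneg mult_nonneg_nonneg) auto
  have AB: "A = B + real r" by (simp add: A_def B_def algebra_simps)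
  have Apos: "A > 0" using AB Bpos by simp
  have a: "alpha_bound k N r = real k * A / B"
  proof (cases "r = N")
    case True
    have "real k * A = (real k + 1) * B" using True by (simp add: A_def B_def algebra_simps)
    thus ?thesis using True Bpos by (simp add: alpha_bound_def field_simps)
  next
    case False thus ?thesis using rN Bpos unfolding alpha_bound_def B_def[symmetric] by (simp add: A_def B_def field_simps)
  qed
  define C where "C = B - (real k - 1)"
  have Ceq: "C = real N + (real k - 1) * real (r - 1)" using r by (simp add: C_def B_def of_nat_diff algebra_simps)
  have Cpos: "C > 0" unfolding Ceq using rN r k by (intro add_pos_nonneg mult_nonneg_nonneg) auto
  have b: "alpha_bound k N (r - 1) = real k * (A - real k) / C"
  proof -
    have "\<not> N \<le> r - 1" using rN r by auto
    hence "alpha_bound k N (r - 1) = real k + real k * real (r - 1) / C" by (simp add: alpha_bound_def Ceq)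
    also have "\<dots> = real k * (C + real (r - 1)) / C" using Cpos by (simp add: field_simps)
    also have "C + real (r - 1) = A - real k" using r by (simp add: Ceq A_def of_nat_diff algebra_simps)
    finally show ?thesis .
  qed
  have S: "alpha_bound k (Suc N) r = real k + real k * real r / (B + 1)"
    using False by (simp add: alpha_bound_def B_def algebra_simps)
  have k0: "real k > 0" using k by simp
  have "real k / alpha_bound k N r = B / A" unfolding a using k0 Apos Bpos by simp
  moreover have "1 - B / A = real r / A" using Apos AB by (simp add: field_simps)
  ultimately have q: "1 - real k / alpha_bound k N r = real r / A" by simp
  have R: "(1 - real k / alpha_bound k N r) * alpha_bound k N (r - 1) = real r / A * (real k * (A - real k) / C)"
    by (simp only: q b)
  have "A * C \<le> (A - real k) * (B + 1)"
  proof -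
    have "(A - real k) * (B + 1) - A * C = real k * (real r - 1)"
      by (simp add: C_def AB algebra_simps)
    moreover have "real k * (real r - 1) \<ge> 0" using r by (intro mult_nonneg_nonneg) auto
    ultimately show ?thesis by linarith
  qed
  hence "1 / (B + 1) \<le> (A - real k) / (A * C)" using Apos Bpos Cpos by (simp add: field_simps)
  hence "real k * real r * (1 / (B + 1)) \<le> real k * real r * ((A - real k) / (A * C))"
    by (intro mult_left_mono) auto
  thus ?thesis unfolding S R by (simp add: field_simps)
qed

text \<open>One hyperplane after the other. Being parallel, they are disjoint in the chart
  \<open>x\<^sub>0 = 1\<close>, so a point on one of them loses only one order.\<close>
lemma divide_hyperplanes:
  fixes F :: "(nat, 'k::field) mpoly"
  assumes L: "finite L" "inj_on c L" and n: "n \<noteq> 0"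
    and F: "vars_in {0..n} F" "homogeneous D F" "F \<noteq> 0"
    and restr: "\<And>l. l \<in> L \<Longrightarrow> restrict_hyperplane n (c l) F = 0"
  shows "\<exists>G. card L \<le> D \<and> vars_in {0..n} G \<and> homogeneous (D - card L) G \<and> G \<noteq> 0 \<and>
    (\<forall>v t. v 0 = 1 \<longrightarrow> vanishes t v F \<longrightarrow>
       vanishes (t - 1) v G \<and> ((\<forall>l\<in>L. v n \<noteq> c l) \<longrightarrow> vanishes t v G))"
  using L F restr
proof (induction L arbitrary: F D rule: finite_induct)
  case empty
  thus ?case by (intro exI[of _ F]) (auto intro: vanishes_mono)
next
  case (insert l L)
  obtain H where H: "D > 0" "vars_in {0..n} H" "homogeneous (D - 1) H" "H \<noteq> 0"
    "F = (Var n - Const (c l) * Var 0) * H"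
    using homogeneous_divide_hyperplane[OF insert.prems(2,3,4), of "c l"] insert.prems(5)[of l] by auto
  have "restrict_hyperplane n (c l') H = 0" if l': "l' \<in> L" for l'
  proof -
    have "0 = restrict_hyperplane n (c l') (Var n - Const (c l) * Var 0) * restrict_hyperplane n (c l') H"
      using insert.prems(5)[of l'] l' by (simp add: H(5) rhomD[OF rhom_restrict_hyperplane])
    also have "restrict_hyperplane n (c l') (Var n - Const (c l) * Var 0) = Const (c l' - c l) * Var 0"
      using n by (simp add: rhom_diff[OF rhom_restrict_hyperplane] rhomD[OF rhom_restrict_hyperplane]
          left_diff_distrib single_diff)
    finally have "Const (c l' - c l) * Var 0 = (0 :: (nat, 'k) mpoly) \<or> restrict_hyperplane n (c l') H = 0" by auto
    moreover have "c l' \<noteq> c l" using insert.prems(1) insert.hyps l' by (auto simp: inj_on_def)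
    hence "poly_eval (\<lambda>_. 1) (Const (c l' - c l) * Var 0) \<noteq> 0"
      by (simp add: rhomD[OF rhom_poly_eval])
    hence "Const (c l' - c l) * Var 0 \<noteq> (0 :: (nat, 'k) mpoly)" using rhomD(1)[OF rhom_poly_eval] by metis
    ultimately show ?thesis by simp
  qed
  moreover have "inj_on c L" using insert.prems(1) by simp
  ultimately obtain G where G: "card L \<le> D - 1" "vars_in {0..n} G" "homogeneous (D - 1 - card L) G" "G \<noteq> 0"
    and vG: "\<And>v t. v 0 = 1 \<Longrightarrow> vanishes t v H \<Longrightarrow> vanishes (t - 1) v G \<and> ((\<forall>l\<in>L. v n \<noteq> c l) \<longrightarrow> vanishes t v G)"
    using insert.IH[OF _ H(2,3,4)] by blast
  show ?case
  proof (rule exI[of _ G], intro conjI allI impI)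
    show "card (insert l L) \<le> D" using G(1) H(1) insert.hyps by simp
    show "homogeneous (D - card (insert l L)) G" using G(3) insert.hyps by simp
    fix v :: "nat \<Rightarrow> 'k" and t assume v: "v 0 = 1" and F: "vanishes t v F"
    note dv = vanishes_divide_hyperplane[OF F[unfolded H(5)] n]
    show "vanishes (t - 1) v G"
    proof (cases "v n = c l")
      case True
      hence "\<forall>l'\<in>L. v n \<noteq> c l'" using insert.prems(1) insert.hyps by (auto simp: inj_on_def)
      thus ?thesis using vG[OF v dv(1)] by blast
    next
      case False
      thus ?thesis using vG[OF v dv(2)] v by simp
    qed
    show "vanishes t v G" if "\<forall>l\<in>insert l L. v n \<noteq> c l"
      using vG[OF v dv(2)] v that by simp
  qed (use G in auto)
qed

text \<open>The induction on the dimension compares, on each hyperplane \<open>x\<^sub>N = c l x\<^sub>0\<close>, the degree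
  of the restriction with the bound there; too small a degree forces divisibility by the
  equation. Let \<open>t1\<close> and \<open>t2\<close> be the current orders on the \<open>k\<close> ordinary hyperplanes and on the
  top one. The quantity \<open>k t1 + t2 - D\<close> does not change under the divisions, and as long as it
  is large enough one of the two kinds of hyperplanes can be divided out. Hence the degree would
  be exhausted.\<close>
lemma special_configuration_bound:
  fixes F :: "(nat, 'k::field) mpoly"
  assumes k: "k \<ge> 1" and c: "inj_on c {0..k}"
    and F: "vars_in {0..N} F" "homogeneous D F" "F \<noteq> 0"
    and v: "\<And>w. w \<in> few_tops k N r \<Longrightarrow> vanishes t (word_point c w) F"
  shows "alpha_bound k N r * real t \<le> real D"
  using F v
proof (induction N arbitrary: F D r t)
  case 0
  define w :: "nat \<Rightarrow> nat" where "w = (\<lambda>_. undefined)"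
  have "w \<in> few_tops k 0 r" by (auto simp: few_tops_def w_def)
  hence van: "vanishes t (word_point c w) F" using 0 by blast
  have "t = 0"
  proof (rule ccontr)
    assume "t \<noteq> 0"
    hence ev: "poly_eval (word_point c w) F = 0"
      using vanishes_mono[OF van, of 1] vanishes_1_iff[of "word_point c w" F] by simp
    have eF: "poly_eval (word_point c w) F = (\<Sum>\<mu>\<in>keys F. lookup F \<mu>)"
      unfolding poly_eval_def using 0(1)
      by (intro sum.cong refl) (auto simp: vars_in_def word_point_def subset_iff intro!: prod.neutral)
    have "\<mu> = single 0 D" if "\<mu> \<in> keys F" for \<mu>
    proof (rule poly_mapping_eqI)
      fix i
      have k0: "keys \<mu> \<subseteq> {0}" using that 0(1) by (auto simp: vars_in_def)
      have "mdeg \<mu> = D" using that 0(2) by (simp add: homogeneous_iff)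
      hence "lookup \<mu> 0 = D" using mdeg_eq_sum[of "{0}" \<mu>] k0 by simp
      thus "lookup \<mu> i = lookup (single 0 D) i"
        using k0 by (cases "i = 0") (auto simp: lookup_single when_def in_keys_iff)
    qed
    moreover obtain \<mu> where \<mu>: "\<mu> \<in> keys F" using 0(3) keys_eq_empty[of F] by fastforce
    ultimately have "keys F = {\<mu>}" by blast
    hence "(\<Sum>\<mu>\<in>keys F. lookup F \<mu>) = lookup F \<mu>" by simp
    thus False using ev eF \<mu> by (simp add: in_keys_iff)
  qed
  thus ?case by simp
next
  case (Suc N)
  define a where "a = alpha_bound k N r"
  have ak: "a \<ge> real k" "a \<le> real k + 1" unfolding a_def using k by (auto intro: alpha_bound_ge alpha_bound_le)
  have a0: "a > 0" using ak k by simp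
  have point: "word_point c (w(Suc N := l)) (Suc N) = c l" "word_point c (w(Suc N := l)) 0 = 1" for w l
    by (auto simp: word_point_def)
  \<comment> \<open>too small a degree forces the restriction to a hyperplane to be zero\<close>
  have restr0: "restrict_hyperplane (Suc N) (c l) G = 0"
    if G: "vars_in {0..Suc N} G" "homogeneous E G" and l: "l \<le> k"
      and vG: "\<And>w. w \<in> few_tops k N q \<Longrightarrow> vanishes u (word_point c (w(Suc N := l))) G"
      and lt: "real E < alpha_bound k N q * real u" for G E l q u
  proof (rule ccontr)
    define H where "H = restrict_hyperplane (Suc N) (c l) G"
    assume "restrict_hyperplane (Suc N) (c l) G \<noteq> 0"
    hence H0: "H \<noteq> 0" by (simp add: H_def)
    have HV: "vars_in {0..N} H" unfolding H_def using vars_in_restrict_hyperplane[OF G(1)] by simp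
    have "vanishes u (word_point c w) H" if w: "w \<in> few_tops k N q" for w
    proof -
      have "vanishes u (word_point c (w(Suc N := l))) H"
        unfolding H_def using vG[OF w] by (rule vanishes_restrict_hyperplane) (simp add: point)
      thus ?thesis
        by (rule vanishes_cong[OF HV, THEN iffD1, rotated]) (auto simp: word_point_def)
    qed
    hence "alpha_bound k N q * real u \<le> real E"
      using Suc.IH[OF HV homogeneous_restrict_hyperplane[OF G(2), of "Suc N" "c l", folded H_def] H0] by blast
    thus False using lt by simp
  qed
  have c_eq: "c l = c l' \<longleftrightarrow> l = l'" if "l \<le> k" "l' \<le> k" for l l'
    using inj_onD[OF c, of l l'] that by auto
  show ?case
  proof (cases "r = 0")
    case True
    have ab: "alpha_bound k (Suc N) r = real k"
      using True by (simp add: alpha_bound_def)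
    have "real k * real u \<le> real E"
      if "vars_in {0..Suc N} G" "homogeneous E G" "G \<noteq> 0"
        and "\<And>w l. w \<in> few_tops k N 0 \<Longrightarrow> l < k \<Longrightarrow> vanishes u (word_point c (w(Suc N := l))) G" for G E u
      using that
    proof (induction u arbitrary: G E)
      case (Suc u)
      show ?case
      proof (rule ccontr)
        assume n: "\<not> ?thesis"
        have "real k * real (Suc u) \<le> a * real (Suc u)" using ak(1) by (rule mult_right_mono) simp
        hence n': "real E < alpha_bound k N 0 * real (Suc u)" using n unfolding a_def True by linarith
        have "restrict_hyperplane (Suc N) (c l) G = 0" if l: "l \<in> {0..<k}" for l
          using l by (intro restr0[OF Suc.prems(1,2) _ _ n'] Suc.prems(4)) auto
        moreover have "inj_on c {0..<k}" using c by (rule inj_on_subset) auto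
        ultimately obtain H where H: "k \<le> E" "vars_in {0..Suc N} H" "homogeneous (E - k) H" "H \<noteq> 0"
          and vH: "\<And>v t. v 0 = 1 \<Longrightarrow> vanishes t v G \<Longrightarrow> vanishes (t - 1) v H"
          using divide_hyperplanes[of "{0..<k}" c "Suc N" G E] Suc.prems(1,2,3) by auto
        have "vanishes u (word_point c (w(Suc N := l))) H" if "w \<in> few_tops k N 0" "l < k" for w l
          using vH[OF point(2) Suc.prems(4)[OF that]] unfolding diff_Suc_1 .
        hence "real k * real u \<le> real (E - k)" using Suc.IH[OF H(2,3,4)] by blast
        thus False using n H(1) by (simp add: of_nat_diff algebra_simps)
      qed
    qed simp
    moreover have "vanishes t (word_point c (w(Suc N := l))) F" if "w \<in> few_tops k N 0" "l < k" for w l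
      using that few_tops_extend_less[of w k N r l] unfolding True by (intro Suc.prems(4)[unfolded True])
    ultimately have "real k * real t \<le> real D" using Suc.prems(1,2,3) by blast
    thus ?thesis by (simp add: ab)
  next
    case False
    hence r: "r \<ge> 1" by simp
    define b where "b = alpha_bound k N (r - 1)"
    have bk: "b \<ge> real k" "b \<le> real k + 1" unfolding b_def using k by (auto intro: alpha_bound_ge alpha_bound_le)
    have b0: "b > 0" using bk k by simp
    \<comment> \<open>if neither kind of hyperplane can be divided out, then \<open>k t1 + t2 - E \<le> \<theta> E\<close>\<close>
    define \<theta> where "\<theta> = real k / a + 1 / b - 1"
    have "real k / a + 1 / b \<ge> real k / (real k + 1) + 1 / (real k + 1)"
      using ak bk a0 b0 by (intro add_mono divide_left_mono) auto
    hence \<theta>0: "\<theta> \<ge> 0" unfolding \<theta>_def by (simp flip: add_divide_distrib)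
    \<comment> \<open>the last hypothesis says that the top hyperplane is divided out only once the degree is below \<open>b t\<close>\<close>
    have main: "G = 0"
      if "vars_in {0..Suc N} G" "homogeneous E G"
        and "\<And>w l. w \<in> few_tops k N r \<Longrightarrow> l < k \<Longrightarrow> vanishes t1 (word_point c (w(Suc N := l))) G"
        and "\<And>w. w \<in> few_tops k N (r - 1) \<Longrightarrow> vanishes t2 (word_point c (w(Suc N := k))) G"
        and "real k * real t1 + real t2 - real E > \<theta> * (b * real t)" "t2 \<le> t"
        and "t2 = t \<or> real E < b * real t" for G E t1 t2
      using that
    proof (induction E arbitrary: G t1 t2 rule: less_induct)
      case (less E)
      show "G = 0"
      proof (rule ccontr)
        assume G0: "G \<noteq> 0"
        have "real E < a * real t1 \<or> real E < b * real t2"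
        proof (rule ccontr)
          assume "\<not> ?thesis"
          hence n: "real t1 \<le> real E / a" "real t2 \<le> real E / b" using a0 b0 by (auto simp: field_simps)
          have k1: "real k * real t1 \<le> real k / a * real E"
            using mult_left_mono[OF n(1), of "real k"] by simp
          show False
          proof (cases "real E < b * real t")
            case True
            have "real k * real t1 + real t2 - real E \<le> real k / a * real E + real E / b - real E"
              using k1 n(2) by linarith
            also have "\<dots> = \<theta> * real E" by (simp add: \<theta>_def algebra_simps)
            also have "\<dots> \<le> \<theta> * (b * real t)" using True \<theta>0 by (intro mult_left_mono) auto
            finally show False using less.prems(5) by simp
          next
            case F: False
            hence t2: "t2 = t" using less.prems(7) by blast
            have "(1 - real k / a) * real E \<ge> (1 - real k / a) * (b * real t)"
              using F ak a0 by (intro mult_left_mono) (auto simp: field_simps)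
            hence "real k * real t1 + real t2 - real E \<le> real t - (1 - real k / a) * (b * real t)"
              using k1 t2 by (simp add: algebra_simps)
            also have "\<dots> = \<theta> * (b * real t)" using b0 by (simp add: \<theta>_def field_simps)
            finally show False using less.prems(5) by simp
          qed
        qed
        then consider "real E < b * real t2" | "real E \<ge> b * real t2" "real E < a * real t1" by linarith
        thus False
        proof cases
          case 1
          have t2: "t2 \<ge> 1" using 1 b0 by (cases t2) auto
          have "restrict_hyperplane (Suc N) (c k) G = 0"
          proof (rule restr0[OF less.prems(1,2), where q = "r - 1" and u = t2])
            show "vanishes t2 (word_point c (w(Suc N := k))) G" if "w \<in> few_tops k N (r - 1)" for w
              by (rule less.prems(4)[OF that])
          qed (use 1 in \<open>simp_all add: b_def\<close>)
          then obtain H where H: "1 \<le> E" "vars_in {0..Suc N} H" "homogeneous (E - 1) H" "H \<noteq> 0"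
            and vH: "\<And>v t. v 0 = 1 \<Longrightarrow> vanishes t v G \<Longrightarrow> vanishes (t - 1) v H \<and> (v (Suc N) \<noteq> c k \<longrightarrow> vanishes t v H)"
            using divide_hyperplanes[of "{k}" c "Suc N" G E] less.prems(1,2) G0 by auto
          have "H = 0"
          proof (rule less.IH[of "E - 1" H t1 "t2 - 1"])
            show "vanishes t1 (word_point c (w(Suc N := l))) H" if "w \<in> few_tops k N r" "l < k" for w l
            proof -
              have "c l \<noteq> c k" using that(2) c_eq[of l k] by simp
              thus ?thesis using vH[OF point(2) less.prems(3)[OF that]] unfolding point by blast
            qed
            show "vanishes (t2 - 1) (word_point c (w(Suc N := k))) H" if "w \<in> few_tops k N (r - 1)" for w
              using vH[OF point(2) less.prems(4)[OF that]] by blast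
            show "\<theta> * (b * real t) < real k * real t1 + real (t2 - 1) - real (E - 1)"
              using less.prems(5) t2 H(1) by (simp add: of_nat_diff)
            have "b * real t2 \<le> b * real t" using less.prems(6) b0 by (intro mult_left_mono) auto
            moreover have "real (E - 1) \<le> real E" by simp
            ultimately have "real (E - 1) < b * real t" using 1 by linarith
            thus "t2 - 1 = t \<or> real (E - 1) < b * real t" ..
          qed (use H less.prems(6) in auto)
          thus False using H(4) by simp
        next
          case 2
          have t1: "t1 \<ge> 1" using 2 a0 by (cases t1) auto
          have "restrict_hyperplane (Suc N) (c l) G = 0" if l: "l \<in> {0..<k}" for l
          proof (rule restr0[OF less.prems(1,2), where q = r and u = t1])
            show "vanishes t1 (word_point c (w(Suc N := l))) G" if "w \<in> few_tops k N r" for w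
              by (rule less.prems(3)[OF that]) (use l in simp)
          qed (use 2(2) l in \<open>simp_all add: a_def\<close>)
          moreover have "inj_on c {0..<k}" using c by (rule inj_on_subset) auto
          ultimately obtain H where H: "k \<le> E" "vars_in {0..Suc N} H" "homogeneous (E - k) H" "H \<noteq> 0"
            and vH: "\<And>v t. v 0 = 1 \<Longrightarrow> vanishes t v G \<Longrightarrow> vanishes (t - 1) v H \<and> ((\<forall>l\<in>{0..<k}. v (Suc N) \<noteq> c l) \<longrightarrow> vanishes t v H)"
            using divide_hyperplanes[of "{0..<k}" c "Suc N" G E] less.prems(1,2) G0 by auto
          have "H = 0"
          proof (rule less.IH[of "E - k" H "t1 - 1" t2])
            show "vanishes (t1 - 1) (word_point c (w(Suc N := l))) H" if "w \<in> few_tops k N r" "l < k" for w l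
              using vH[OF point(2) less.prems(3)[OF that]] by blast
            show "vanishes t2 (word_point c (w(Suc N := k))) H" if "w \<in> few_tops k N (r - 1)" for w
            proof -
              have "\<forall>l\<in>{0..<k}. c k \<noteq> c l" using c_eq[of k] by auto
              thus ?thesis using vH[OF point(2) less.prems(4)[OF that]] unfolding point by blast
            qed
            show "\<theta> * (b * real t) < real k * real (t1 - 1) + real t2 - real (E - k)"
              using less.prems(5) t1 H(1) by (simp add: of_nat_diff algebra_simps)
            show "t2 = t \<or> real (E - k) < b * real t" using less.prems(7) by auto
          qed (use H k less.prems(6) in auto)
          thus False using H(4) by simp
        qed
      qed
    qed
    show ?thesis
    proof (rule ccontr)
      assume n: "\<not> ?thesis"
      have "F = 0"
      proof (rule main[of F D t t, OF Suc.prems(1,2)])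
        show "vanishes t (word_point c (w(Suc N := l))) F" if "w \<in> few_tops k N r" "l < k" for w l
          by (rule Suc.prems(4)[OF few_tops_extend_less[OF that]])
        show "vanishes t (word_point c (w(Suc N := k))) F" if "w \<in> few_tops k N (r - 1)" for w
          by (rule Suc.prems(4)[OF few_tops_extend_top[OF that r]])
        have "real D < (real k + (1 - real k / a) * b) * real t"
          using n mult_right_mono[OF alpha_bound_recursion[OF k r, of N], of "real t"] by (simp add: a_def b_def)
        also have "\<dots> = real k * real t + real t - \<theta> * (b * real t)"
          using b0 by (simp add: \<theta>_def field_simps)
        finally show "\<theta> * (b * real t) < real k * real t + real t - real D" by simp
      qed auto
      thus False using Suc.prems(3) by simp
    qed
  qed
qed

section \<open>Counting conditions\<close>

definition monomials :: "nat \<Rightarrow> nat \<Rightarrow> (nat \<Rightarrow>\<^sub>0 nat) set" where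
  "monomials N d = {\<mu>. keys \<mu> \<subseteq> {0..N} \<and> mdeg \<mu> = d}"

lemma bij_betw_monomials:
  "bij_betw (\<lambda>\<mu>. map (lookup \<mu>) [0..<Suc N]) (monomials N d) {l. length l = Suc N \<and> sum_list l = d}"
proof (rule bij_betw_imageI)
  show "inj_on (\<lambda>\<mu>. map (lookup \<mu>) [0..<Suc N]) (monomials N d)"
  proof (rule inj_onI)
    fix \<mu> \<nu> assume m: "\<mu> \<in> monomials N d" "\<nu> \<in> monomials N d"
      and e: "map (lookup \<mu>) [0..<Suc N] = map (lookup \<nu>) [0..<Suc N]"
    show "\<mu> = \<nu>"
    proof (rule poly_mapping_eqI)
      fix i show "lookup \<mu> i = lookup \<nu> i"
      proof (cases "i < Suc N")
        case True thus ?thesis using e by (auto simp del: upt_Suc)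
      next
        case False
        hence "i \<notin> keys \<mu>" "i \<notin> keys \<nu>" using m by (auto simp: monomials_def)
        thus ?thesis by (simp add: in_keys_iff)
      qed
    qed
  qed
  have deg: "sum_list (map (lookup \<mu>) [0..<Suc N]) = mdeg \<mu>" if "keys \<mu> \<subseteq> {0..N}" for \<mu> :: "nat \<Rightarrow>\<^sub>0 nat"
  proof -
    have "{0..N} = set [0..<Suc N]" by auto
    thus ?thesis using mdeg_eq_sum[of "{0..N}" \<mu>] that by (simp add: interv_sum_list_conv_sum_set_nat del: upt_Suc)
  qed
  show "(\<lambda>\<mu>. map (lookup \<mu>) [0..<Suc N]) ` monomials N d = {l. length l = Suc N \<and> sum_list l = d}"
  proof (intro equalityI subsetI)
    fix l :: "nat list" assume "l \<in> {l. length l = Suc N \<and> sum_list l = d}"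
    hence l: "length l = Suc N" "sum_list l = d" by auto
    define \<mu> where "\<mu> = Poly_Mapping.nth l"
    have lm: "lookup \<mu> i = nth_default 0 l i" for i by (simp add: \<mu>_def)
    have m: "map (lookup \<mu>) [0..<Suc N] = l"
      by (rule nth_equalityI) (simp_all add: l lm nth_default_nth del: upt_Suc)
    have "keys \<mu> \<subseteq> {0..N}"
    proof
      fix i assume "i \<in> keys \<mu>"
      hence "nth_default 0 l i \<noteq> 0" by (simp add: in_keys_iff lm)
      hence "i < length l" by (metis nth_default_beyond not_less)
      thus "i \<in> {0..N}" using l by simp
    qed
    moreover from this have "mdeg \<mu> = d" using deg[of \<mu>] l unfolding m by simp
    ultimately show "l \<in> (\<lambda>\<mu>. map (lookup \<mu>) [0..<Suc N]) ` monomials N d"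
      using m by (auto simp: monomials_def intro!: image_eqI[of _ _ \<mu>])
  qed (use deg in \<open>auto simp: monomials_def simp del: upt_Suc\<close>)
qed

lemma card_monomials: "card (monomials N d) = (d + N choose N)"
proof -
  have "card (monomials N d) = (d + Suc N - 1 choose d)"
    using bij_betw_same_card[OF bij_betw_monomials] card_length_sum_list[of "Suc N" d] by metis
  thus ?thesis using binomial_symmetric[of d "d + N"] by simp
qed

lemma finite_monomials: "finite (monomials N d)"
  by (rule card_ge_0_finite) (simp add: card_monomials)

lemma lookup_Const_mult: "lookup (Const c * g) \<nu> = c * lookup g \<nu>" for g :: "('v, 'k::comm_ring_1) mpoly"
  by (simp add: lookup_map_zero flip: mult_map_scale_conv_mult)

lemma lookup_monomial_mult: "lookup (single \<mu> 1 * g) (\<mu> + \<nu>) = lookup g \<nu>"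
  for g :: "('v, 'k::comm_ring_1) mpoly"
proof -
  have "single \<mu> 1 * g = (\<Sum>\<kappa>\<in>keys g. single (\<mu> + \<kappa>) (lookup g \<kappa>))"
    by (subst mpoly_eq_sum_single[of g]) (simp add: sum_distrib_left mult_single)
  thus ?thesis by (simp add: lookup_sum lookup_single when_def in_keys_iff)
qed

lemma form_of_coeffs:
  fixes x :: "(nat \<Rightarrow>\<^sub>0 nat) \<Rightarrow> 'k::comm_ring_1" and N d :: nat
  defines "f \<equiv> (\<Sum>\<mu>\<in>monomials N d. single \<mu> (x \<mu>))"
  shows "vars_in {0..N} f" "homogeneous d f" "\<mu> \<in> monomials N d \<Longrightarrow> lookup f \<mu> = x \<mu>"
proof -
  show "vars_in {0..N} f" unfolding f_def
    by (intro vars_in_sum vars_in_single) (simp add: monomials_def)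
  show "homogeneous d f" unfolding f_def
    by (intro homogeneous_sum homogeneous_single) (simp add: monomials_def)
  show "lookup f \<mu> = x \<mu>" if "\<mu> \<in> monomials N d"
    unfolding f_def lookup_sum lookup_single when_def using that finite_monomials by simp
qed

lemma form_eq_sum_monomials:
  fixes G :: "(nat, 'k::comm_ring_1) mpoly"
  assumes "vars_in {0..N} G" "homogeneous e G"
  shows "G = (\<Sum>\<mu>\<in>monomials N e. single \<mu> (lookup G \<mu>))"
proof -
  have "keys G \<subseteq> monomials N e" using assms by (auto simp: monomials_def vars_in_def homogeneous_iff)
  hence "(\<Sum>\<mu>\<in>keys G. single \<mu> (lookup G \<mu>)) = (\<Sum>\<mu>\<in>monomials N e. single \<mu> (lookup G \<mu>))"
    using finite_monomials by (intro sum.mono_neutral_left) (auto simp: in_keys_iff)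
  thus ?thesis by (simp flip: mpoly_eq_sum_single)
qed

lemma lookup_rhom_sum_monomials:
  fixes F :: "(nat, 'k::comm_ring_1) mpoly \<Rightarrow> (nat, 'k) mpoly"
  assumes "rhom F" "\<And>c. F (Const c) = Const c"
  shows "lookup (F (\<Sum>\<mu>\<in>J. single \<mu> (x \<mu>))) \<nu> = (\<Sum>\<mu>\<in>J. x \<mu> * lookup (F (single \<mu> 1)) \<nu>)"
proof -
  have "F (single \<mu> c) = Const c * F (single \<mu> 1)" for \<mu> c
  proof -
    have "single \<mu> c = Const c * single \<mu> 1" by (simp add: mult_single)
    thus ?thesis using rhomD(4)[OF assms(1)] assms(2) by metis
  qed
  hence "F (\<Sum>\<mu>\<in>J. single \<mu> (x \<mu>)) = (\<Sum>\<mu>\<in>J. Const (x \<mu>) * F (single \<mu> 1))"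
    unfolding rhom_sum[OF assms(1)] by (intro sum.cong refl)
  thus ?thesis by (simp add: lookup_sum lookup_Const_mult)
qed

text \<open>The linear change of coordinates moving \<open>v\<close> to \<open>(1, 0, \<dots>, 0)\<close>, where the order of a
  monomial is its degree in the variables other than \<open>x\<^sub>0\<close>.\<close>
definition move_point :: "(nat \<Rightarrow> 'k::comm_ring_1) \<Rightarrow> (nat, 'k) mpoly \<Rightarrow> (nat, 'k) mpoly" where
  "move_point v = substitute Const (\<lambda>i. if i = 0 then Var 0 else Var i + Const (v i) * Var 0)"

lemma rhom_move_point: "rhom (move_point v)"
  unfolding move_point_def by (intro rhom_substitute rhom_Const)

lemma move_point_simps [simp]:
  "move_point v (Const c) = Const c"
  "move_point v (Var i) = (if i = 0 then Var 0 else Var i + Const (v i) * Var 0)"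
  unfolding move_point_def by (simp_all add: substitute_Const substitute_Var rhom_Const)

lemma move_point_inverse: "move_point (\<lambda>i. - v i) (move_point v f) = f"
proof (rule rhom_eqI[of "\<lambda>f. move_point (\<lambda>i. - v i) (move_point v f)" "\<lambda>f. f"])
  fix i
  have "Const (- v i) * Var 0 + Const (v i) * Var 0 = (0 :: (nat, 'a) mpoly)"
    by (simp add: single_uminus)
  thus "move_point (\<lambda>i. - v i) (move_point v (Var i)) = Var i"
    by (simp add: rhomD[OF rhom_move_point] add.assoc)
qed (auto intro: rhom_comp rhom_move_point rhom_id)

lemma homogeneous_move_point: "homogeneous d f \<Longrightarrow> homogeneous d (move_point v f)"
  unfolding move_point_def
  by (intro homogeneous_linear_substitute) (simp_all add: homogeneous_add homogeneous_Var[simplified] homogeneous_Const_Var[simplified])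

lemma vars_in_move_point: "vars_in {0..N} f \<Longrightarrow> vars_in {0..N} (move_point v f)"
  by (induction rule: vars_in_induct)
    (simp_all add: rhomD[OF rhom_move_point] vars_in_add vars_in_mult vars_in_Var)

text \<open>Changing the exponent of \<open>x\<^sub>0\<close> by \<open>m - 1 - d\<close> turns these monomials into monomials of
  degree \<open>m - 1\<close>.\<close>
lemma card_low_monomials:
  assumes m: "m \<ge> 1"
  shows "card {\<nu> \<in> monomials N d. d < lookup \<nu> 0 + m} \<le> (m + N - 1 choose N)"
proof -
  define E where "E = {\<nu> \<in> monomials N d. d < lookup \<nu> 0 + m}"
  define g where "g \<nu> = Poly_Mapping.update 0 (lookup \<nu> 0 + m - 1 - d) \<nu>" for \<nu> :: "nat \<Rightarrow>\<^sub>0 nat"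
  have lg: "lookup (g \<nu>) i = (if i = 0 then lookup \<nu> 0 + m - 1 - d else lookup \<nu> i)" for \<nu> i
    by (simp add: g_def lookup_update)
  have "inj_on g E"
  proof (rule inj_onI)
    fix \<nu> \<nu>' assume e: "\<nu> \<in> E" "\<nu>' \<in> E" "g \<nu> = g \<nu>'"
    show "\<nu> = \<nu>'"
    proof (rule poly_mapping_eqI)
      fix i
      have "lookup (g \<nu>) i = lookup (g \<nu>') i" using e(3) by simp
      thus "lookup \<nu> i = lookup \<nu>' i" using e(1,2) by (cases "i = 0") (auto simp: lg E_def)
    qed
  qed
  moreover have "g ` E \<subseteq> monomials N (m - 1)"
  proof
    fix x assume "x \<in> g ` E"
    then obtain \<nu> where \<nu>: "\<nu> \<in> E" "x = g \<nu>" by auto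
    have k: "keys (g \<nu>) \<subseteq> {0..N}"
    proof
      fix i assume "i \<in> keys (g \<nu>)"
      hence "i = 0 \<or> i \<in> keys \<nu>" by (auto simp: in_keys_iff lg split: if_splits)
      thus "i \<in> {0..N}" using \<nu>(1) by (auto simp: E_def monomials_def)
    qed
    have s: "(\<Sum>i\<in>{0..N}. h i) = h 0 + (\<Sum>i\<in>{1..N}. h i)" for h :: "nat \<Rightarrow> nat"
      by (simp add: sum.atLeast_Suc_atMost)
    have "mdeg (g \<nu>) = (lookup \<nu> 0 + m - 1 - d) + (\<Sum>i\<in>{1..N}. lookup (g \<nu>) i)"
      using mdeg_eq_sum[OF _ k] s[of "lookup (g \<nu>)"] by (simp add: lg)
    moreover have "(\<Sum>i\<in>{1..N}. lookup (g \<nu>) i) = (\<Sum>i\<in>{1..N}. lookup \<nu> i)" by (intro sum.cong) (auto simp: lg)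
    moreover have "d = lookup \<nu> 0 + (\<Sum>i\<in>{1..N}. lookup \<nu> i)"
      using \<nu>(1) mdeg_eq_sum[of "{0..N}" \<nu>] s[of "lookup \<nu>"] by (simp add: E_def monomials_def)
    moreover have "d < lookup \<nu> 0 + m" using \<nu>(1) by (simp add: E_def)
    ultimately have "mdeg (g \<nu>) = m - 1" by linarith
    thus "x \<in> monomials N (m - 1)" using k \<nu>(2) by (simp add: monomials_def)
  qed
  ultimately have "card E \<le> card (monomials N (m - 1))" by (rule card_inj_on_le[OF _ _ finite_monomials])
  thus ?thesis using m by (simp add: card_monomials E_def)
qed

text \<open>In coordinates where \<open>v\<close> is \<open>(1, 0, \<dots>, 0)\<close>, membership in the \<open>m\<close>-th local power only
  requires the coefficients at the monomials of \<open>card_low_monomials\<close> to be zero.\<close>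
lemma (in projective_points) symbolic_power_degree_bound:
  assumes m: "m \<ge> 1" and cnt: "card W * (m + N - 1 choose N) < (d + N choose N)"
  shows "\<exists>f\<in>symbolic_power (ring_on coord_ring) ideal_of_points m. f \<noteq> 0 \<and> homogeneous d f"
proof -
  define E where "E = {\<nu> \<in> monomials N d. d < lookup \<nu> 0 + m}"
  have finE: "finite E" using finite_monomials by (simp add: E_def)
  have "card (W \<times> E) \<le> card W * (m + N - 1 choose N)"
    unfolding card_cartesian_product E_def by (intro mult_le_mono2 card_low_monomials[OF m])
  hence "card (W \<times> E) < card (monomials N d)" using cnt by (simp add: card_monomials)
  then obtain x where x: "\<exists>\<mu>\<in>monomials N d. x \<mu> \<noteq> 0"
    "\<forall>p\<in>W \<times> E. (\<Sum>\<mu>\<in>monomials N d. lookup (move_point (fst p) (single \<mu> 1)) (snd p) * x \<mu>) = 0"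
    using underdetermined_system[of "W \<times> E" "monomials N d" "\<lambda>p \<mu>. lookup (move_point (fst p) (single \<mu> 1)) (snd p)"]
      finite_W finE finite_monomials by auto
  define f where "f = (\<Sum>\<mu>\<in>monomials N d. single \<mu> (x \<mu>))"
  note fc = form_of_coeffs[where x = x and N = N and d = d, folded f_def]
  have f0: "f \<noteq> 0" using x(1) fc(3) by force
  have fS: "f \<in> coord_ring" using fc(1) by (simp add: coord_ring_def)
  have "f \<in> local_power v m" if v: "v \<in> W" for v
  proof -
    define g where "g = move_point v f"
    have g: "vars_in {0..N} g" "homogeneous d g"
      unfolding g_def using fc by (simp_all add: vars_in_move_point homogeneous_move_point)
    have gE: "lookup g \<nu> = 0" if "\<nu> \<in> E" for \<nu>
      unfolding g_def f_def using x(2) v that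
      by (subst lookup_rhom_sum_monomials) (auto simp: rhom_move_point mult.commute)
    have f_eq: "f = (\<Sum>\<nu>\<in>keys g. move_point (\<lambda>i. - v i) (single \<nu> (lookup g \<nu>)))"
      unfolding rhom_sum[OF rhom_move_point, symmetric] mpoly_eq_sum_single[symmetric] g_def
      by (rule move_point_inverse[symmetric])
    have "move_point (\<lambda>i. - v i) (single \<nu> (lookup g \<nu>)) \<in> local_power v m" if \<nu>: "\<nu> \<in> keys g" for \<nu>
    proof -
      have \<nu>m: "keys \<nu> \<subseteq> {0..N}" "mdeg \<nu> = d" using \<nu> g by (auto simp: vars_in_def homogeneous_iff)
      have nE: "lookup \<nu> 0 + m \<le> d"
      proof (rule ccontr)
        assume "\<not> ?thesis"
        hence "\<nu> \<in> E" using \<nu>m by (simp add: E_def monomials_def)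
        thus False using gE[of \<nu>] \<nu> by (simp add: in_keys_iff)
      qed
      define n where "n i = (if i = 0 then 0 else lookup \<nu> i)" for i
      have fac: "(if i = 0 then Var 0 else Var i + Const (- v i) * Var 0) ^ lookup \<nu> i \<in> local_power v (n i)"
        if i: "i \<in> keys \<nu>" for i
      proof (cases "i = 0")
        case True
        thus ?thesis by (auto simp: n_def coord_ring_def intro!: local_power_0 vars_in_power vars_in_Var)
      next
        case False
        have "linear_form v i ^ lookup \<nu> i \<in> local_power v (lookup \<nu> i)"
          using i \<nu>m by (intro power_local_power linear_form_local_power v) auto
        thus ?thesis using False by (simp add: n_def linear_form_def single_uminus)
      qed
      have "move_point (\<lambda>i. - v i) (single \<nu> (lookup g \<nu>)) = Const (lookup g \<nu>) *
          (\<Prod>i\<in>keys \<nu>. (if i = 0 then Var 0 else Var i + Const (- v i) * Var 0) ^ lookup \<nu> i)"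
        unfolding move_point_def by (simp add: substitute_single monom_val_def)
      also have "\<dots> \<in> local_power v (sum n (keys \<nu>))"
        by (intro local_power_mult_left prod_local_power fac) (simp_all add: coord_ring_def)
      finally have "move_point (\<lambda>i. - v i) (single \<nu> (lookup g \<nu>)) \<in> local_power v (sum n (keys \<nu>))" .
      moreover have "m \<le> sum n (keys \<nu>)"
      proof -
        have "d = (\<Sum>i\<in>keys \<nu>. lookup \<nu> i)" using \<nu>m by (simp add: mdeg_def)
        also have "\<dots> = (\<Sum>i\<in>keys \<nu>. n i + (if i = 0 then lookup \<nu> 0 else 0))" by (intro sum.cong) (auto simp: n_def)
        also have "\<dots> \<le> sum n (keys \<nu>) + lookup \<nu> 0" by (simp add: sum.distrib)
        finally show ?thesis using nE by simp
      qed
      ultimately show ?thesis by (rule local_power_antimono[rotated])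
    qed
    thus ?thesis by (subst f_eq) (intro local_power_sum finite_keys)
  qed
  hence "f \<in> symbolic_power (ring_on coord_ring) ideal_of_points m" using fS by (simp add: symbolic_power_iff)
  thus ?thesis using f0 fc(2) by blast
qed

section \<open>Subadditive sequences\<close>

text \<open>Fekete's lemma. The Waldschmidt constant being a \<open>lim\<close>, a lower bound for it requires
  convergence.\<close>
lemma subadditive_convergent:
  fixes a :: "nat \<Rightarrow> nat"
  assumes sub: "\<And>t u. a (t + u) \<le> a t + a u"
  shows "convergent (\<lambda>t. real (a t) / real t)"
proof -
  define R where "R = (\<lambda>t. real (a t) / real t) ` {1..}"
  define L where "L = Inf R"
  have bdd: "bdd_below R" unfolding R_def by (intro bdd_belowI[of _ 0]) auto
  have ne: "R \<noteq> {}" unfolding R_def by auto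
  have low: "L \<le> real (a t) / real t" if "t \<ge> 1" for t
    unfolding L_def using bdd that by (intro cInf_lower) (auto simp: R_def)
  have mult: "a (q * t) \<le> q * a t + a 0" for q t
  proof (induction q)
    case (Suc q)
    thus ?case using sub[of t "q * t"] by simp
  qed simp
  have "(\<lambda>t. real (a t) / real t) \<longlonglongrightarrow> L"
  proof (rule LIMSEQ_I)
    fix e :: real assume e: "e > 0"
    have "\<exists>x\<in>R. x < L + e / 2" using cInf_lessD[OF ne, of "L + e / 2"] e by (auto simp: L_def)
    then obtain t0 where t0: "t0 \<ge> 1" "real (a t0) / real t0 < L + e / 2" by (auto simp: R_def)
    define C where "C = a 0 + Max (a ` {..t0})"
    have key: "real (a t) / real t \<le> real (a t0) / real t0 + real C / real t" if t: "t \<ge> 1" for t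
    proof -
      have "a t \<le> a ((t div t0) * t0) + a (t mod t0)" using sub[of "(t div t0) * t0" "t mod t0"] by simp
      also have "a (t mod t0) \<le> Max (a ` {..t0})" using t0 by (intro Max_ge) (auto intro!: imageI less_imp_le)
      finally have "a t \<le> (t div t0) * a t0 + C" using mult[of "t div t0" t0] by (simp add: C_def)
      hence "real (a t) \<le> real (t div t0) * real (a t0) + real C" by (simp flip: of_nat_mult of_nat_add)
      also have "real (t div t0) \<le> real t / real t0"
      proof -
        have "real (t div t0 * t0) \<le> real t" by (simp only: of_nat_le_iff div_times_less_eq_dividend)
        thus ?thesis using t0 by (simp add: field_simps)
      qed
      finally have "real (a t) \<le> real t / real t0 * real (a t0) + real C" by (simp add: mult_right_mono)
      hence "real (a t) / real t \<le> (real t / real t0 * real (a t0) + real C) / real t" using t by (intro divide_right_mono) auto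
      also have "\<dots> = real (a t0) / real t0 + real C / real t" using t by (simp add: field_simps)
      finally show ?thesis .
    qed
    obtain n where n: "real n > 2 * real C / e" using reals_Archimedean2 by blast
    show "\<exists>no. \<forall>t\<ge>no. norm (real (a t) / real t - L) < e"
    proof (intro exI[of _ "Suc n"] allI impI)
      fix t assume t: "t \<ge> Suc n"
      have "2 * real C / e < real t" using n t by linarith
      hence "real C / real t < e / 2" using e t by (simp add: field_simps)
      moreover have "t \<ge> 1" using t by simp
      note key[OF this] low[OF this]
      ultimately show "norm (real (a t) / real t - L) < e" using t0(2) unfolding real_norm_def by linarith
    qed
  qed
  thus ?thesis by (rule convergentI)
qed

section \<open>From one order of vanishing to all\<close>

text \<open>Apply the descent to \<open>F\<^sup>j\<close>, where \<open>j T\<close> is just above \<open>p\<^sup>l (t + N + 1)\<close>. The result has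
  degree at most \<open>j D / p\<^sup>l\<close> and order \<open>t\<close> modulo the maximal ideal, so this degree exceeds \<open>e\<close>.
  For \<open>l\<close> tending to infinity \<open>j / p\<^sup>l\<close> tends to \<open>(t + N + 1) / T\<close>.\<close>
lemma degree_lower_bound:
  fixes F :: "(nat, 'k::alg_closed_field) mpoly"
  assumes A: "valuation_ring A" and p: "prime p" "of_nat p \<in> max_ideal A"
    and u: "\<And>i j. i \<in> J \<Longrightarrow> u i j \<in> A"
    and cert: "\<And>G. vars_in {0..N} G \<Longrightarrow> homogeneous e G \<Longrightarrow> coeffs_in A G \<Longrightarrow>
      (\<And>i. i \<in> J \<Longrightarrow> vanishes_mod A t (u i) G) \<Longrightarrow> coeffs_in (max_ideal A) G"
    and F: "vars_in {0..N} F" "homogeneous D F" "F \<noteq> 0" "\<And>i. i \<in> J \<Longrightarrow> vanishes T (u i) F"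
  shows "e * T \<le> D * (t + N + 1)"
proof (cases "T = 0")
  case False
  have As: "subring_of A" by (rule valuation_ring_subring[OF A])
  have main: "p ^ l * (e + 1) \<le> j * D" if jT: "p ^ l * (t + N + 1) \<le> j * T" for l j
  proof (rule ccontr)
    assume n: "\<not> ?thesis"
    have Fj: "F ^ j \<noteq> 0" using F(3) by simp
    then obtain \<mu>0 where \<mu>0: "lookup (F ^ j) \<mu>0 \<noteq> 0" by (metis lookup_zero poly_mapping_eqI)
    obtain c where c: "c \<noteq> 0" "\<forall>x\<in>lookup (F ^ j) ` keys (F ^ j). c * x \<in> A"
      "\<exists>x\<in>lookup (F ^ j) ` keys (F ^ j). c * x = 1"
      using valuation_ring_normalize[OF A, of "lookup (F ^ j) ` keys (F ^ j)" "lookup (F ^ j) \<mu>0"] \<mu>0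
      by (auto simp: in_keys_iff)
    define H where "H = Const c * F ^ j"
    have lH: "lookup H \<mu> = c * lookup (F ^ j) \<mu>" for \<mu> by (simp add: H_def lookup_Const_mult)
    have H1: "coeffs_in A H"
      unfolding coeffs_in_def lH using c(2) subring_of_zero[OF As]
      by (metis image_eqI in_keys_iff mult_zero_right)
    have H2: "\<not> coeffs_in (max_ideal A) H"
      using c(3) max_ideal_one[OF A] unfolding coeffs_in_def lH by (metis imageE)
    have "homogeneous (0 + j * D) H"
      unfolding H_def by (intro homogeneous_mult homogeneous_Const homogeneous_power F(2))
    moreover have "vars_in {0..N} H"
      unfolding H_def by (intro vars_in_mult vars_in_Const vars_in_power F(1))
    ultimately have H3: "vars_in {0..N} H" "homogeneous (j * D) H" by simp_all
    obtain G d where G: "vars_in {0..N} G" "homogeneous d G" "p ^ l * d \<le> j * D" "coeffs_in A G"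
        "\<not> coeffs_in (max_ideal A) G"
      and vG: "\<And>v T t. \<forall>i. v i \<in> A \<Longrightarrow> vanishes_mod A T v H \<Longrightarrow> p ^ l * (t + card {0..N}) \<le> T + card {0..N} \<Longrightarrow> vanishes_mod A t v G"
      using frobenius_descent_power[OF A p finite_atLeastAtMost H3(1,2) H1 H2, of l] by blast
    have "d \<le> e"
    proof (rule ccontr)
      assume "\<not> d \<le> e"
      hence "p ^ l * (e + 1) \<le> p ^ l * d" by (intro mult_le_mono2) simp
      thus False using G(3) n by linarith
    qed
    define \<kappa> where "\<kappa> = single (0::nat) (e - d)"
    \<comment> \<open>raises the degree to \<open>e\<close> without lowering any order\<close>
    define G' where "G' = single \<kappa> 1 * G"
    have "vanishes_mod A t (u i) G'" if i: "i \<in> J" for i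
    proof -
      have "vanishes (j * T) (u i) H" unfolding H_def by (intro vanishes_mult_left vanishes_power F(4) i)
      hence v: "vanishes_mod A t (u i) G"
        using jT by (intro vG vanishes_imp_vanishes_mod[OF A]) (auto simp: u[OF i])
      have sA: "coeffs_in A (shift (u i) (single \<kappa> 1))"
        by (intro coeffs_in_shift[OF A] coeffs_in_single[OF A] u[OF i] subring_of_one[OF As])
      show ?thesis unfolding vanishes_mod_def[OF A]
      proof (intro allI impI)
        fix \<alpha> :: "nat \<Rightarrow>\<^sub>0 nat" assume \<alpha>: "mdeg \<alpha> < t"
        show "lookup (shift (u i) G') \<alpha> \<in> max_ideal A"
          unfolding G'_def rhomD(4)[OF rhom_shift] lookup_mult_eq_sum
        proof (intro max_ideal_sum[OF A])
          fix \<mu> \<nu>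
          show "(lookup (shift (u i) (single \<kappa> 1)) \<mu> * lookup (shift (u i) G) \<nu> when \<mu> + \<nu> = \<alpha>) \<in> max_ideal A"
          proof (cases "\<mu> + \<nu> = \<alpha>")
            case True
            hence "mdeg \<nu> < t" using \<alpha> mdeg_add[of \<mu> \<nu>] by simp
            hence "lookup (shift (u i) G) \<nu> \<in> max_ideal A" using v by (simp add: vanishes_mod_def[OF A])
            thus ?thesis using max_ideal_mult(2)[OF A _ coeffs_inD[OF sA]] True by simp
          qed (simp add: max_ideal_zero[OF A])
        qed
      qed
    qed
    moreover have "homogeneous (e - d + d) G'"
      unfolding G'_def by (intro homogeneous_mult homogeneous_single G(2)) (simp add: \<kappa>_def)
    hence "homogeneous e G'" using \<open>d \<le> e\<close> by simp
    moreover have "vars_in {0..N} G'"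
      unfolding G'_def by (intro vars_in_mult vars_in_single G(1)) (simp add: \<kappa>_def)
    moreover have "coeffs_in A G'"
      unfolding G'_def by (intro coeffs_in_mult[OF A] coeffs_in_single[OF A] subring_of_one[OF As] G(4))
    ultimately have "coeffs_in (max_ideal A) G'" using cert by blast
    hence "lookup G \<mu> \<in> max_ideal A" for \<mu>
      using coeffs_inD[of "max_ideal A" G' "\<kappa> + \<mu>"] by (simp add: G'_def lookup_monomial_mult)
    thus False using G(5) by (simp add: coeffs_in_def)
  qed
  show ?thesis
  proof (rule ccontr)
    assume n: "\<not> ?thesis"
    \<comment> \<open>\<open>q\<close> only has to exceed the rounding error \<open>D * T\<close>\<close>
    define q where "q = p ^ (D * T)"
    have "2 \<le> p" using p(1) prime_ge_2_nat by blast
    hence q: "D * T < q" unfolding q_def using less_exp[of "D * T"] power_mono[of 2 p "D * T"] by linarith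
    define j where "j = q * (t + N + 1) div T + 1"
    have jT: "j * T = q * (t + N + 1) div T * T + T" unfolding j_def by (simp only: add_mult_distrib mult_1)
    have j1: "q * (t + N + 1) \<le> j * T"
      unfolding jT using False div_mult_mod_eq[of "q * (t + N + 1)" T] mod_less_divisor[of T "q * (t + N + 1)"]
      by linarith
    have j2: "j * T \<le> q * (t + N + 1) + T"
      unfolding jT by (intro add_right_mono div_times_less_eq_dividend)
    have "q * (e + 1) \<le> j * D" using main[of "D * T" j] j1 by (simp add: q_def)
    hence "q * (e + 1) * T \<le> j * D * T" by (rule mult_le_mono1)
    also have "\<dots> = j * T * D" by simp
    also have "\<dots> \<le> (q * (t + N + 1) + T) * D" using j2 by (rule mult_le_mono1)
    also have "\<dots> = q * (D * (t + N + 1)) + D * T" by (simp add: algebra_simps)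
    also have "\<dots> < q * (D * (t + N + 1)) + q" using q by simp
    also have "\<dots> = q * (D * (t + N + 1) + 1)" by simp
    also have "\<dots> \<le> q * (e * T)" using n by (intro mult_le_mono2) simp
    also have "\<dots> \<le> q * (e + 1) * T" by (simp add: algebra_simps)
    finally show False by simp
  qed
qed simp

text \<open>The words with a given set of top positions inject into the words over \<open>k\<close> letters on
  the other positions.\<close>
lemma card_few_tops: "finite (few_tops k N r)" "card (few_tops k N r) \<le> few_tops_count k N r"
proof -
  define Z where "Z U = {w \<in> {1..N} \<rightarrow>\<^sub>E {0..k}. {i\<in>{1..N}. w i = k} = U}" for U
  define P where "P = {U. U \<subseteq> {1..N} \<and> card U \<le> r}"
  have finP: "finite P" unfolding P_def by (rule finite_subset[of _ "Pow {1..N}"]) auto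
  have fin: "finite ({1..N} \<rightarrow>\<^sub>E {0..k})" by (intro finite_PiE) auto
  have sub: "few_tops k N r \<subseteq> (\<Union>U\<in>P. Z U)" by (auto simp: few_tops_def Z_def P_def)
  show "finite (few_tops k N r)" using fin by (rule finite_subset[rotated]) (auto simp: few_tops_def)
  have cZ: "card (Z U) \<le> k ^ (N - card U)" if U: "U \<in> P" for U
  proof -
    have "inj_on (\<lambda>w. restrict w ({1..N} - U)) (Z U)"
    proof (rule inj_onI)
      fix w w' assume w: "w \<in> Z U" "w' \<in> Z U" "restrict w ({1..N} - U) = restrict w' ({1..N} - U)"
      show "w = w'"
      proof
        fix i
        consider "i \<in> U" | "i \<in> {1..N} - U" | "i \<notin> {1..N}" using U by (auto simp: P_def)
        thus "w i = w' i"
        proof cases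
          case 1
          have "{i\<in>{1..N}. w i = k} = U" "{i\<in>{1..N}. w' i = k} = U" using w(1,2) by (simp_all add: Z_def)
          hence "w i = k" "w' i = k" using 1 by blast+
          thus ?thesis by simp
        next
          case 2 thus ?thesis using fun_cong[OF w(3), of i] by simp
        next
          case 3 thus ?thesis using w(1,2) by (auto simp: Z_def PiE_iff extensional_def)
        qed
      qed
    qed
    moreover have "(\<lambda>w. restrict w ({1..N} - U)) ` Z U \<subseteq> ({1..N} - U) \<rightarrow>\<^sub>E {0..<k}"
    proof (rule image_subsetI)
      fix w assume w: "w \<in> Z U"
      have "w i \<in> {0..<k}" if i: "i \<in> {1..N} - U" for i
      proof -
        have "w i \<le> k" using w i by (auto simp: Z_def PiE_iff)
        moreover have "w i \<noteq> k" using w i by (auto simp: Z_def)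
        ultimately show ?thesis by simp
      qed
      thus "restrict w ({1..N} - U) \<in> ({1..N} - U) \<rightarrow>\<^sub>E {0..<k}"
        by (subst restrict_PiE_iff) blast
    qed
    ultimately have "card (Z U) \<le> card (({1..N} - U) \<rightarrow>\<^sub>E {0..<k})"
      by (rule card_inj_on_le) (intro finite_PiE, auto)
    also have "\<dots> = k ^ (N - card U)" using U finite_subset[of U "{1..N}"]
      by (simp add: card_PiE P_def card_Diff_subset)
    finally show ?thesis .
  qed
  have "card (few_tops k N r) \<le> card (\<Union>U\<in>P. Z U)"
    using sub finP fin by (intro card_mono finite_UN_I) (auto simp: Z_def)
  also have "\<dots> \<le> (\<Sum>U\<in>P. card (Z U))" by (rule card_UN_le[OF finP])
  also have "\<dots> \<le> (\<Sum>U\<in>P. k ^ (N - card U))" by (intro sum_mono cZ)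
  also have "\<dots> = (\<Sum>i\<in>{..r}. \<Sum>U\<in>{U\<in>P. card U = i}. k ^ (N - card U))"
    by (rule sum.group[symmetric, OF finP finite_atMost]) (auto simp: P_def)
  also have "\<dots> = (\<Sum>i\<in>{..r}. (N choose i) * k ^ (N - i))"
  proof (rule sum.cong[OF refl])
    fix i assume i: "i \<in> {..r}"
    have "{U\<in>P. card U = i} = {U. U \<subseteq> {1..N} \<and> card U = i}" using i by (auto simp: P_def)
    thus "(\<Sum>U\<in>{U\<in>P. card U = i}. k ^ (N - card U)) = (N choose i) * k ^ (N - i)"
      using n_subsets[of "{1..N}" i] by simp
  qed
  finally show "card (few_tops k N r) \<le> few_tops_count k N r" by (simp add: few_tops_count_def)
qed

section \<open>Openness\<close>

text \<open>The vanishing orders concern vectors indexed by all of \<open>nat\<close>; the coordinates beyond \<open>N\<close>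
  are filled with a value that lies in every subring.\<close>
definition row :: "nat \<Rightarrow> (nat \<times> nat \<Rightarrow> 'k::zero) \<Rightarrow> nat \<Rightarrow> nat \<Rightarrow> 'k" where
  "row N a i j = (if j \<le> N then a (i, j) else 0)"

lemma lookup_Var_mult:
  fixes g :: "('v, 'k::comm_ring_1) mpoly"
  shows "lookup (Var j * g) \<alpha> = (if lookup \<alpha> j > 0 then lookup g (\<alpha> - single j 1) else 0)"
proof (cases "lookup \<alpha> j > 0")
  case True
  have "\<alpha> = single j 1 + (\<alpha> - single j 1)"
    by (rule poly_mapping_eqI) (use True in \<open>auto simp: lookup_add lookup_minus lookup_single when_def\<close>)
  thus ?thesis using True lookup_monomial_mult[of "single j 1" g "\<alpha> - single j 1"] by (simp add: Var_def)
next
  case False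
  have "\<alpha> \<notin> keys (Var j * g)"
  proof
    assume "\<alpha> \<in> keys (Var j * g)"
    then obtain \<mu> \<nu> where "\<alpha> = \<mu> + \<nu>" "\<mu> \<in> keys (Var j :: ('v, 'k) mpoly)" using keys_mult[of "Var j" g] by blast
    hence "\<alpha> = single j 1 + \<nu>" by (auto simp: Var_def)
    thus False using False by (simp add: lookup_add)
  qed
  thus ?thesis using False by (simp add: in_keys_iff)
qed

lemma int_poly_fun_shift_monomial:
  fixes \<mu> :: "nat \<Rightarrow>\<^sub>0 nat"
  assumes i: "i \<in> {1..s}" and \<mu>: "keys \<mu> \<subseteq> {0..N}"
  shows "int_poly_fun ({1..s} \<times> {0..N}) (\<lambda>a :: nat \<times> nat \<Rightarrow> 'k::comm_ring_1. lookup (shift (row N a i) (single \<mu> 1)) \<alpha>)"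
proof -
  define P where "P h \<longleftrightarrow> (\<forall>\<alpha>. int_poly_fun ({1..s} \<times> {0..N}) (\<lambda>a :: nat \<times> nat \<Rightarrow> 'k. lookup (h a) \<alpha>))"
    for h :: "(nat \<times> nat \<Rightarrow> 'k) \<Rightarrow> (nat, 'k) mpoly"
  have one: "P (\<lambda>_. 1)"
    unfolding P_def lookup_one when_def by (auto intro: int_poly_fun.one int_poly_fun_zero)
  have step: "P (\<lambda>a. (Var j + Const (row N a i j)) * h a)" if "j \<le> N" "P h" for j h
    unfolding P_def
  proof
    fix \<alpha>
    have "int_poly_fun ({1..s} \<times> {0..N}) (\<lambda>a :: nat \<times> nat \<Rightarrow> 'k. lookup (Var j * h a) \<alpha>)"
      using that(2) by (cases "lookup \<alpha> j > 0") (simp_all add: lookup_Var_mult P_def int_poly_fun_zero)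
    moreover have "int_poly_fun ({1..s} \<times> {0..N}) (\<lambda>a :: nat \<times> nat \<Rightarrow> 'k. a (i, j) * lookup (h a) \<alpha>)"
      using that i by (intro int_poly_fun.mult int_poly_fun.var) (auto simp: P_def)
    ultimately have "int_poly_fun ({1..s} \<times> {0..N}) (\<lambda>a :: nat \<times> nat \<Rightarrow> 'k. lookup (Var j * h a) \<alpha> + a (i, j) * lookup (h a) \<alpha>)"
      by (rule int_poly_fun_add)
    thus "int_poly_fun ({1..s} \<times> {0..N}) (\<lambda>a :: nat \<times> nat \<Rightarrow> 'k. lookup ((Var j + Const (row N a i j)) * h a) \<alpha>)"
      using that(1) by (simp add: distrib_right lookup_add lookup_Const_mult row_def)
  qed
  have pw: "P (\<lambda>a. (Var j + Const (row N a i j)) ^ n * h a)" if "j \<le> N" "P h" for j n h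
  proof (induction n)
    case (Suc n) thus ?case using step[OF that(1) Suc] by (simp add: mult.assoc)
  qed (use that in simp)
  have "P (\<lambda>a. \<Prod>j\<in>J. (Var j + Const (row N a i j)) ^ lookup \<mu> j)" if "finite J" "J \<subseteq> {0..N}" for J
    using that by (induction J rule: finite_induct) (simp_all add: one pw)
  hence "P (\<lambda>a. \<Prod>j\<in>keys \<mu>. (Var j + Const (row N a i j)) ^ lookup \<mu> j)" using \<mu> by simp
  thus ?thesis unfolding shift_def by (simp add: substitute_single monom_val_def P_def)
qed

lemma int_poly_fun_imp_poly:
  "int_poly_fun V f \<Longrightarrow> \<exists>g. vars_in V g \<and> (\<forall>a. poly_eval a g = f a)"
proof (induction rule: int_poly_fun.induct)
  case one show ?case by (intro exI[of _ 1]) (simp add: rhomD[OF rhom_poly_eval])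
next
  case (var i) thus ?case by (intro exI[of _ "Var i"]) (simp add: vars_in_Var)
next
  case (diff f g)
  then obtain F G where "vars_in V F" "\<forall>a. poly_eval a F = f a" "vars_in V G" "\<forall>a. poly_eval a G = g a" by blast
  thus ?case by (intro exI[of _ "F - G"]) (simp add: vars_in_diff rhom_diff[OF rhom_poly_eval])
next
  case (mult f g)
  then obtain F G where "vars_in V F" "\<forall>a. poly_eval a F = f a" "vars_in V G" "\<forall>a. poly_eval a G = g a" by blast
  thus ?case by (intro exI[of _ "F * G"]) (simp add: vars_in_mult rhomD[OF rhom_poly_eval])
qed

lemma zariski_open_nonvanishing:
  assumes "vars_in V g"
  shows "zariski_open V {a \<in> affine_space V. poly_eval a g \<noteq> 0}"
  unfolding zariski_open_def
  by (rule exI[of _ "{g}"]) (use assms in \<open>auto simp: zero_locus_def poly_ring_eq_ring_on\<close>)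

text \<open>By \<open>special_configuration_bound\<close>, the linear system for the coefficients of a form of
  degree \<open>e\<close> that expresses vanishing to order \<open>t\<close> has only the trivial solution at the special
  configuration, and its entries are integer polynomials in the coordinates. The nonzero first
  coordinates are kept for normalizing.\<close>
lemma general_certificate:
  fixes k N r s e t :: nat
  assumes k: "k \<ge> 1" and cnt: "few_tops_count k N r \<le> s" and et: "real e < alpha_bound k N r * real t"
  shows "\<exists>\<Delta> a0. int_poly_fun ({1..s} \<times> {0..N}) \<Delta> \<and> \<Delta> a0 \<noteq> 0 \<and>
    (\<forall>i\<in>{1..s}. a0 (i, 0) \<noteq> 0) \<and> (a0 :: nat \<times> nat \<Rightarrow> 'k::alg_closed_field) \<in> affine_space ({1..s} \<times> {0..N}) \<and>
    (\<forall>A a G. valuation_ring A \<longrightarrow> (\<forall>i\<in>{1..s} \<times> {0..N}. a i \<in> A) \<longrightarrow> \<Delta> a \<notin> max_ideal A \<longrightarrow>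
       vars_in {0..N} G \<longrightarrow> homogeneous e G \<longrightarrow> coeffs_in A G \<longrightarrow>
       (\<forall>i\<in>{1..s}. vanishes_mod A t (row N a i) G) \<longrightarrow> coeffs_in (max_ideal A) G)"
proof -
  obtain c :: "nat \<Rightarrow> 'k" where c: "inj c" using infinite_countable_subset[OF infinite_UNIV_alg_closed[where 'k = 'k]] by blast
  define Z where "Z = few_tops k N r"
  have Z: "finite Z" "card Z \<le> s" using card_few_tops[of k N r] cnt by (auto simp: Z_def)
  obtain z where z: "bij_betw z {1..card Z} Z" using ex_bij_betw_nat_finite_1[OF Z(1)] by blast
  \<comment> \<open>the surplus points are all put at \<open>(1, 0, \<dots>, 0)\<close>\<close>
  define a0 :: "nat \<times> nat \<Rightarrow> 'k" where
    "a0 = restrict (\<lambda>(i, j). if i \<le> card Z then word_point c (z i) j else if j = 0 then 1 else 0) ({1..s} \<times> {0..N})"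
  define C where "C = monomials N e"
  define X where "X = {1..s} \<times> {\<alpha> :: nat \<Rightarrow>\<^sub>0 nat. mdeg \<alpha> < t}"
  define f where "f \<mu> x a = lookup (shift (row N a (fst x)) (single \<mu> 1)) (snd x)"
    for \<mu> :: "nat \<Rightarrow>\<^sub>0 nat" and x :: "nat \<times> (nat \<Rightarrow>\<^sub>0 nat)" and a :: "nat \<times> nat \<Rightarrow> 'k"
  have fi: "int_poly_fun ({1..s} \<times> {0..N}) (f \<mu> x)" if "\<mu> \<in> C" "x \<in> X" for \<mu> x
    unfolding f_def[abs_def] using that by (intro int_poly_fun_shift_monomial) (auto simp: C_def X_def monomials_def)
  have sumf: "(\<Sum>\<mu>\<in>C. w \<mu> * f \<mu> x a) = lookup (shift (row N a (fst x)) (\<Sum>\<mu>\<in>C. single \<mu> (w \<mu>))) (snd x)" for w x a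
    unfolding f_def by (rule lookup_rhom_sum_monomials[symmetric]) (simp_all add: rhom_shift)
  have ind: "\<forall>\<mu>\<in>C. w \<mu> = 0" if w: "\<And>x. x \<in> X \<Longrightarrow> (\<Sum>\<mu>\<in>C. w \<mu> * f \<mu> x a0) = 0" for w
  proof -
    define F where "F = (\<Sum>\<mu>\<in>C. single \<mu> (w \<mu>))"
    note Fc = form_of_coeffs[where N = N and d = e and x = w, folded C_def, folded F_def]
    have "F = 0"
    proof (rule ccontr)
      assume F0: "F \<noteq> 0"
      have "vanishes t (word_point c v) F" if v: "v \<in> few_tops k N r" for v
      proof -
        have "v \<in> z ` {1..card Z}" using v bij_betw_imp_surj_on[OF z] by (simp add: Z_def)
        then obtain i where i: "i \<in> {1..card Z}" "v = z i" by blast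
        have "vanishes t (row N a0 i) F"
          unfolding vanishes_def
        proof (intro allI impI)
          fix \<alpha> :: "nat \<Rightarrow>\<^sub>0 nat" assume "mdeg \<alpha> < t"
          hence "(i, \<alpha>) \<in> X" using i Z by (auto simp: X_def)
          from w[OF this] show "lookup (shift (row N a0 i) F) \<alpha> = 0" by (simp add: sumf F_def)
        qed
        moreover have "row N a0 i j = word_point c v j" if "j \<in> {0..N}" for j
          using that i Z by (auto simp: row_def a0_def)
        ultimately show ?thesis using vanishes_cong[OF Fc(1), of "row N a0 i" "word_point c v" t] by simp
      qed
      hence "alpha_bound k N r * real t \<le> real e"
        using special_configuration_bound[OF k inj_on_subset[OF c subset_UNIV] Fc(1,2) F0] by blast
      thus False using et by simp
    qed
    thus ?thesis using Fc(3) by auto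
  qed
  obtain \<Delta> where \<Delta>: "int_poly_fun ({1..s} \<times> {0..N}) \<Delta>" "\<Delta> a0 \<noteq> 0"
    and cert: "\<And>A a w. valuation_ring A \<Longrightarrow> \<forall>i\<in>{1..s} \<times> {0..N}. a i \<in> A \<Longrightarrow> \<Delta> a \<notin> max_ideal A \<Longrightarrow>
      \<forall>\<mu>\<in>C. w \<mu> \<in> A \<Longrightarrow> \<forall>x\<in>X. (\<Sum>\<mu>\<in>C. w \<mu> * f \<mu> x a) \<in> max_ideal A \<Longrightarrow> \<forall>\<mu>\<in>C. w \<mu> \<in> max_ideal A"
    using independence_certificate[of C X "{1..s} \<times> {0..N}" f a0, OF _ fi ind] finite_monomials[of N e]
    unfolding C_def by blast
  show ?thesis
  proof (rule exI[of _ \<Delta>], rule exI[of _ a0], intro conjI allI impI \<Delta>)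
    show "\<forall>i\<in>{1..s}. a0 (i, 0) \<noteq> 0" by (auto simp: a0_def word_point_def)
    show "a0 \<in> affine_space ({1..s} \<times> {0..N})" by (auto simp: a0_def affine_space_def)
    fix A a G
    assume A: "valuation_ring A" and a: "\<forall>i\<in>{1..s} \<times> {0..N}. a i \<in> A" and d: "\<Delta> a \<notin> max_ideal A"
      and G: "vars_in {0..N} G" "homogeneous e G" "coeffs_in A G"
      and v: "\<forall>i\<in>{1..s}. vanishes_mod A t (row N a i) G"
    have Geq: "(\<Sum>\<mu>\<in>C. single \<mu> (lookup G \<mu>)) = G" unfolding C_def using form_eq_sum_monomials[OF G(1,2)] by simp
    have "\<forall>x\<in>X. (\<Sum>\<mu>\<in>C. lookup G \<mu> * f \<mu> x a) \<in> max_ideal A"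
      unfolding sumf Geq using v by (auto simp: X_def vanishes_mod_def[OF A])
    hence "\<forall>\<mu>\<in>C. lookup G \<mu> \<in> max_ideal A" using cert[OF A a d, of "lookup G"] G(3) by (simp add: coeffs_in_def)
    moreover have "lookup G \<mu> = 0" if "\<mu> \<notin> C" for \<mu>
      using that G(1,2) by (auto simp: C_def monomials_def vars_in_def homogeneous_iff in_keys_iff)
    ultimately show "coeffs_in (max_ideal A) G" unfolding coeffs_in_def using max_ideal_zero[OF A] by metis
  qed
qed

section \<open>The Demailly-type bound for general points\<close>

text \<open>The representative with \<open>x\<^sub>0 = 1\<close> of a point outside the hyperplane \<open>x\<^sub>0 = 0\<close>.\<close>
definition normalized_row :: "nat \<Rightarrow> (nat \<times> nat \<Rightarrow> 'k::field) \<Rightarrow> nat \<Rightarrow> nat \<Rightarrow> 'k" where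
  "normalized_row N a i j = inverse (a (i, 0)) * row N a i j"

lemma projective_points_normalized_rows:
  fixes a :: "nat \<times> nat \<Rightarrow> 'k::alg_closed_field"
  assumes "\<And>i. i \<in> {1..s} \<Longrightarrow> a (i, 0) \<noteq> 0"
  shows "projective_points N (normalized_row N a ` {1..s})"
proof
  fix v w assume v: "v \<in> normalized_row N a ` {1..s}" and w: "w \<in> normalized_row N a ` {1..s}" and ne: "v \<noteq> w"
  obtain j where j: "v j \<noteq> w j" using ne by blast
  have "v j = 0" "w j = 0" if "j > N" using v w that by (auto simp: normalized_row_def row_def)
  moreover have "v 0 = 1" "w 0 = 1" using v w assms by (auto simp: normalized_row_def row_def)
  ultimately have "j \<le> N" "j \<noteq> 0" using j by (metis not_le, metis)
  thus "\<exists>j\<in>{1..N}. v j \<noteq> w j" using j by (intro bexI[of _ j]) auto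
next
  fix v assume "v \<in> normalized_row N a ` {1..s}"
  thus "v 0 = 1" using assms by (auto simp: normalized_row_def row_def)
qed simp

lemma proj_point_normalized_row:
  fixes a :: "nat \<times> nat \<Rightarrow> 'k::field"
  assumes "a (i, 0) \<noteq> 0"
  shows "proj_point N (normalized_row N a i) = proj_point N (\<lambda>j. a (i, j))"
proof -
  have r: "(\<lambda>j\<in>{0..N}. c * normalized_row N a i j) = (\<lambda>j\<in>{0..N}. (c * inverse (a (i, 0))) * a (i, j))" for c
    by (rule ext) (simp add: normalized_row_def row_def restrict_def)
  show ?thesis
  proof (intro equalityI subsetI)
    fix x assume "x \<in> proj_point N (normalized_row N a i)"
    then obtain c where c: "x = (\<lambda>j\<in>{0..N}. c * normalized_row N a i j)" "c \<noteq> 0" by (auto simp: proj_point_def)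
    show "x \<in> proj_point N (\<lambda>j. a (i, j))"
      unfolding proj_point_def using c assms
      by (intro CollectI exI[of _ "c * inverse (a (i, 0))"]) (simp only: r, simp)
  next
    fix x assume "x \<in> proj_point N (\<lambda>j. a (i, j))"
    then obtain c where c: "x = (\<lambda>j\<in>{0..N}. c * a (i, j))" "c \<noteq> 0" by (auto simp: proj_point_def)
    have "c * a (i, 0) * inverse (a (i, 0)) = c" using assms by simp
    hence "x = (\<lambda>j\<in>{0..N}. (c * a (i, 0)) * normalized_row N a i j)" unfolding r c(1) by (simp only:)
    thus "x \<in> proj_point N (normalized_row N a i)"
      unfolding proj_point_def using c(2) assms by (intro CollectI exI[of _ "c * a (i, 0)"]) simp
  qed
qed

lemma (in projective_points) initial_degree_attained:
  assumes "N \<ge> 1"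
  shows "\<exists>f\<in>symbolic_power (ring_on coord_ring) ideal_of_points t. f \<noteq> 0 \<and> homogeneous (initial_degree (symbolic_power (ring_on coord_ring) ideal_of_points t)) f"
  unfolding initial_degree_def by (rule LeastI_ex) (rule symbolic_power_nonzero[OF assms])

lemma initial_degree_le: "f \<in> J \<Longrightarrow> f \<noteq> 0 \<Longrightarrow> homogeneous d f \<Longrightarrow> initial_degree J \<le> d"
  unfolding initial_degree_def by (rule Least_le) blast

lemma (in projective_points) waldschmidt_ge:
  assumes N: "N \<ge> 1" and c: "\<And>t. t \<ge> 1 \<Longrightarrow> c * real t \<le> real (initial_degree (symbolic_power (ring_on coord_ring) ideal_of_points t))"
  shows "waldschmidt (ring_on coord_ring) ideal_of_points \<ge> c"
proof -
  define a where "a t = initial_degree (symbolic_power (ring_on coord_ring) ideal_of_points t)" for t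
  have "a (t + u) \<le> a t + a u" for t u
  proof -
    obtain f g where f: "f \<in> symbolic_power (ring_on coord_ring) ideal_of_points t" "f \<noteq> 0" "homogeneous (a t) f"
      and g: "g \<in> symbolic_power (ring_on coord_ring) ideal_of_points u" "g \<noteq> 0" "homogeneous (a u) g"
      using initial_degree_attained[OF N] unfolding a_def by metis
    show ?thesis unfolding a_def[of "t + u"]
      using f g by (intro initial_degree_le[of "f * g"] symbolic_power_mult homogeneous_mult) auto
  qed
  hence "convergent (\<lambda>t. real (a t) / real t)" by (rule subadditive_convergent)
  hence "(\<lambda>t. real (a t) / real t) \<longlonglongrightarrow> lim (\<lambda>t. real (a t) / real t)" by (simp add: convergent_LIMSEQ_iff)
  moreover have "\<exists>n. \<forall>t\<ge>n. c \<le> real (a t) / real t"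
    using c by (intro exI[of _ 1]) (auto simp: a_def field_simps)
  ultimately have "c \<le> lim (\<lambda>t. real (a t) / real t)" by (rule LIMSEQ_le_const)
  thus ?thesis by (simp add: waldschmidt_def a_def)
qed

text \<open>The gap between \<open>\<theta> t\<close> and \<open>c t\<close> grows beyond \<open>\<theta> K\<close> and the rounding of \<open>e\<close>.\<close>
lemma large_order_exists:
  fixes c \<theta> K :: real
  assumes "\<theta> < c" "0 \<le> \<theta>"
  shows "\<exists>t e :: nat. real e < c * real t \<and> \<theta> * (real t + K) \<le> real e"
proof -
  obtain t :: nat where t: "real t > (1 + \<bar>\<theta> * K\<bar>) / (c - \<theta>)" using reals_Archimedean2 by blast
  hence *: "real t * (c - \<theta>) > 1 + \<bar>\<theta> * K\<bar>" using assms by (simp add: field_simps)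
  define e where "e = nat (\<lceil>c * real t\<rceil> - 1)"
  have "\<theta> * real t \<ge> 0" using assms by simp
  hence ct: "c * real t > 1" using * by (simp add: algebra_simps)
  hence "real e = of_int \<lceil>c * real t\<rceil> - 1" unfolding e_def by simp
  hence "real e < c * real t" "real e \<ge> c * real t - 1" by linarith+
  moreover have "\<theta> * (real t + K) \<le> c * real t - 1" using * by (simp add: algebra_simps)
  ultimately show ?thesis by (intro exI[of _ t] exI[of _ e]) linarith
qed

theorem mainTheorem1:
  fixes N m s :: nat and k :: int and \<epsilon> :: real
  assumes "N \<ge> 3" and "m \<ge> 1" and "s \<ge> 1"
    and "root N (real s) = of_int k + \<epsilon>" and "0 \<le> \<epsilon>" and "\<epsilon> < 1"
    and "real s \<ge> ((1 + \<epsilon>) * (2 * real m) / (real N - 1) + 1 + \<epsilon>) ^ N"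
  shows "holds_for_general_points N s
    (\<lambda>X :: (nat \<Rightarrow> 'k::alg_closed_field) set set.
       let R = poly_ring {0..N}; I = defining_ideal N X in
         waldschmidt R I \<ge>
           (real (initial_degree (symbolic_power R I m)) + real N - 1) / (real m + real N - 1))"
proof -
  obtain \<kappa> r d where \<kappa>: "\<kappa> \<ge> 1" and cnt: "few_tops_count \<kappa> N r \<le> s"
    and dim: "s * (m + N - 1 choose N) < (d + N choose N)"
    and deg: "real d + real N - 1 < alpha_bound \<kappa> N r * (real m + real N - 1)"
    using configuration_exists[OF assms] by blast
  define \<theta> where "\<theta> = (real d + real N - 1) / (real m + real N - 1)"
  have pos: "real m + real N - 1 > 0" "real d + real N - 1 \<ge> 0" using assms(1,2) by auto
  have \<theta>: "\<theta> < alpha_bound \<kappa> N r" "0 \<le> \<theta>" unfolding \<theta>_def using deg pos by (simp_all add: field_simps)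
  obtain t e :: nat where e: "real e < alpha_bound \<kappa> N r * real t" and te: "\<theta> * (real t + real (N + 1)) \<le> real e"
    using large_order_exists[OF \<theta>, of "real (N + 1)"] by blast
  define V where "V = {1..s} \<times> {0..N}"
  obtain \<Delta> and a0 :: "nat \<times> nat \<Rightarrow> 'k" where \<Delta>: "int_poly_fun V \<Delta>" "\<Delta> a0 \<noteq> 0"
    and a0: "\<forall>i\<in>{1..s}. a0 (i, 0) \<noteq> 0" "a0 \<in> affine_space V"
    and cert: "\<And>A a G. valuation_ring A \<Longrightarrow> \<forall>i\<in>V. a i \<in> A \<Longrightarrow> \<Delta> a \<notin> max_ideal A \<Longrightarrow>
       vars_in {0..N} G \<Longrightarrow> homogeneous e G \<Longrightarrow> coeffs_in A G \<Longrightarrow>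
       \<forall>i\<in>{1..s}. vanishes_mod A t (row N a i) G \<Longrightarrow> coeffs_in (max_ideal A) G"
    using general_certificate[OF \<kappa> cnt e, where 'k = 'k] unfolding V_def by blast
  have "int_poly_fun V (\<lambda>a :: nat \<times> nat \<Rightarrow> 'k. \<Delta> a * (\<Prod>i\<in>{1..s}. a (i, 0)))"
    by (intro int_poly_fun.mult \<Delta>(1) int_poly_fun_prod int_poly_fun.var) (auto simp: V_def)
  then obtain g where g: "vars_in V g" "\<And>a :: nat \<times> nat \<Rightarrow> 'k. poly_eval a g = \<Delta> a * (\<Prod>i\<in>{1..s}. a (i, 0))"
    using int_poly_fun_imp_poly by blast
  define U where "U = {a \<in> affine_space V. poly_eval a g \<noteq> 0}"
  have "zariski_open V U" unfolding U_def by (rule zariski_open_nonvanishing[OF g(1)])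
  moreover have "a0 \<in> U" using a0 \<Delta>(2) by (simp add: U_def g(2))
  moreover have "(\<forall>i\<in>{1..s}. \<exists>j\<in>{0..N}. a (i, j) \<noteq> 0) \<and>
    (let R = poly_ring {0..N}; I = defining_ideal N ((\<lambda>i. proj_point N (\<lambda>j. a (i, j))) ` {1..s}) in
         waldschmidt R I \<ge> (real (initial_degree (symbolic_power R I m)) + real N - 1) / (real m + real N - 1))"
    if a: "a \<in> U" for a
  proof -
    have nz: "a (i, 0) \<noteq> 0" if "i \<in> {1..s}" for i using a that by (auto simp: U_def g(2))
    have \<Delta>a: "\<Delta> a \<noteq> 0" using a by (auto simp: U_def g(2))
    define W where "W = normalized_row N a ` {1..s}"
    interpret P: projective_points N W unfolding W_def by (rule projective_points_normalized_rows) (rule nz)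
    have "(\<lambda>i. proj_point N (\<lambda>j. a (i, j))) ` {1..s} = proj_point N ` W"
      unfolding W_def image_image using proj_point_normalized_row[of a _ N] nz by (intro image_cong) auto
    hence I: "defining_ideal N ((\<lambda>i. proj_point N (\<lambda>j. a (i, j))) ` {1..s}) = P.ideal_of_points"
      by (simp add: P.defining_ideal_eq)
    have N1: "N \<ge> 1" using assms(1) by simp
    have "card W \<le> s" unfolding W_def using card_image_le[of "{1..s}" "normalized_row N a"] by simp
    hence "card W * (m + N - 1 choose N) < (d + N choose N)" using dim mult_le_mono1 le_less_trans by blast
    then obtain f where f: "f \<in> symbolic_power (ring_on P.coord_ring) P.ideal_of_points m" "f \<noteq> 0" "homogeneous d f"
      using P.symbolic_power_degree_bound[OF assms(2)] by blast
    have "initial_degree (symbolic_power (ring_on P.coord_ring) P.ideal_of_points m) \<le> d" by (rule initial_degree_le[OF f])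
    hence up: "(real (initial_degree (symbolic_power (ring_on P.coord_ring) P.ideal_of_points m)) + real N - 1) / (real m + real N - 1) \<le> \<theta>"
      unfolding \<theta>_def using pos by (intro divide_right_mono) auto
    \<comment> \<open>making the coordinates and \<open>\<Delta> a\<close> units keeps the points integral and the rank condition valid\<close>
    define Q where "Q = insert (\<Delta> a) (a ` V - {0})"
    have "finite Q" "0 \<notin> Q" using \<Delta>a by (auto simp: Q_def V_def)
    then obtain A and p :: nat where A: "valuation_ring A" and p: "prime p" "of_nat p \<in> max_ideal A"
      and Q: "\<And>x. x \<in> Q \<Longrightarrow> x \<in> A \<and> inverse x \<in> A"
      using units_of_valuation_ring[of Q] by blast
    have As: "subring_of A" by (rule valuation_ring_subring[OF A])
    have aA: "\<forall>i\<in>V. a i \<in> A"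
    proof
      fix i assume "i \<in> V"
      thus "a i \<in> A" using Q[of "a i"] subring_of_zero[OF As] by (cases "a i = 0") (auto simp: Q_def)
    qed
    have dA: "\<Delta> a \<notin> max_ideal A" using Q[of "\<Delta> a"] \<Delta>a by (auto simp: max_ideal_def Q_def)
    have low: "\<theta> * real T \<le> real (initial_degree (symbolic_power (ring_on P.coord_ring) P.ideal_of_points T))" if T: "T \<ge> 1" for T
    proof -
      define D where "D = initial_degree (symbolic_power (ring_on P.coord_ring) P.ideal_of_points T)"
      obtain F where F: "F \<in> symbolic_power (ring_on P.coord_ring) P.ideal_of_points T" "F \<noteq> 0" "homogeneous D F"
        using P.initial_degree_attained[OF N1] unfolding D_def by blast
      have "F \<in> P.coord_ring" using F(1) by (simp add: symbolic_power_def)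
      hence Fv: "vars_in {0..N} F" by (simp add: P.coord_ring_def)
      have "e * T \<le> D * (t + N + 1)"
      proof (rule degree_lower_bound[OF A p _ _ Fv F(3) F(2), where J = "{1..s}" and u = "row N a"])
        show "row N a i j \<in> A" if "i \<in> {1..s}" for i j
          using that aA subring_of_zero[OF As] by (auto simp: row_def V_def)
        show "coeffs_in (max_ideal A) G"
          if "vars_in {0..N} G" "homogeneous e G" "coeffs_in A G" "\<And>i. i \<in> {1..s} \<Longrightarrow> vanishes_mod A t (row N a i) G" for G
          using cert[OF A aA dA that(1-3)] that(4) by blast
        show "vanishes T (row N a i) F" if i: "i \<in> {1..s}" for i
        proof -
          have "vanishes T (normalized_row N a i) F"
            using i by (intro P.symbolic_power_vanishes[OF F(1,3)]) (auto simp: W_def)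
          hence "vanishes T (\<lambda>j. inverse (a (i, 0)) * row N a i j) F" by (simp add: normalized_row_def[abs_def])
          thus ?thesis using nz[OF i] vanishes_scale[OF F(3), of "inverse (a (i, 0))" T "row N a i"] by simp
        qed
      qed
      hence "real (e * T) \<le> real (D * (t + N + 1))" by (rule of_nat_mono)
      hence "real e * real T \<le> real D * (real t + real (N + 1))" by (simp add: algebra_simps)
      moreover have "\<theta> * (real t + real (N + 1)) * real T \<le> real e * real T" using te by (rule mult_right_mono) simp
      ultimately have "(\<theta> * real T) * (real t + real (N + 1)) \<le> real D * (real t + real (N + 1))"
        by (simp only: mult.assoc mult.left_commute mult.commute)
      thus ?thesis unfolding D_def by (rule mult_right_le_imp_le) linarith
    qed
    have "waldschmidt (ring_on P.coord_ring) P.ideal_of_points \<ge> \<theta>" by (rule P.waldschmidt_ge[OF N1 low])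
    note order_trans[OF up this]
    moreover have "\<forall>i\<in>{1..s}. \<exists>j\<in>{0..N}. a (i, j) \<noteq> 0" using nz by force
    ultimately show ?thesis unfolding Let_def I P.ring_eq by blast
  qed
  ultimately show ?thesis unfolding holds_for_general_points_def V_def[symmetric] by blast
qed

end
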